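(* Let $p \ge 3$ be an integer and $\lambda \in \mathbb{R}$. Within the class $\mathcal{G}_p$ of $p$-colorable signed graphs, the family $\mathcal{G}_p(\lambda)$ of $p$-colorable signed graphs whose smallest eigenvalue is at least $-\lambda$ has a finite forbidden subgraph characterization if and only if $\lambda < \lambda^*$, where $\lambda^* := \rho^{1/2} + \rho^{-1/2} \approx 2.01980$ and $\rho$ is the unique real root of $x^3 = 1 + x$.
   Context: A signed graph is a (finite, simple) graph each of whose edges is labeled $+$ or $-$; its signed adjacency matrix has entry $+1$ for positive edges, $-1$ for negative edges and $0$ otherwise. The smallest eigenvalue $\lambda_1(G)$ of a signed graph $G$ is the smallest eigenvalue of its signed adjacency matrix. A signed graph is $p$-colorable if there is a coloring of its vertices with $p$ colors such that the endpoints of every negative edge receive identical colors and the endpoints of every positive edge receive different colors. $\mathcal{G}_p$ denotes the class of $p$-colorable signed graphs and $\mathcal{G}_p(\lambda)$ the family of those with $\lambda_1(G) \ge -\lambda$. Given a class $\mathcal{G}$ of signed graphs and a family $\mathcal{H} \subseteq \mathcal{G}$ closed under taking induced subgraphs, a set $\mathcal{F} \subseteq \mathcal{G}$ is a forbidden subgraph characterization of $\mathcal{H}$ within $\mathcal{G}$ if $\mathcal{H}$ consists exactly of the signed graphs in $\mathcal{G}$ that contain no member of $\mathcal{F}$ as an induced subgraph. *)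

theory Defs
  imports "HOL-Analysis.Analysis" "Jordan_Normal_Form.Char_Poly"
begin

record 'a sgraph =
  verts :: "'a set"
  pos_edges :: "'a set set"
  neg_edges :: "'a set set"

text \<open>
  Disjointness of the two edge sets says that each edge carries exactly one label.
  The graph without vertices is excluded, as it has no eigenvalues.
\<close>

definition signed_graph :: "'a sgraph \<Rightarrow> bool" where
  "signed_graph G \<longleftrightarrow>
     finite (verts G) \<and> verts G \<noteq> {} \<and>
     (\<forall>e \<in> pos_edges G \<union> neg_edges G. e \<subseteq> verts G \<and> card e = 2) \<and>
     pos_edges G \<inter> neg_edges G = {}"

definition adj_entry :: "'a sgraph \<Rightarrow> 'a \<Rightarrow> 'a \<Rightarrow> real" where
  "adj_entry G u v =
     (if {u, v} \<in> pos_edges G then 1 else if {u, v} \<in> neg_edges G then -1 else 0)"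

text \<open>
  Rows and columns of the matrix follow the increasing enumeration of the vertices.
  The spectrum does not depend on this choice of enumeration.
\<close>

definition signed_adjacency_matrix :: "'a::linorder sgraph \<Rightarrow> real mat" where
  "signed_adjacency_matrix G =
     (let vs = sorted_list_of_set (verts G)
      in mat (length vs) (length vs) (\<lambda>(i, j). adj_entry G (vs ! i) (vs ! j)))"

definition smallest_eigenvalue :: "'a::linorder sgraph \<Rightarrow> real" where
  "smallest_eigenvalue G = Min {x. eigenvalue (signed_adjacency_matrix G) x}"

definition colorable :: "nat \<Rightarrow> 'a sgraph \<Rightarrow> bool" where
  "colorable p G \<longleftrightarrow>
     (\<exists>c :: 'a \<Rightarrow> nat. (\<forall>v \<in> verts G. c v < p) \<and>
        (\<forall>u v. {u, v} \<in> neg_edges G \<longrightarrow> c u = c v) \<and>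
        (\<forall>u v. {u, v} \<in> pos_edges G \<longrightarrow> c u \<noteq> c v))"

definition induced_subgraph :: "'a sgraph \<Rightarrow> 'a set \<Rightarrow> 'a sgraph" where
  "induced_subgraph G U =
     \<lparr>verts = U,
      pos_edges = {e \<in> pos_edges G. e \<subseteq> U},
      neg_edges = {e \<in> neg_edges G. e \<subseteq> U}\<rparr>"

definition isomorphic :: "'a sgraph \<Rightarrow> 'b sgraph \<Rightarrow> bool" where
  "isomorphic G H \<longleftrightarrow>
     (\<exists>f. bij_betw f (verts G) (verts H) \<and>
        (\<lambda>e. f ` e) ` pos_edges G = pos_edges H \<and>
        (\<lambda>e. f ` e) ` neg_edges G = neg_edges H)"

definition contains_induced :: "'a sgraph \<Rightarrow> 'b sgraph \<Rightarrow> bool" where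
  "contains_induced G H \<longleftrightarrow>
     (\<exists>U \<subseteq> verts G. isomorphic (induced_subgraph G U) H)"

text \<open>
  Every finite signed graph is isomorphic to one whose vertices are natural numbers,
  so the classes below represent all isomorphism types.
\<close>

definition colorable_class :: "nat \<Rightarrow> nat sgraph set" where
  "colorable_class p = {G. signed_graph G \<and> colorable p G}"

definition colorable_family :: "nat \<Rightarrow> real \<Rightarrow> nat sgraph set" where
  "colorable_family p l = {G \<in> colorable_class p. smallest_eigenvalue G \<ge> - l}"

text \<open>
  The equation forces \<open>\<H>\<close> to be a subfamily of \<open>\<G>\<close> that is closed, within \<open>\<G>\<close>,
  under induced subgraphs, so these conditions are not repeated.
\<close>

definition forbidden_subgraph_characterization ::
    "'a sgraph set \<Rightarrow> 'a sgraph set \<Rightarrow> 'a sgraph set \<Rightarrow> bool" where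
  "forbidden_subgraph_characterization \<G> \<H> \<F> \<longleftrightarrow>
     \<F> \<subseteq> \<G> \<and> \<H> = {G \<in> \<G>. \<forall>F \<in> \<F>. \<not> contains_induced G F}"

definition rho :: real where
  "rho = (THE x. x ^ 3 = 1 + x)"

definition lambda_star :: real where
  "lambda_star = rho powr (1/2) + rho powr (-1/2)"

lemma plastic_unique:
  fixes x y :: real
  assumes x: "x ^ 3 = 1 + x" and y: "y ^ 3 = 1 + y"
  shows "x = y"
proof (rule ccontr)
  have gt: "z > 1" if z: "z ^ 3 = 1 + z" for z :: real
  proof (rule ccontr)
    assume "\<not> z > 1"
    then have "z \<le> 1" by simp
    have eq: "z * (z\<^sup>2 - 1) = 1" using z by (simp add: algebra_simps power2_eq_square power3_eq_cube)
    show False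
    proof (cases "z \<ge> -1")
      case True
      then have "\<bar>z\<bar> \<le> 1" using \<open>z \<le> 1\<close> by simp
      then have "0 \<le> z\<^sup>2" "z\<^sup>2 \<le> 1" by (simp_all add: abs_square_le_1)
      show False
      proof (cases "z = -1")
        case True then show False using eq by simp
      next
        case False
        then have "z > -1" using \<open>z \<ge> -1\<close> by simp
        have "\<bar>z\<bar> * \<bar>z\<^sup>2 - 1\<bar> = 1" using eq by (metis abs_mult abs_one)
        moreover have "\<bar>z\<bar> * \<bar>z\<^sup>2 - 1\<bar> \<le> 1 * \<bar>z\<^sup>2 - 1\<bar>"
          using \<open>\<bar>z\<bar> \<le> 1\<close> by (intro mult_right_mono) auto
        ultimately have "\<bar>z\<^sup>2 - 1\<bar> \<ge> 1" by simp
        then have "z\<^sup>2 = 0" using \<open>0 \<le> z\<^sup>2\<close> \<open>z\<^sup>2 \<le> 1\<close> by linarith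
        then show False using eq by simp
      qed
    next
      case False
      then have "z\<^sup>2 \<ge> 1" using one_less_power[of "-z" 2] by simp
      then have "z * (z\<^sup>2 - 1) \<le> 0" using False by (intro mult_nonpos_nonneg) auto
      then show False using eq by simp
    qed
  qed
  assume "x \<noteq> y"
  have "(x - y) * (x\<^sup>2 + x * y + y\<^sup>2 - 1) = 0"
    using x y by (simp add: algebra_simps power2_eq_square power3_eq_cube)
  with \<open>x \<noteq> y\<close> have "x\<^sup>2 + x * y + y\<^sup>2 = 1" by simp
  moreover have "x\<^sup>2 > 1" "x * y > 0" "y\<^sup>2 > 0"
    using gt[OF x] gt[OF y] by (auto simp: one_less_power)
  ultimately show False by linarith
qed

lemma rho_root_bounds:
  "rho ^ 3 = 1 + rho" "1.324717 \<le> rho" "rho \<le> 1.324718"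
proof -
  have "\<exists>x \<ge> 1.324717. x \<le> (1.324718::real) \<and> x ^ 3 - x = 1"
    by (rule IVT') (auto intro!: continuous_intros simp: power3_eq_cube)
  then obtain x :: real where x: "1.324717 \<le> x" "x \<le> 1.324718" "x ^ 3 = 1 + x"
    by (auto simp: algebra_simps)
  have "rho = x"
    unfolding rho_def using x(3) by (rule the_equality) (rule plastic_unique[OF _ x(3)])
  with x show "rho ^ 3 = 1 + rho" "1.324717 \<le> rho" "rho \<le> 1.324718" by simp_all
qed

lemma rho_unique_real_root: "x ^ 3 = 1 + x \<longleftrightarrow> x = rho"
  using rho_root_bounds(1) plastic_unique by blast

lemma lambda_star_approx: "\<bar>lambda_star - 2.01980\<bar> < 0.000005"
proof -
  define s where "s = sqrt rho"
  have "1.1509635 \<le> s"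
    unfolding s_def by (rule real_le_rsqrt) (use rho_root_bounds(2) in \<open>simp add: power2_eq_square\<close>)
  moreover have "s \<le> 1.1509645"
    unfolding s_def by (rule real_le_lsqrt) (use rho_root_bounds(2,3) in \<open>simp_all add: power2_eq_square\<close>)
  ultimately have s: "1.1509635 \<le> s" "s \<le> 1.1509645" .
  have eq: "lambda_star = s + 1 / s"
    using rho_root_bounds(2) unfolding lambda_star_def s_def
    by (simp add: powr_half_sqrt powr_minus_divide)
  have "1 / s \<le> 1 / 1.1509635" "1 / 1.1509645 \<le> 1 / s"
    using s by (intro divide_left_mono; simp)+
  then show ?thesis unfolding eq using s by (simp add: abs_less_iff)
qed

end

theory Submission
  imports Defs
begin

text \<open>
  The condition on the smallest eigenvalue says that the quadratic form of the adjacency matrix plus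
  \<open>l\<close> times the identity is positive semidefinite. A finite characterization exists if the minimal
  graphs that violate this at \<open>l\<close> have bounded size, and it does not exist if for every \<open>d > 0\<close> some
  graph violates it at \<open>l\<close> but not at \<open>l + d\<close>.

  Suppose \<open>l \<ge> \<lambda>\<^sup>*\<close>. Graphs with positive edges only are built by attaching stars, paths and triangles
  one after the other at the last vertex, and Gaussian elimination replaces each such graph by a single
  number, the pivot at the last vertex. If no smallest eigenvalue were in \<open>[- l - d, - l)\<close>, then the
  pivots for \<open>l\<close> and \<open>l + d\<close> would remain on the same side of the fixed point of \<open>x \<mapsto> l - 1 / x\<close>, but
  a greedy choice of the attached pieces drives them apart.

  Suppose \<open>l < \<lambda>\<^sup>*\<close>. A large minimal graph has bounded degree and is connected, so it contains a long
  induced path. The path violates the bound if \<open>l < 2\<close>; otherwise it is represented by vectors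
  \<open>\<plusminus> e\<^sub>i \<plusminus> e\<^sub>j\<close> whose inner products are the adjacency entries. The represented part grows by one vertex
  \<open>v\<close> at a time: in the graph on the coordinates, the adjacency to \<open>v\<close> determines an integral potential
  \<open>w\<close> along a breadth-first tree whose root is far from \<open>v\<close>. A charge at a coordinate can be sent towards
  the root while a fraction \<open>1 - q\<close> is left behind at each step, where \<open>q + 1 / q\<close> is slightly above
  \<open>l\<close>. This gives a vector of negative energy unless \<open>w\<close> is \<open>\<plusminus> e\<^sub>i\<close> or \<open>\<plusminus> e\<^sub>i \<plusminus> e\<^sub>j\<close> and has the correct
  inner product with every represented vertex; the extremal configurations are exactly where
  \<open>q ^ 4 + q ^ 6 > 1\<close> is needed, and equality holds there for \<open>q = 1 / sqrt rho\<close>. In the remaining case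
  \<open>v\<close> is represented too. In the end the whole graph is represented, so its smallest eigenvalue is at
  least \<open>-2\<close>.
\<close>

section \<open>Quadratic forms and the smallest eigenvalue\<close>

text \<open>For \<open>l = t + 1 / t\<close> the number \<open>t\<close> is the repelling fixed
  point of x -> l - 1 / x. Attaching a long path makes a pivot below \<open>t\<close> negative,
  while a pivot of at least \<open>t\<close> survives every path. A vertex with arms of lengths 2
  and 1 has pivot at least \<open>t\<close> exactly if t^4 + t^6 <= 1, that is, if l is at least the
  threshold. The same polynomial returns below the threshold. If the adjacency to v is the inner
  product with w, a test vector x with value 1 at v whose root vectors add up to P has energy l -
  |w|^2 + |w + P|^2 + (l - 2) |x|^2. Flows spread the charge w thinly; the least cost of a unit
  charge on an infinite ray is 1 - q. Three unit marks are too expensive, and three consecutive ones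
  are borderline, with value (1 - q^4 - q^6) / q. The obstacle is that minimality gives nonnegative
  energy only on proper induced subgraphs. The flow has to miss some represented vertex, so it ends
  before the root, and the root must be so far away that the extra cost q^(2N - 1) is
  negligible.\<close>

definition qform :: "('a \<Rightarrow> 'a \<Rightarrow> real) \<Rightarrow> 'a set \<Rightarrow> real \<Rightarrow> ('a \<Rightarrow> real) \<Rightarrow> real" where
  "qform a V l x = (\<Sum>u\<in>V. \<Sum>v\<in>V. a u v * x u * x v) + l * (\<Sum>u\<in>V. (x u)\<^sup>2)"

definition psd :: "('a \<Rightarrow> 'a \<Rightarrow> real) \<Rightarrow> 'a set \<Rightarrow> real \<Rightarrow> bool" where
  "psd a V l \<longleftrightarrow> (\<forall>x. 0 \<le> qform a V l x)"

lemma psd_mono: "psd a V l \<Longrightarrow> l \<le> l' \<Longrightarrow> psd a V l'"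
  unfolding psd_def qform_def
  by (meson add_left_mono mult_right_mono order_trans sum_nonneg zero_le_power2)

lemma qform_cong:
  assumes "\<And>u v. u \<in> V \<Longrightarrow> v \<in> V \<Longrightarrow> a u v = b u v" "\<And>u. u \<in> V \<Longrightarrow> x u = y u"
  shows "qform a V l x = qform b V l y"
  unfolding qform_def using assms by (simp cong: sum.cong)

lemma psd_cong:
  assumes "\<And>u v. u \<in> V \<Longrightarrow> v \<in> V \<Longrightarrow> a u v = b u v"
  shows "psd a V l \<longleftrightarrow> psd b V l"
  unfolding psd_def using qform_cong[of V a b] assms by metis

lemma qform_subset:
  assumes "finite V" "U \<subseteq> V" "\<And>u. u \<in> V - U \<Longrightarrow> x u = 0"
  shows "qform a V l x = qform a U l x"
proof -
  have "(\<Sum>u\<in>V. \<Sum>v\<in>V. a u v * x u * x v) = (\<Sum>u\<in>U. \<Sum>v\<in>V. a u v * x u * x v)"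
    using assms by (intro sum.mono_neutral_right) auto
  also have "\<dots> = (\<Sum>u\<in>U. \<Sum>v\<in>U. a u v * x u * x v)"
    using assms by (intro sum.cong sum.mono_neutral_right) auto
  finally show ?thesis
    unfolding qform_def using assms by (simp add: sum.mono_neutral_right[of V U])
qed

lemma psd_subset:
  assumes "finite V" "U \<subseteq> V" "psd a V l"
  shows "psd a U l"
  unfolding psd_def
proof
  fix x
  have "qform a U l x = qform a U l (\<lambda>u. if u \<in> U then x u else 0)"
    by (rule qform_cong) auto
  also have "\<dots> = qform a V l (\<lambda>u. if u \<in> U then x u else 0)"
    using assms by (intro qform_subset[symmetric]) auto
  finally show "0 \<le> qform a U l x" using assms(3) by (simp add: psd_def)
qed

lemma psd_reindex:
  assumes f: "bij_betw f V W"
    and ab: "\<And>u v. u \<in> V \<Longrightarrow> v \<in> V \<Longrightarrow> a u v = b (f u) (f v)"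
    and psd: "psd a V l"
  shows "psd b W l"
  unfolding psd_def
proof
  fix x
  have "qform b W l x = qform a V l (x \<circ> f)"
    unfolding qform_def using ab
    by (simp add: sum.reindex_bij_betw[OF f, symmetric] cong: sum.cong)
  then show "0 \<le> qform b W l x" using psd by (simp add: psd_def)
qed

lemma adj_entry_commute: "adj_entry G u v = adj_entry G v u"
  by (simp add: adj_entry_def insert_commute)

lemma adj_entry_self: "signed_graph G \<Longrightarrow> adj_entry G u u = 0"
  unfolding adj_entry_def signed_graph_def by (metis Un_iff card_1_singleton_iff
      One_nat_def insert_absorb2 numeral_eq_one_iff semiring_norm(85))

lemma adj_entry_values: "adj_entry G u v \<in> {-1, 0, 1}"
  by (simp add: adj_entry_def)

lemma eigenvalue_signed_adjacency_matrix:
  assumes "signed_graph G"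
  shows "eigenvalue (signed_adjacency_matrix G) m \<longleftrightarrow>
    (\<exists>x. (\<exists>u\<in>verts G. x u \<noteq> 0) \<and>
         (\<forall>u\<in>verts G. (\<Sum>v\<in>verts G. adj_entry G u v * x v) = m * x u))"
proof -
  define vs where "vs = sorted_list_of_set (verts G)"
  define n where "n = length vs"
  have fin: "finite (verts G)" using assms by (simp add: signed_graph_def)
  have bij: "bij_betw ((!) vs) {0..<n} (verts G)"
    using fin by (simp add: vs_def n_def bij_betw_nth atLeast0LessThan)
  define ix where "ix = the_inv_into {0..<n} ((!) vs)"
  have ix: "ix (vs ! i) = i" if "i < n" for i
    using bij that unfolding ix_def by (simp add: bij_betw_def the_inv_into_f_f)
  have M: "signed_adjacency_matrix G = mat n n (\<lambda>(i, j). adj_entry G (vs ! i) (vs ! j))"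
    by (simp add: signed_adjacency_matrix_def vs_def n_def Let_def)
  have all: "(\<forall>u\<in>verts G. P u) \<longleftrightarrow> (\<forall>i<n. P (vs ! i))" for P
    using bij unfolding bij_betw_def by (metis atLeastLessThan_iff image_iff zero_le)
  have ex: "(\<exists>u\<in>verts G. P u) \<longleftrightarrow> (\<exists>i<n. P (vs ! i))" for P
    using all[of "\<lambda>u. \<not> P u"] by blast
  have sum: "(\<Sum>v\<in>verts G. g v) = (\<Sum>j=0..<n. g (vs ! j))" for g :: "'a \<Rightarrow> real"
    by (rule sum.reindex_bij_betw[OF bij, symmetric])
  have mult: "mat n n (\<lambda>(i, j). adj_entry G (vs ! i) (vs ! j)) *\<^sub>v y = m \<cdot>\<^sub>v y \<longleftrightarrow>
      (\<forall>i<n. (\<Sum>j=0..<n. adj_entry G (vs ! i) (vs ! j) * y $ j) = m * y $ i)"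
    if "y \<in> carrier_vec n" for y
  proof -
    have "(mat n n (\<lambda>(i, j). adj_entry G (vs ! i) (vs ! j)) *\<^sub>v y) $ i =
        (\<Sum>j=0..<n. adj_entry G (vs ! i) (vs ! j) * y $ j)" if "i < n" for i
      using that \<open>y \<in> carrier_vec n\<close> by (simp add: scalar_prod_def)
    moreover have "(m \<cdot>\<^sub>v y) $ i = m * y $ i" if "i < n" for i
      using that \<open>y \<in> carrier_vec n\<close> by simp
    ultimately show ?thesis using that by (subst vec_eq_iff) auto
  qed
  show ?thesis
  proof
    assume "eigenvalue (signed_adjacency_matrix G) m"
    then obtain y where y: "y \<in> carrier_vec n" "y \<noteq> 0\<^sub>v n"
      "mat n n (\<lambda>(i, j). adj_entry G (vs ! i) (vs ! j)) *\<^sub>v y = m \<cdot>\<^sub>v y"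
      unfolding eigenvalue_def eigenvector_def M by auto
    define x where "x = (\<lambda>u. y $ ix u)"
    have "\<exists>i<n. y $ i \<noteq> 0" using y(1,2) by (metis carrier_vecD eq_vecI index_zero_vec)
    then have "\<exists>u\<in>verts G. x u \<noteq> 0" unfolding ex x_def by (auto simp: ix)
    moreover have "\<forall>u\<in>verts G. (\<Sum>v\<in>verts G. adj_entry G u v * x v) = m * x u"
      unfolding all sum x_def using mult[OF y(1)] y(3) by (auto simp: ix)
    ultimately show "\<exists>x. (\<exists>u\<in>verts G. x u \<noteq> 0) \<and>
         (\<forall>u\<in>verts G. (\<Sum>v\<in>verts G. adj_entry G u v * x v) = m * x u)" by blast
  next
    assume "\<exists>x. (\<exists>u\<in>verts G. x u \<noteq> 0) \<and>
         (\<forall>u\<in>verts G. (\<Sum>v\<in>verts G. adj_entry G u v * x v) = m * x u)"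
    then obtain x where x: "\<exists>u\<in>verts G. x u \<noteq> 0"
      "\<forall>u\<in>verts G. (\<Sum>v\<in>verts G. adj_entry G u v * x v) = m * x u" by blast
    define y where "y = vec n (\<lambda>i. x (vs ! i))"
    have "y \<in> carrier_vec n" by (simp add: y_def)
    moreover have "y \<noteq> 0\<^sub>v n" using x(1) unfolding ex y_def by (auto simp: vec_eq_iff)
    moreover have "mat n n (\<lambda>(i, j). adj_entry G (vs ! i) (vs ! j)) *\<^sub>v y = m \<cdot>\<^sub>v y"
      unfolding mult[OF \<open>y \<in> carrier_vec n\<close>] using x(2) unfolding all sum by (simp add: y_def)
    ultimately show "eigenvalue (signed_adjacency_matrix G) m"
      unfolding eigenvalue_def eigenvector_def M by auto
  qed
qed

lemma finite_eigenvalues: "finite {x. eigenvalue (signed_adjacency_matrix G) x}"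
proof -
  let ?A = "signed_adjacency_matrix G"
  define n where "n = dim_row ?A"
  have A: "?A \<in> carrier_mat n n" by (simp add: n_def signed_adjacency_matrix_def Let_def)
  have "char_poly ?A \<noteq> 0" using degree_monic_char_poly[OF A] by auto
  then have "finite {x. poly (char_poly ?A) x = 0}" by (rule poly_roots_finite)
  then show ?thesis using eigenvalue_root_char_poly[OF A] by simp
qed

lemma qform_scale: "qform a V l (\<lambda>u. c * x u) = c\<^sup>2 * qform a V l x"
  unfolding qform_def
  by (simp add: sum_distrib_left power2_eq_square algebra_simps)

text \<open>Compactness of the unit sphere over \<open>V\<close>: the coordinates outside
  \<open>V\<close> are fixed to 0 and the others lie in [-1, 1], so \<open>B\<close> is a product of
  compact sets. Homogeneity of degree 2 carries the minimum over to all vectors.\<close>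

lemma exists_rayleigh_minimizer:
  fixes a :: "'a \<Rightarrow> 'a \<Rightarrow> real"
  assumes "finite V" "V \<noteq> {}"
  shows "\<exists>x m. (\<Sum>u\<in>V. (x u)\<^sup>2) = 1 \<and> qform a V 0 x = m \<and> psd a V (-m)"
proof -
  define B where "B = (\<Pi>\<^sub>E u\<in>UNIV. if u \<in> V then {-1..1::real} else {0})"
  define K where "K = B \<inter> {x. (\<Sum>u\<in>V. (x u)\<^sup>2) = 1}"
  have "compactin (product_topology (\<lambda>u::'a. euclidean::real topology) UNIV) B"
    unfolding B_def compactin_PiE by (auto simp: compactin_euclidean_iff)
  then have "compact B" by (simp add: euclidean_product_topology compactin_euclidean_iff)
  have cont: "continuous_on UNIV (\<lambda>x::'a \<Rightarrow> real. \<Sum>u\<in>V. (x u)\<^sup>2)"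
    "continuous_on UNIV (qform a V 0 :: ('a \<Rightarrow> real) \<Rightarrow> real)"
    unfolding qform_def
    by (intro continuous_intros continuous_on_product_coordinates)+
  have "closed {x::'a \<Rightarrow> real. (\<Sum>u\<in>V. (x u)\<^sup>2) = 1}"
    using closed_Collect_eq[OF cont(1) continuous_on_const] .
  with \<open>compact B\<close> have "compact K" unfolding K_def by (rule compact_Int_closed)
  obtain u0 where u0: "u0 \<in> V" using assms by blast
  have "(\<lambda>u. if u = u0 then 1 else 0) \<in> K"
    using assms u0 by (auto simp: K_def B_def PiE_def if_distrib[of "\<lambda>z. z\<^sup>2"] cong: if_cong)
  then have "K \<noteq> {}" by blast
  have "continuous_on K (qform a V 0)" using cont(2) continuous_on_subset by blast
  from continuous_attains_inf[OF \<open>compact K\<close> \<open>K \<noteq> {}\<close> this]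
  obtain x where x: "x \<in> K" "\<And>y. y \<in> K \<Longrightarrow> qform a V 0 x \<le> qform a V 0 y" by blast
  define m where "m = qform a V 0 x"
  have "psd a V (-m)"
    unfolding psd_def
  proof
    fix y :: "'a \<Rightarrow> real"
    define s where "s = (\<Sum>u\<in>V. (y u)\<^sup>2)"
    have s0: "s \<ge> 0" by (simp add: s_def sum_nonneg)
    have split: "qform a V (-m) y = qform a V 0 y - m * s"
      by (simp add: qform_def s_def)
    show "0 \<le> qform a V (-m) y"
    proof (cases "s = 0")
      case True
      then have "y u = 0" if "u \<in> V" for u
        using assms that unfolding s_def by (simp add: sum_nonneg_eq_0_iff)
      then show ?thesis by (simp add: qform_def)
    next
      case False
      with s0 have "s > 0" by simp
      define z where "z = (\<lambda>u. if u \<in> V then y u / sqrt s else 0)"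
      have zz: "(\<Sum>u\<in>V. (z u)\<^sup>2) = 1"
      proof -
        have "(\<Sum>u\<in>V. (z u)\<^sup>2) = (\<Sum>u\<in>V. (y u)\<^sup>2 / s)"
          using \<open>s > 0\<close> by (intro sum.cong) (simp_all add: z_def power_divide)
        then show ?thesis using False by (simp add: s_def flip: sum_divide_distrib)
      qed
      have "(z u)\<^sup>2 \<le> 1" if "u \<in> V" for u
        using zz member_le_sum[of u V "\<lambda>u. (z u)\<^sup>2"] that assms(1) by simp
      then have "- 1 \<le> z u \<and> z u \<le> 1" if "u \<in> V" for u
        using that by (metis abs_le_iff abs_square_le_1 minus_le_iff)
      moreover have "z u = 0" if "u \<notin> V" for u using that by (simp add: z_def)
      ultimately have "z \<in> K" using zz by (auto simp: K_def B_def PiE_def)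
      then have "m \<le> qform a V 0 z" using x(2) by (simp add: m_def)
      moreover have "qform a V 0 y = s * qform a V 0 z"
      proof -
        have "qform a V 0 y = qform a V 0 (\<lambda>u. sqrt s * z u)"
          using \<open>s > 0\<close> by (intro qform_cong) (auto simp: z_def)
        then show ?thesis using \<open>s > 0\<close> by (simp add: qform_scale)
      qed
      ultimately show ?thesis unfolding split using \<open>s > 0\<close>
        by (simp add: mult.commute[of m])
    qed
  qed
  then show ?thesis using x(1) m_def by (auto simp: K_def)
qed

text \<open>First-order condition at a minimum: a nonzero linear term would win for a small step
  against its sign. The step is \<open>- b / d\<close>, where \<open>d\<close> is positive and above
  \<open>c\<close>.\<close>

lemma linear_coefficient_zero:
  fixes b c :: real
  assumes "\<And>t. 0 \<le> 2 * t * b + t\<^sup>2 * c"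
  shows "b = 0"
proof (rule ccontr)
  assume b: "b \<noteq> 0"
  define d where "d = \<bar>c\<bar> + 1"
  have d: "d > 0" "c < d" by (auto simp: d_def)
  have "0 \<le> 2 * (- b / d) * b + (- b / d)\<^sup>2 * c" by (rule assms)
  also have "\<dots> = b\<^sup>2 / d * (c / d - 2)"
    using d by (simp add: field_simps power2_eq_square)
  finally have "0 \<le> b\<^sup>2 / d * (c / d - 2)" .
  moreover have "b\<^sup>2 / d * (c / d - 2) < 0"
    using b d by (intro mult_pos_neg) (simp_all add: field_simps)
  ultimately show False by simp
qed

lemma qform_add_single:
  assumes "finite V" "w \<in> V" "\<And>u v. a u v = a v u" "a w w = 0"
  shows "qform a V l (\<lambda>u. x u + (if u = w then t else 0)) =
    qform a V l x + 2 * t * ((\<Sum>v\<in>V. a w v * x v) + l * x w) + t\<^sup>2 * l"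
proof -
  let ?e = "\<lambda>u. if u = w then t else 0"
  have e1: "(\<Sum>v\<in>V. a u v * y u * ?e v) = a u w * y u * t" for u y
  proof -
    have "(\<Sum>v\<in>V. a u v * y u * ?e v) = (\<Sum>v\<in>V. if v = w then a u v * y u * t else 0)"
      by (intro sum.cong) auto
    then show ?thesis using assms by simp
  qed
  have e2: "(\<Sum>u\<in>V. \<Sum>v\<in>V. a u v * ?e u * y v) = (\<Sum>v\<in>V. a w v * t * y v)" for y
  proof -
    have "(\<Sum>u\<in>V. \<Sum>v\<in>V. a u v * ?e u * y v) = (\<Sum>u\<in>V. if u = w then \<Sum>v\<in>V. a u v * t * y v else 0)"
      by (intro sum.cong) auto
    then show ?thesis using assms by simp
  qed
  have "(\<Sum>u\<in>V. \<Sum>v\<in>V. a u v * (x u + ?e u) * (x v + ?e v)) =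
      (\<Sum>u\<in>V. \<Sum>v\<in>V. a u v * x u * x v + a u v * x u * ?e v
       + (a u v * ?e u * x v + a u v * ?e u * ?e v))"
    by (intro sum.cong refl) (simp only: algebra_simps)
  also have "\<dots> = (\<Sum>u\<in>V. \<Sum>v\<in>V. a u v * x u * x v) + (\<Sum>u\<in>V. a u w * x u * t)
      + ((\<Sum>v\<in>V. a w v * t * x v) + (\<Sum>v\<in>V. a w v * t * ?e v))"
    by (simp only: sum.distrib e1 e2)
  also have "(\<Sum>v\<in>V. a w v * t * ?e v) = 0"
    using assms by (intro sum.neutral) auto
  also have "(\<Sum>u\<in>V. a u w * x u * t) = t * (\<Sum>v\<in>V. a w v * x v)"
    by (simp add: sum_distrib_left assms(3)[of _ w] mult_ac)
  also have "(\<Sum>v\<in>V. a w v * t * x v) = t * (\<Sum>v\<in>V. a w v * x v)"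
    by (simp add: sum_distrib_left mult_ac)
  finally have 1: "(\<Sum>u\<in>V. \<Sum>v\<in>V. a u v * (x u + ?e u) * (x v + ?e v)) =
      (\<Sum>u\<in>V. \<Sum>v\<in>V. a u v * x u * x v) + 2 * t * (\<Sum>v\<in>V. a w v * x v)"
    by simp
  have "(\<Sum>u\<in>V. (x u + ?e u)\<^sup>2) = (\<Sum>u\<in>V. (x u)\<^sup>2 + (if u = w then 2 * x w * t + t\<^sup>2 else 0))"
    by (intro sum.cong) (auto simp: power2_sum)
  also have "\<dots> = (\<Sum>u\<in>V. (x u)\<^sup>2) + (2 * x w * t + t\<^sup>2)"
    using assms by (simp add: sum.distrib)
  finally show ?thesis unfolding qform_def 1 by (simp add: algebra_simps)
qed

text \<open>At a Rayleigh minimizer the derivative in every coordinate direction vanishes, so the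
  minimum is an eigenvalue; testing the form with an eigenvector shows that no eigenvalue lies below
  it. This replaces matrices by \<open>psd\<close> in the rest of the argument.\<close>

lemma smallest_eigenvalue_ge_iff:
  assumes "signed_graph G"
  shows "- l \<le> smallest_eigenvalue G \<longleftrightarrow> psd (adj_entry G) (verts G) l"
proof -
  let ?V = "verts G" and ?a = "adj_entry G"
  let ?S = "{x. eigenvalue (signed_adjacency_matrix G) x}"
  have V: "finite ?V" "?V \<noteq> {}" using assms by (auto simp: signed_graph_def)
  obtain x m where x: "(\<Sum>u\<in>?V. (x u)\<^sup>2) = 1" "qform ?a ?V 0 x = m" "psd ?a ?V (-m)"
    using exists_rayleigh_minimizer[OF V] by blast
  have q0: "qform ?a ?V (-m) x = 0" using x(1,2) by (simp add: qform_def)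
  have "(\<Sum>v\<in>?V. ?a w v * x v) + (-m) * x w = 0" if "w \<in> ?V" for w
  proof (rule linear_coefficient_zero)
    fix t
    have "0 \<le> qform ?a ?V (-m) (\<lambda>u. x u + (if u = w then t else 0))"
      using x(3) by (simp add: psd_def)
    then show "0 \<le> 2 * t * ((\<Sum>v\<in>?V. ?a w v * x v) + (-m) * x w) + t\<^sup>2 * (-m)"
      using qform_add_single[of ?V w ?a "-m" x t] V that q0
      by (simp add: adj_entry_commute adj_entry_self[OF assms])
  qed
  then have "\<forall>u\<in>?V. (\<Sum>v\<in>?V. ?a u v * x v) = m * x u" by simp
  moreover have "\<exists>u\<in>?V. x u \<noteq> 0" using x(1) by (metis power_zero_numeral sum.neutral zero_neq_one)
  ultimately have "eigenvalue (signed_adjacency_matrix G) m"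
    using eigenvalue_signed_adjacency_matrix[OF assms, of m, THEN iffD2, OF exI[of _ x]] by simp
  then have m: "m \<in> ?S" by simp
  have ge: "- l \<le> c" if "c \<in> ?S" "psd ?a ?V l" for c l
  proof -
    have "eigenvalue (signed_adjacency_matrix G) c" using that(1) by simp
    from iffD1[OF eigenvalue_signed_adjacency_matrix[OF assms] this]
    obtain y where y: "\<exists>u\<in>?V. y u \<noteq> 0" "\<forall>u\<in>?V. (\<Sum>v\<in>?V. ?a u v * y v) = c * y u"
      by (elim exE conjE)
    have "qform ?a ?V l y = (\<Sum>u\<in>?V. y u * (\<Sum>v\<in>?V. ?a u v * y v)) + l * (\<Sum>u\<in>?V. (y u)\<^sup>2)"
      unfolding qform_def by (simp add: sum_distrib_left mult_ac)
    also have "(\<Sum>u\<in>?V. y u * (\<Sum>v\<in>?V. ?a u v * y v)) = c * (\<Sum>u\<in>?V. (y u)\<^sup>2)"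
      using y(2) by (simp add: sum_distrib_left power2_eq_square mult_ac)
    also have "c * (\<Sum>u\<in>?V. (y u)\<^sup>2) + l * (\<Sum>u\<in>?V. (y u)\<^sup>2) = (c + l) * (\<Sum>u\<in>?V. (y u)\<^sup>2)"
      by (simp add: distrib_right)
    finally have "0 \<le> (c + l) * (\<Sum>u\<in>?V. (y u)\<^sup>2)"
      using that(2) unfolding psd_def by metis
    moreover have "(\<Sum>u\<in>?V. (y u)\<^sup>2) > 0"
    proof -
      obtain u where "u \<in> ?V" "y u \<noteq> 0" using y(1) by (elim bexE)
      then show ?thesis using V(1) by (intro sum_pos2[of _ u]) auto
    qed
    ultimately show ?thesis by (simp add: zero_le_mult_iff)
  qed
  have "smallest_eigenvalue G = m"
    unfolding smallest_eigenvalue_def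
  proof (rule Min_eqI[OF finite_eigenvalues _ m])
    fix y assume "y \<in> ?S"
    from ge[OF this x(3)] show "m \<le> y" by simp
  qed
  then show ?thesis using ge[OF m] x(3) psd_mono[of ?a ?V "-m" l] by auto
qed

section \<open>Induced subgraphs and minimal forbidden subgraphs\<close>

lemma adj_entry_induced:
  "u \<in> U \<Longrightarrow> v \<in> U \<Longrightarrow> adj_entry (induced_subgraph G U) u v = adj_entry G u v"
  by (simp add: adj_entry_def induced_subgraph_def)

lemma psd_isomorphic:
  assumes "isomorphic G H" "\<And>e. e \<in> pos_edges G \<union> neg_edges G \<Longrightarrow> e \<subseteq> verts G"
    "psd (adj_entry G) (verts G) l"
  shows "psd (adj_entry H) (verts H) l"
proof -
  obtain f where f: "bij_betw f (verts G) (verts H)"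
    "(\<lambda>e. f ` e) ` pos_edges G = pos_edges H" "(\<lambda>e. f ` e) ` neg_edges G = neg_edges H"
    using assms(1) by (auto simp: isomorphic_def)
  have inj: "inj_on f (verts G)" using f(1) by (simp add: bij_betw_def)
  have mem: "{f u, f v} \<in> (\<lambda>e. f ` e) ` E \<longleftrightarrow> {u, v} \<in> E"
    if "u \<in> verts G" "v \<in> verts G" "\<And>e. e \<in> E \<Longrightarrow> e \<subseteq> verts G" for u v E
  proof
    assume "{f u, f v} \<in> (\<lambda>e. f ` e) ` E"
    then obtain e where e: "e \<in> E" "f ` {u, v} = f ` e" by auto
    then have "{u, v} = e"
      using inj_on_image_eq_iff[OF inj, of "{u, v}" e] that by auto
    with e show "{u, v} \<in> E" by simp
  qed (auto intro!: image_eqI[of _ _ "{u, v}"])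
  show ?thesis
  proof (rule psd_reindex[OF f(1) _ assms(3)])
    fix u v assume uv: "u \<in> verts G" "v \<in> verts G"
    show "adj_entry G u v = adj_entry H (f u) (f v)"
      unfolding adj_entry_def f(2,3)[symmetric] using mem[OF uv] assms(2) by simp
  qed
qed

lemma contains_induced_psd:
  assumes "signed_graph G" "contains_induced G F" "psd (adj_entry G) (verts G) l"
  shows "psd (adj_entry F) (verts F) l"
proof -
  obtain U where U: "U \<subseteq> verts G" "isomorphic (induced_subgraph G U) F"
    using assms(2) by (auto simp: contains_induced_def)
  have "psd (adj_entry G) U l"
    using psd_subset[OF _ U(1) assms(3)] assms(1) by (simp add: signed_graph_def)
  then have "psd (adj_entry (induced_subgraph G U)) (verts (induced_subgraph G U)) l"
    using psd_cong[of U "adj_entry (induced_subgraph G U)" "adj_entry G" l, OF adj_entry_induced]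
    by (simp add: induced_subgraph_def)
  from psd_isomorphic[OF U(2) _ this] show ?thesis by (auto simp: induced_subgraph_def)
qed

lemma contains_induced_refl:
  assumes "signed_graph G"
  shows "contains_induced G G"
proof -
  have "induced_subgraph G (verts G) = G"
    using assms by (cases G) (auto simp: induced_subgraph_def signed_graph_def)
  moreover have "isomorphic G G" unfolding isomorphic_def by (rule exI[of _ id]) auto
  ultimately show ?thesis unfolding contains_induced_def by auto
qed

text \<open>Small vertex sets inside arbitrary graphs consist of unboundedly large numbers. Only
  after moving them to an initial segment are there finitely many obstructions.\<close>

lemma induced_subgraph_relabel:
  assumes G: "G \<in> colorable_class p" and U: "U \<subseteq> verts G" "U \<noteq> {}"
  shows "\<exists>F \<in> colorable_class p. verts F = {0..<card U} \<and> isomorphic (induced_subgraph G U) F"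
proof -
  have sg: "signed_graph G" using G by (simp add: colorable_class_def)
  have fin: "finite U" using U sg by (meson finite_subset signed_graph_def)
  obtain f where f: "bij_betw f U {0..<card U}"
    using ex_bij_betw_finite_nat[OF fin] by blast
  then have inj: "inj_on f U" by (simp add: bij_betw_def)
  define P where "P = {e \<in> pos_edges G. e \<subseteq> U}"
  define N where "N = {e \<in> neg_edges G. e \<subseteq> U}"
  define F where "F = \<lparr>verts = {0..<card U}, pos_edges = (\<lambda>e. f ` e) ` P, neg_edges = (\<lambda>e. f ` e) ` N\<rparr>"
  have card_img: "f ` e \<subseteq> {0..<card U} \<and> card (f ` e) = 2" if "e \<in> P \<union> N" for e
  proof -
    have "e \<subseteq> U" "card e = 2" using that sg by (auto simp: P_def N_def signed_graph_def)
    then show ?thesis using f inj by (metis bij_betw_def card_image image_mono inj_on_subset)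
  qed
  have "(\<lambda>e. f ` e) ` P \<inter> (\<lambda>e. f ` e) ` N = {}"
  proof -
    have same: "e = e'" if "f ` e = f ` e'" "e \<in> P" "e' \<in> N" for e e'
      using inj_on_image_eq_iff[OF inj, of e e'] that by (auto simp: P_def N_def)
    have "(\<lambda>e. f ` e) ` P \<inter> (\<lambda>e. f ` e) ` N \<subseteq> (\<lambda>e. f ` e) ` (P \<inter> N)"
    proof (intro subsetI)
      fix x assume *: "x \<in> (\<lambda>e. f ` e) ` P \<inter> (\<lambda>e. f ` e) ` N"
      obtain e where e: "e \<in> P" "x = f ` e" using * by (elim IntE imageE)
      obtain e' where e': "e' \<in> N" "x = f ` e'" using * by (elim IntE imageE)
      have "e = e'" using same[of e e'] e e' by simp
      then show "x \<in> (\<lambda>e. f ` e) ` (P \<inter> N)" using e e' by simp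
    qed
    moreover have "pos_edges G \<inter> neg_edges G = {}" using sg by (simp add: signed_graph_def)
    then have "P \<inter> N = {}" by (auto simp: P_def N_def)
    ultimately show ?thesis by simp
  qed
  then have sF: "signed_graph F"
    unfolding signed_graph_def
  proof (intro conjI ballI)
    show "verts F \<noteq> {}" using U fin by (simp add: F_def card_gt_0_iff)
    fix e assume "e \<in> pos_edges F \<union> neg_edges F"
    then obtain e' where "e' \<in> P \<union> N" "e = f ` e'" by (auto simp: F_def)
    then show "e \<subseteq> verts F" "card e = 2" using card_img[of e'] by (auto simp: F_def)
  qed (auto simp: F_def)
  obtain c where c: "\<forall>v \<in> verts G. c v < p" "\<forall>u v. {u, v} \<in> neg_edges G \<longrightarrow> c u = c v"
    "\<forall>u v. {u, v} \<in> pos_edges G \<longrightarrow> c u \<noteq> c v"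
    using G by (auto simp: colorable_class_def colorable_def)
  define g where "g = the_inv_into U f"
  have g: "g (f u) = u" if "u \<in> U" for u
    using that inj by (simp add: g_def the_inv_into_f_f)
  have gU: "g i \<in> U" if "i < card U" for i
    using that f unfolding g_def bij_betw_def by (metis atLeastLessThan_iff order_refl the_inv_into_into zero_le)
  have dest: "{g i, g j} \<in> E" if mem: "{i, j} \<in> (\<lambda>e. f ` e) ` E"
    and sub: "\<And>e. e \<in> E \<Longrightarrow> e \<subseteq> U" for i j E
  proof -
    obtain e where e: "e \<in> E" "{i, j} = f ` e" using mem by auto
    have "g ` f ` e = (\<lambda>u. u) ` e"
      unfolding image_image by (rule image_cong) (use g sub[OF e(1)] in auto)
    then have "g ` {i, j} = e" using e(2) by simp
    then show ?thesis using e(1) by simp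
  qed
  have "colorable p F"
    unfolding colorable_def
  proof (intro exI[of _ "\<lambda>i. c (g i)"] conjI ballI allI impI)
    fix i assume "i \<in> verts F"
    then have "g i \<in> verts G" using gU U(1) by (auto simp: F_def)
    then show "c (g i) < p" using c(1) by blast
  next
    fix i j assume "{i, j} \<in> neg_edges F"
    then have "{g i, g j} \<in> N" by (intro dest) (simp_all add: F_def N_def)
    then show "c (g i) = c (g j)" using c(2) unfolding N_def by blast
  next
    fix i j assume "{i, j} \<in> pos_edges F"
    then have "{g i, g j} \<in> P" by (intro dest) (simp_all add: F_def P_def)
    then show "c (g i) \<noteq> c (g j)" using c(3) unfolding P_def by blast
  qed
  moreover have "isomorphic (induced_subgraph G U) F"
    unfolding isomorphic_def using f by (auto simp: F_def induced_subgraph_def P_def N_def)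
  ultimately show ?thesis using sF by (intro bexI[of _ F]) (auto simp: colorable_class_def F_def)
qed

lemma finite_sgraphs_on:
  assumes "finite A"
  shows "finite {F :: 'a sgraph. signed_graph F \<and> verts F \<subseteq> A}"
proof (rule finite_subset)
  show "{F. signed_graph F \<and> verts F \<subseteq> A} \<subseteq>
    (\<lambda>(V, P, N). \<lparr>verts = V, pos_edges = P, neg_edges = N\<rparr>) ` (Pow A \<times> Pow (Pow A) \<times> Pow (Pow A))"
  proof
    fix F :: "'a sgraph" assume "F \<in> {F. signed_graph F \<and> verts F \<subseteq> A}"
    then have "(verts F, pos_edges F, neg_edges F) \<in> Pow A \<times> Pow (Pow A) \<times> Pow (Pow A)"
      unfolding signed_graph_def by fastforce
    then show "F \<in> (\<lambda>(V, P, N). \<lparr>verts = V, pos_edges = P, neg_edges = N\<rparr>) ` (Pow A \<times> Pow (Pow A) \<times> Pow (Pow A))"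
      by (rule rev_image_eqI) simp
  qed
  show "finite ((\<lambda>(V, P, N). \<lparr>verts = V, pos_edges = P, neg_edges = N\<rparr>) ` (Pow A \<times> Pow (Pow A) \<times> Pow (Pow A)))"
    using assms by blast
qed

lemma colorable_family_iff:
  "G \<in> colorable_family p l \<longleftrightarrow> G \<in> colorable_class p \<and> psd (adj_entry G) (verts G) l"
  by (auto simp: colorable_family_def colorable_class_def smallest_eigenvalue_ge_iff)

text \<open>The family consists of all violating members of the class with vertices below
  \<open>M\<close>, without minimality. A graph containing one of them violates the bound by
  interlacing, and a violating graph contains a relabelled copy of a small violating vertex
  set.\<close>

lemma finite_characterization_if_bounded:
  assumes "\<And>G. G \<in> colorable_class p \<Longrightarrow> \<not> psd (adj_entry G) (verts G) l \<Longrightarrow>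
    \<exists>U \<subseteq> verts G. card U \<le> M \<and> \<not> psd (adj_entry G) U l"
  shows "\<exists>\<F>. finite \<F> \<and>
    forbidden_subgraph_characterization (colorable_class p) (colorable_family p l) \<F>"
proof -
  let ?F = "{F \<in> colorable_class p. verts F \<subseteq> {0..<M} \<and> \<not> psd (adj_entry F) (verts F) l}"
  have fin: "finite ?F"
    by (rule finite_subset[OF _ finite_sgraphs_on[of "{0..<M}"]]) (auto simp: colorable_class_def)
  have char: "G \<in> colorable_family p l \<longleftrightarrow> (\<forall>F\<in>?F. \<not> contains_induced G F)"
    if G: "G \<in> colorable_class p" for G
  proof
    assume "G \<in> colorable_family p l"
    then show "\<forall>F\<in>?F. \<not> contains_induced G F"
      using contains_induced_psd G by (auto simp: colorable_family_iff colorable_class_def)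
  next
    assume *: "\<forall>F\<in>?F. \<not> contains_induced G F"
    show "G \<in> colorable_family p l"
    proof (rule ccontr)
      assume "G \<notin> colorable_family p l"
      then have "\<not> psd (adj_entry G) (verts G) l" using G by (simp add: colorable_family_iff)
      then obtain U where U: "U \<subseteq> verts G" "card U \<le> M" "\<not> psd (adj_entry G) U l"
        using assms G by blast
      then have "U \<noteq> {}" by (auto simp: psd_def qform_def)
      then obtain F where F: "F \<in> colorable_class p" "verts F = {0..<card U}"
        "isomorphic (induced_subgraph G U) F" using induced_subgraph_relabel G U by blast
      obtain f where f: "bij_betw f U {0..<card U}"
        "(\<lambda>e. f ` e) ` {e \<in> pos_edges G. e \<subseteq> U} = pos_edges F"
        "(\<lambda>e. f ` e) ` {e \<in> neg_edges G. e \<subseteq> U} = neg_edges F"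
        using F(3) F(2) by (auto simp: isomorphic_def induced_subgraph_def)
      have mem: "{f u, f v} \<in> (\<lambda>e. f ` e) ` {e \<in> E. e \<subseteq> U} \<longleftrightarrow> {u, v} \<in> E"
        if "u \<in> U" "v \<in> U" for u v E
      proof
        assume "{f u, f v} \<in> (\<lambda>e. f ` e) ` {e \<in> E. e \<subseteq> U}"
        then obtain e where e: "e \<in> E" "e \<subseteq> U" "f ` {u, v} = f ` e" by auto
        then have "{u, v} = e"
          using inj_on_image_eq_iff[of f U "{u, v}" e] f(1) that by (auto simp: bij_betw_def)
        with e show "{u, v} \<in> E" by simp
      qed (use that in \<open>auto intro!: image_eqI[of _ _ "{u, v}"]\<close>)
      have "\<not> psd (adj_entry F) (verts F) l"
      proof
        assume psd: "psd (adj_entry F) (verts F) l"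
        have bij: "bij_betw (the_inv_into U f) (verts F) U"
          unfolding F(2) by (rule bij_betw_the_inv_into[OF f(1)])
        have "psd (adj_entry G) U l"
        proof (rule psd_reindex[OF bij _ psd])
          fix i j assume ij: "i \<in> verts F" "j \<in> verts F"
          have "verts F = f ` U" using f(1) F(2) by (simp add: bij_betw_def)
          then obtain u v where uv: "u \<in> U" "v \<in> U" "i = f u" "j = f v"
            using ij by (elim equalityE) blast
          then have "the_inv_into U f i = u" "the_inv_into U f j = v"
            using f(1) by (auto simp: bij_betw_def the_inv_into_f_f)
          then show "adj_entry F i j = adj_entry G (the_inv_into U f i) (the_inv_into U f j)"
            unfolding adj_entry_def f(2,3)[symmetric] uv(3,4)
            using mem[OF uv(1,2), of "pos_edges G"] mem[OF uv(1,2), of "neg_edges G"] by simp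
        qed
        with U(3) show False by simp
      qed
      moreover have "contains_induced G F"
        using F(3) U(1) by (auto simp: contains_induced_def)
      ultimately show False using * F U(2) by auto
    qed
  qed
  have "colorable_family p l = {G \<in> colorable_class p. \<forall>F\<in>?F. \<not> contains_induced G F}"
  proof (rule Set.set_eqI)
    fix G
    have "G \<in> colorable_family p l \<Longrightarrow> G \<in> colorable_class p"
      by (simp add: colorable_family_def)
    then show "G \<in> colorable_family p l \<longleftrightarrow>
        G \<in> {G \<in> colorable_class p. \<forall>F\<in>?F. \<not> contains_induced G F}"
      using char[of G] unfolding mem_Collect_eq by argo
  qed
  then have "forbidden_subgraph_characterization (colorable_class p) (colorable_family p l) ?F"
    unfolding forbidden_subgraph_characterization_def by (rule conjI[OF Collect_restrict])
  with fin show ?thesis by blast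
qed

text \<open>The smallest eigenvalues of finitely many forbidden graphs stay below \<open>- l\<close>
  by a fixed amount. A graph whose smallest eigenvalue lies in the upper half of this gap contains
  none of them by interlacing, yet it is outside the family.\<close>

lemma no_finite_characterization_if_limit:
  assumes "\<And>d. d > 0 \<Longrightarrow> \<exists>G \<in> colorable_class p.
    \<not> psd (adj_entry G) (verts G) l \<and> psd (adj_entry G) (verts G) (l + d)"
  shows "\<not> (\<exists>\<F>. finite \<F> \<and>
    forbidden_subgraph_characterization (colorable_class p) (colorable_family p l) \<F>)"
proof
  assume "\<exists>\<F>. finite \<F> \<and>
    forbidden_subgraph_characterization (colorable_class p) (colorable_family p l) \<F>"
  then obtain \<F> where fin: "finite \<F>" and sub: "\<F> \<subseteq> colorable_class p"
    and char: "colorable_family p l = {G \<in> colorable_class p. \<forall>F \<in> \<F>. \<not> contains_induced G F}"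
    by (auto simp: forbidden_subgraph_characterization_def)
  have bad: "\<not> psd (adj_entry F) (verts F) l" if "F \<in> \<F>" for F
  proof
    assume "psd (adj_entry F) (verts F) l"
    then have "F \<in> colorable_family p l" using that sub by (auto simp: colorable_family_iff)
    moreover have "contains_induced F F"
      using that sub by (intro contains_induced_refl) (auto simp: colorable_class_def)
    ultimately show False using char that by auto
  qed
  have sg: "signed_graph F" if "F \<in> \<F>" for F
    using that sub by (auto simp: colorable_class_def)
  have lt: "smallest_eigenvalue F < - l" if "F \<in> \<F>" for F
    using bad[OF that] smallest_eigenvalue_ge_iff[OF sg[OF that], of l] by auto
  \<comment> \<open>The inserted value \<open>- l - 1\<close> keeps the maximum defined for an empty
    family and lies below \<open>- l\<close> like the others.\<close>
  define e where "e = Max (insert (- l - 1) (smallest_eigenvalue ` \<F>))"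
  have e: "e < - l" "\<And>F. F \<in> \<F> \<Longrightarrow> smallest_eigenvalue F \<le> e"
    using fin lt by (auto simp: e_def)
  obtain G where G: "G \<in> colorable_class p" "\<not> psd (adj_entry G) (verts G) l"
    "psd (adj_entry G) (verts G) (l + (- l - e) / 2)"
    using assms[of "(- l - e) / 2"] e(1) by auto
  then have "G \<notin> colorable_family p l" by (simp add: colorable_family_iff)
  then obtain F where F: "F \<in> \<F>" "contains_induced G F" using char G(1) by blast
  have "psd (adj_entry F) (verts F) (l + (- l - e) / 2)"
    using contains_induced_psd[OF _ F(2) G(3)] G(1) by (simp add: colorable_class_def)
  then have "- (l + (- l - e) / 2) \<le> smallest_eigenvalue F"
    unfolding smallest_eigenvalue_ge_iff[OF sg[OF F(1)]] .
  with e(2)[OF F(1)] e(1) show False by (simp add: field_simps)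
qed

section \<open>Chains of all-positive graphs\<close>

text \<open>All edges will be positive, so colorability means a proper coloring. The colors are
  bounded on all numbers, which lets \<open>c(n := k)\<close> color a new vertex without side
  conditions.\<close>

definition chain_graph :: "nat \<Rightarrow> nat set set \<Rightarrow> bool" where
  "chain_graph n E \<longleftrightarrow> 0 < n \<and> (\<forall>e\<in>E. e \<subseteq> {..<n} \<and> card e = 2) \<and>
     (\<exists>c. (\<forall>v. c v < (3::nat)) \<and> (\<forall>u v. {u, v} \<in> E \<longrightarrow> c u \<noteq> c v))"

definition chain_form :: "nat \<Rightarrow> nat set set \<Rightarrow> real \<Rightarrow> (nat \<Rightarrow> real) \<Rightarrow> real" where
  "chain_form n E = qform (\<lambda>u v. if {u, v} \<in> E then 1 else 0) {..<n}"

definition star_edges :: "nat \<Rightarrow> nat set \<Rightarrow> nat set set" where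
  "star_edges n A = (\<lambda>a. {n, a}) ` A"

lemma chain_form_extend:
  assumes E: "\<And>e. e \<in> E \<Longrightarrow> e \<subseteq> {..<n}" and A: "A \<subseteq> {..<n}"
  shows "chain_form (Suc n) (E \<union> star_edges n A) l x =
    chain_form n E l x + 2 * x n * (\<Sum>a\<in>A. x a) + l * (x n)\<^sup>2"
proof -
  let ?F = "E \<union> star_edges n A"
  have old: "{u, v} \<in> ?F \<longleftrightarrow> {u, v} \<in> E" if "u < n" "v < n" for u v
    using that A unfolding star_edges_def by (auto simp: doubleton_eq_iff)
  have new: "{n, v} \<in> ?F \<longleftrightarrow> v \<in> A" if "v < n" for v
    using that A E[of "{n, v}"] unfolding star_edges_def by (auto simp: doubleton_eq_iff)
  have new': "{v, n} \<in> ?F \<longleftrightarrow> v \<in> A" if "v < n" for v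
    using new[OF that] by (simp add: insert_commute)
  have self: "{n, n} \<notin> ?F"
    using A E[of "{n}"] unfolding star_edges_def by (auto simp: doubleton_eq_iff)
  have sumA: "(\<Sum>v<n. if v \<in> A then y * x v else 0) = y * (\<Sum>a\<in>A. x a)" for y
  proof -
    have "(\<Sum>v<n. if v \<in> A then y * x v else 0) = (\<Sum>v\<in>{..<n} \<inter> A. y * x v)"
      by (simp add: sum.inter_restrict)
    also have "{..<n} \<inter> A = A" using A by blast
    finally show ?thesis by (simp add: sum_distrib_left)
  qed
  have 1: "(\<Sum>v<n. (if {n, v} \<in> ?F then 1 else 0) * x n * x v) = x n * (\<Sum>a\<in>A. x a)"
    unfolding sumA[symmetric] using new by (intro sum.cong) auto
  have 2: "(\<Sum>v<n. (if {v, n} \<in> ?F then 1 else 0) * x v * x n) = x n * (\<Sum>a\<in>A. x a)"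
    unfolding sumA[symmetric] using new' by (intro sum.cong) auto
  have 3: "(\<Sum>u<n. \<Sum>v<n. (if {u, v} \<in> ?F then 1 else 0) * x u * x v) =
      (\<Sum>u<n. \<Sum>v<n. (if {u, v} \<in> E then 1 else 0) * x u * x v)"
    using old by (intro sum.cong) auto
  have "(\<Sum>u<Suc n. \<Sum>v<Suc n. (if {u, v} \<in> ?F then 1 else 0) * x u * x v) =
     (\<Sum>u<n. \<Sum>v<n. (if {u, v} \<in> ?F then 1 else 0) * x u * x v)
     + (\<Sum>v<n. (if {v, n} \<in> ?F then 1 else 0) * x v * x n)
     + (\<Sum>v<n. (if {n, v} \<in> ?F then 1 else 0) * x n * x v)
     + (if {n, n} \<in> ?F then 1 else 0) * x n * x n"
    by (simp only: sum.lessThan_Suc sum.distrib add.assoc)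
  then have "(\<Sum>u<Suc n. \<Sum>v<Suc n. (if {u, v} \<in> ?F then 1 else 0) * x u * x v) =
     (\<Sum>u<n. \<Sum>v<n. (if {u, v} \<in> E then 1 else 0) * x u * x v) + 2 * x n * (\<Sum>a\<in>A. x a)"
    unfolding 1 2 3 using self by simp
  then show ?thesis
    unfolding chain_form_def qform_def by (simp add: distrib_left)
qed

lemma chain_graph_edge: "chain_graph n E \<Longrightarrow> e \<in> E \<Longrightarrow> e \<subseteq> {..<n}"
  by (simp add: chain_graph_def)

text \<open>A new vertex with at most two neighbors finds one of three colors free; this covers
  leaves, paths and triangles.\<close>

lemma chain_graph_extend:
  assumes E: "chain_graph n E" and A: "A \<subseteq> {..<n}" "card A \<le> 2"
  shows "chain_graph (Suc n) (E \<union> star_edges n A)"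
proof -
  obtain c where c: "\<And>v. c v < (3::nat)" "\<And>u v. {u, v} \<in> E \<Longrightarrow> c u \<noteq> c v"
    using E by (auto simp: chain_graph_def)
  have "card (c ` A) \<le> 2" using A by (meson card_image_le finite_lessThan finite_subset le_trans)
  then have "\<not> {..<3} \<subseteq> c ` A"
    using A(1) card_mono[of "c ` A" "{..<3::nat}"] by (auto dest: finite_subset)
  then obtain k where k: "k < 3" "k \<notin> c ` A" by auto
  have cov: "e \<subseteq> {..<n}" "card e = 2" if "e \<in> E" for e using E that by (auto simp: chain_graph_def)
  have "(c(n := k)) u \<noteq> (c(n := k)) v" if uv: "{u, v} \<in> E \<union> star_edges n A" for u v
  proof (cases "{u, v} \<in> E")
    case True
    then show ?thesis using cov[OF True] c(2)[OF True] by auto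
  next
    case False
    then obtain a where "a \<in> A" "{u, v} = {n, a}" using uv by (auto simp: star_edges_def)
    then show ?thesis using k A(1) by (auto simp: doubleton_eq_iff)
  qed
  moreover have "(c(n := k)) v < 3" for v using c(1) k by simp
  moreover have "e \<subseteq> {..<Suc n} \<and> card e = 2" if mem: "e \<in> E \<union> star_edges n A" for e
  proof (cases "e \<in> E")
    case True then show ?thesis using cov[OF True] by auto
  next
    case False
    then obtain a where "a \<in> A" "e = {n, a}" using mem by (auto simp: star_edges_def)
    then show ?thesis using A(1) by auto
  qed
  ultimately show ?thesis unfolding chain_graph_def by blast
qed

lemma chain_graph_realize:
  assumes "chain_graph n E" "p \<ge> 3"
  shows "\<exists>G \<in> colorable_class p. \<forall>l. psd (adj_entry G) (verts G) l \<longleftrightarrow> (\<forall>x. 0 \<le> chain_form n E l x)"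
proof -
  let ?G = "\<lparr>verts = {..<n}, pos_edges = E, neg_edges = {}\<rparr>"
  obtain c where c: "\<And>v. c v < (3::nat)" "\<And>u v. {u, v} \<in> E \<Longrightarrow> c u \<noteq> c v"
    using assms by (auto simp: chain_graph_def)
  have "colorable p ?G"
    unfolding colorable_def using c assms(2) by (intro exI[of _ c]) (auto intro: less_le_trans)
  moreover have "signed_graph ?G"
    using assms(1) unfolding signed_graph_def chain_graph_def by (auto simp: lessThan_empty_iff)
  moreover have "adj_entry ?G = (\<lambda>u v. if {u, v} \<in> E then 1 else 0)"
    by (simp add: adj_entry_def fun_eq_iff)
  ultimately show ?thesis
    by (intro bexI[of _ ?G]) (simp_all add: colorable_class_def psd_def chain_form_def)
qed

section \<open>Pivots under attachment of leaves, paths and triangles\<close>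

text \<open>The pivot of the last vertex \<open>z\<close> in Gaussian elimination: the minimum of the form
  subject to \<open>x z = 1\<close>.\<close>

definition pivot :: "nat \<Rightarrow> nat set set \<Rightarrow> nat \<Rightarrow> real \<Rightarrow> real \<Rightarrow> bool" where
  "pivot n E z l d \<longleftrightarrow> z < n \<and> (\<forall>x. d * (x z)\<^sup>2 \<le> chain_form n E l x) \<and>
     (\<exists>x. x z = 1 \<and> chain_form n E l x = d)"

text \<open>One graph and one vertex are seen at both levels \<open>l\<close> and \<open>l'\<close>,
  so that every attachment acts on the pair of pivots simultaneously.\<close>

definition pivots :: "real \<Rightarrow> real \<Rightarrow> real \<Rightarrow> real \<Rightarrow> bool" where
  "pivots l l' d d' \<longleftrightarrow> (\<exists>n E z. chain_graph n E \<and> pivot n E z l d \<and> pivot n E z l' d')"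

lemma chain_form_scale: "chain_form n E l (\<lambda>u. c * x u) = c\<^sup>2 * chain_form n E l x"
  by (simp add: chain_form_def qform_scale)

lemma chain_form_cong: "(\<And>u. u < n \<Longrightarrow> x u = y u) \<Longrightarrow> chain_form n E l x = chain_form n E l y"
  unfolding chain_form_def by (rule qform_cong) auto

lemma pivot_attained:
  assumes "pivot n E z l d"
  shows "\<exists>x. x z = c \<and> (\<forall>u\<ge>n. x u = y u) \<and> chain_form n E l x = d * c\<^sup>2"
proof -
  obtain x where x: "z < n" "x z = 1" "chain_form n E l x = d"
    using assms by (auto simp: pivot_def)
  let ?x = "\<lambda>u. if u < n then c * x u else y u"
  have "chain_form n E l ?x = chain_form n E l (\<lambda>u. c * x u)"
    by (rule chain_form_cong) simp
  then show ?thesis using x by (intro exI[of _ ?x]) (auto simp: chain_form_scale mult.commute)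
qed

lemma pivot_single: "pivot 1 {} 0 l l"
proof -
  have "chain_form (Suc 0) {} l x = l * (x 0)\<^sup>2" for x
    by (simp add: chain_form_def qform_def)
  then show ?thesis by (auto simp: pivot_def intro!: exI[of _ "\<lambda>_. 1"])
qed

lemma pivot_leaf:
  assumes "chain_graph n E" and piv: "pivot n E z l d" and l: "l > 0"
  shows "pivot (Suc n) (E \<union> star_edges n {z}) z l (d - 1 / l)"
proof -
  have z: "z < n" using piv by (simp add: pivot_def)
  have form: "chain_form (Suc n) (E \<union> star_edges n {z}) l x =
      chain_form n E l x + 2 * x n * x z + l * (x n)\<^sup>2" for x
    using assms z by (subst chain_form_extend) (auto simp: chain_graph_def)
  have sq: "2 * t * a + l * t\<^sup>2 = l * (t + a / l)\<^sup>2 - a\<^sup>2 / l" for t a :: real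
    using l by (simp add: field_simps power2_eq_square)
  have "(d - 1 / l) * (x z)\<^sup>2 \<le> chain_form (Suc n) (E \<union> star_edges n {z}) l x" for x
  proof -
    have "d * (x z)\<^sup>2 \<le> chain_form n E l x" using piv by (simp add: pivot_def)
    moreover have "2 * x n * x z + l * (x n)\<^sup>2 \<ge> - (x z)\<^sup>2 / l" unfolding sq using l by simp
    ultimately show ?thesis unfolding form by (simp add: left_diff_distrib)
  qed
  moreover obtain x where x: "x z = 1" "x n = - 1 / l" "chain_form n E l x = d"
    using pivot_attained[OF piv, of 1 "\<lambda>_. - 1 / l"] by auto
  then have "x z = 1 \<and> chain_form (Suc n) (E \<union> star_edges n {z}) l x = d - 1 / l"
    unfolding form x using l by (simp add: power2_eq_square)
  ultimately show ?thesis using z unfolding pivot_def by (auto simp: less_Suc_eq)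
qed

lemma pivot_path:
  assumes "chain_graph n E" and piv: "pivot n E z l d" and d: "d > 0"
  shows "pivot (Suc n) (E \<union> star_edges n {z}) n l (l - 1 / d)"
proof -
  have z: "z < n" using piv by (simp add: pivot_def)
  have form: "chain_form (Suc n) (E \<union> star_edges n {z}) l x =
      chain_form n E l x + 2 * x n * x z + l * (x n)\<^sup>2" for x
    using assms z by (subst chain_form_extend) (auto simp: chain_graph_def)
  have sq: "d * a\<^sup>2 + 2 * t * a = d * (a + t / d)\<^sup>2 - t\<^sup>2 / d" for t a :: real
    using d by (simp add: field_simps power2_eq_square)
  have "(l - 1 / d) * (x n)\<^sup>2 \<le> chain_form (Suc n) (E \<union> star_edges n {z}) l x" for x
  proof -
    have "d * (x z)\<^sup>2 \<le> chain_form n E l x" using piv by (simp add: pivot_def)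
    moreover have "d * (x z)\<^sup>2 + 2 * x n * x z \<ge> - (x n)\<^sup>2 / d" unfolding sq using d by simp
    ultimately show ?thesis unfolding form by (simp add: left_diff_distrib)
  qed
  moreover obtain x where x: "x z = - 1 / d" "x n = 1" "chain_form n E l x = d * (- 1 / d)\<^sup>2"
    using pivot_attained[OF piv, of "- 1 / d" "\<lambda>_. 1"] by auto
  then have "x n = 1 \<and> chain_form (Suc n) (E \<union> star_edges n {z}) l x = l - 1 / d"
    unfolding form x using d by (simp add: power2_eq_square)
  ultimately show ?thesis unfolding pivot_def by auto
qed

text \<open>Gaussian elimination in the order old vertex, pendant vertex, second and third vertex of
  the triangle. After the pendant and the old vertex are eliminated, the second vertex has pivot
  \<open>l - 1 / l - 1 / d\<close> and its edge to the third has weight \<open>1 - 1 / d\<close>;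
  \<open>tri l d\<close> is the last Schur complement.\<close>

definition tri :: "real \<Rightarrow> real \<Rightarrow> real" where
  "tri l d = l - 1 / d - (1 - 1 / d)\<^sup>2 / (l - 1 / l - 1 / d)"

text \<open>Glue a triangle to the last vertex, with a pendant edge at its second vertex; its third
  vertex becomes the last one.\<close>

definition glue_triangle :: "nat \<Rightarrow> nat set set \<Rightarrow> nat \<Rightarrow> nat set set" where
  "glue_triangle n E z = E \<union> star_edges n {z} \<union> star_edges (Suc n) {n} \<union> star_edges (Suc (Suc n)) {z, n}"

lemma glue_triangle_graph:
  assumes "chain_graph n E" "z < n"
  shows "chain_graph (Suc (Suc (Suc n))) (glue_triangle n E z)"
  unfolding glue_triangle_def using assms(2)
  by (intro chain_graph_extend assms(1)) (auto simp: card_insert_if)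

lemma pivot_triangle:
  assumes cg: "chain_graph n E" and piv: "pivot n E z l d"
    and d: "d > 0" and l: "l > 0" and pos: "l - 1 / l - 1 / d > 0"
  shows "pivot (Suc (Suc (Suc n))) (glue_triangle n E z) (Suc (Suc n)) l (tri l d)"
proof -
  let ?m = "Suc (Suc n)"
  let ?r = "l - 1 / l - 1 / d"
  have z: "z < n" using piv by (simp add: pivot_def)
  have cg1: "chain_graph (Suc n) (E \<union> star_edges n {z})"
    using z by (intro chain_graph_extend[OF cg]) auto
  have cg2: "chain_graph (Suc (Suc n)) (E \<union> star_edges n {z} \<union> star_edges (Suc n) {n})"
    by (intro chain_graph_extend[OF cg1]) auto
  have form: "chain_form (Suc ?m) (glue_triangle n E z) l x =
      chain_form n E l x + 2 * x n * x z + l * (x n)\<^sup>2 + 2 * x (Suc n) * x n + l * (x (Suc n))\<^sup>2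
      + 2 * x ?m * (x z + x n) + l * (x ?m)\<^sup>2" for x
    unfolding glue_triangle_def
    apply (subst chain_form_extend[OF chain_graph_edge[OF cg2]])
    using z apply simp_all
    apply (subst chain_form_extend[OF chain_graph_edge[OF cg1]])
    apply simp_all
    apply (subst chain_form_extend[OF chain_graph_edge[OF cg]])
    apply simp_all
    done
  have sq: "d * a\<^sup>2 + 2 * t * a + l * t\<^sup>2 + 2 * s * t + l * s\<^sup>2 + 2 * w * (a + t) + l * w\<^sup>2 =
      d * (a + (t + w) / d)\<^sup>2 + l * (s + t / l)\<^sup>2 + ?r * (t + (1 - 1 / d) * w / ?r)\<^sup>2 + tri l d * w\<^sup>2"
    for a t s w :: real
  proof -
    have a: "d * (a + (t + w) / d)\<^sup>2 = d * a\<^sup>2 + 2 * a * (t + w) + (t + w)\<^sup>2 / d"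
      using d by (simp add: field_simps power2_eq_square)
    have b: "l * (s + t / l)\<^sup>2 = l * s\<^sup>2 + 2 * s * t + t\<^sup>2 / l"
      using l by (simp add: field_simps power2_eq_square)
    have c: "r * (t + k * w / r)\<^sup>2 = r * t\<^sup>2 + 2 * t * k * w + k\<^sup>2 * w\<^sup>2 / r" if "r > 0" for r k :: real
      using that by (simp add: field_simps power2_eq_square)
    have e: "(t + w)\<^sup>2 / d = t\<^sup>2 / d + 2 * t * w / d + w\<^sup>2 / d"
      using d by (simp add: field_simps power2_eq_square)
    show ?thesis
      unfolding a b c[OF pos] e tri_def
      by (simp add: algebra_simps power2_eq_square diff_divide_distrib add_divide_distrib)
  qed
  have lower: "tri l d * (x ?m)\<^sup>2 \<le> chain_form (Suc ?m) (glue_triangle n E z) l x" for x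
  proof -
    have "d * (x z)\<^sup>2 \<le> chain_form n E l x" using piv by (simp add: pivot_def)
    moreover have "tri l d * (x ?m)\<^sup>2 \<le> d * (x z + (x n + x ?m) / d)\<^sup>2 + l * (x (Suc n) + x n / l)\<^sup>2
      + ?r * (x n + (1 - 1 / d) * x ?m / ?r)\<^sup>2 + tri l d * (x ?m)\<^sup>2"
      using d l pos by simp
    ultimately show ?thesis unfolding form using sq[of "x z" "x n" "x (Suc n)" "x ?m"] by linarith
  qed
  define t where "t = - (1 - 1 / d) / ?r"
  define s where "s = - t / l"
  define a where "a = - (t + 1) / d"
  obtain x where x: "x z = a" "\<forall>u\<ge>n. x u = (if u = n then t else if u = Suc n then s else 1)"
    "chain_form n E l x = d * a\<^sup>2"
    using pivot_attained[OF piv, of a "\<lambda>u. if u = n then t else if u = Suc n then s else 1"] by auto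
  have xv: "x n = t" "x (Suc n) = s" "x ?m = 1" using x(2) by auto
  have "chain_form (Suc ?m) (glue_triangle n E z) l x =
     d * (a + (t + 1) / d)\<^sup>2 + l * (s + t / l)\<^sup>2 + ?r * (t + (1 - 1 / d) * 1 / ?r)\<^sup>2 + tri l d * 1\<^sup>2"
    unfolding form xv x(1,3) using sq[of a t s 1] by simp
  also have "\<dots> = tri l d"
    using d l pos by (simp add: a_def s_def t_def diff_divide_distrib add_divide_distrib)
  finally have "chain_form (Suc ?m) (glue_triangle n E z) l x = tri l d" .
  then have "x ?m = 1 \<and> chain_form (Suc ?m) (glue_triangle n E z) l x = tri l d"
    using xv(3) by (rule conjI[rotated])
  then show ?thesis unfolding pivot_def using lower by auto
qed

lemma pivots_start: "pivots l l' l l'"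
proof -
  have "chain_graph 1 {}" by (auto simp: chain_graph_def intro!: exI[of _ "\<lambda>_. 0"])
  then show ?thesis unfolding pivots_def using pivot_single by blast
qed

lemma pivots_leaf:
  assumes "pivots l l' d d'" "l > 0" "l' > 0"
  shows "pivots l l' (d - 1 / l) (d' - 1 / l')"
proof -
  obtain n E z where *: "chain_graph n E" "pivot n E z l d" "pivot n E z l' d'"
    using assms(1) by (auto simp: pivots_def)
  then have "z < n" by (simp add: pivot_def)
  then have "chain_graph (Suc n) (E \<union> star_edges n {z})" by (intro chain_graph_extend[OF *(1)]) auto
  then show ?thesis unfolding pivots_def
    using pivot_leaf[OF *(1,2) assms(2)] pivot_leaf[OF *(1,3) assms(3)] by blast
qed

lemma pivots_path:
  assumes "pivots l l' d d'" "d > 0" "d' > 0"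
  shows "pivots l l' (l - 1 / d) (l' - 1 / d')"
proof -
  obtain n E z where *: "chain_graph n E" "pivot n E z l d" "pivot n E z l' d'"
    using assms(1) by (auto simp: pivots_def)
  then have "z < n" by (simp add: pivot_def)
  then have "chain_graph (Suc n) (E \<union> star_edges n {z})" by (intro chain_graph_extend[OF *(1)]) auto
  then show ?thesis unfolding pivots_def
    using pivot_path[OF *(1,2) assms(2)] pivot_path[OF *(1,3) assms(3)] by blast
qed

lemma pivots_tri:
  assumes "pivots l l' d d'" "d > 0" "d' > 0" "l > 0" "l' > 0"
    "l - 1 / l - 1 / d > 0" "l' - 1 / l' - 1 / d' > 0"
  shows "pivots l l' (tri l d) (tri l' d')"
proof -
  obtain n E z where *: "chain_graph n E" "pivot n E z l d" "pivot n E z l' d'"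
    using assms(1) by (auto simp: pivots_def)
  then have "z < n" by (simp add: pivot_def)
  then show ?thesis unfolding pivots_def
    using pivot_triangle[OF *(1,2)] pivot_triangle[OF *(1,3)] glue_triangle_graph[OF *(1)] assms
    by blast
qed

lemma pivot_nonneg_imp: "pivot n E z l d \<Longrightarrow> d \<ge> 0 \<Longrightarrow> 0 \<le> chain_form n E l x"
  unfolding pivot_def by (meson mult_nonneg_nonneg order_trans zero_le_power2)

text \<open>A pivot 0 is still compatible with a nonnegative form; one more path vertex makes the
  form negative, by the values \<open>l\<close> at \<open>z\<close> and -1 at the new
  vertex.\<close>

lemma pivot_nonpos_path:
  assumes "chain_graph n E" "pivot n E z l d" "d \<le> 0" "l > 0"
  shows "\<exists>x. chain_form (Suc n) (E \<union> star_edges n {z}) l x < 0"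
proof -
  have z: "z < n" using assms by (simp add: pivot_def)
  have form: "chain_form (Suc n) (E \<union> star_edges n {z}) l x =
      chain_form n E l x + 2 * x n * x z + l * (x n)\<^sup>2" for x
    using assms z by (subst chain_form_extend) (auto simp: chain_graph_def)
  obtain x where "x z = l" "x n = -1" "chain_form n E l x = d * l\<^sup>2"
    using pivot_attained[OF assms(2), of l "\<lambda>_. -1"] by auto
  then have "chain_form (Suc n) (E \<union> star_edges n {z}) l x = d * l\<^sup>2 - l" by (simp add: form)
  also have "d * l\<^sup>2 \<le> 0" using assms by (simp add: mult_nonpos_nonneg)
  finally show ?thesis using assms(4) by (intro exI[of _ x]) simp
qed

lemma inverse_sum_antimono:
  fixes a b :: real
  assumes "0 < a" "a \<le> b" "b \<le> 1"
  shows "b + 1 / b \<le> a + 1 / a"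
proof -
  have "(b - a) * (1 - a * b) \<ge> 0"
    using assms by (intro mult_nonneg_nonneg) (auto simp: mult_le_one)
  then have "b * (a * b) + a \<le> a * (a * b) + b" by (simp add: algebra_simps)
  then show ?thesis using assms by (simp add: field_simps)
qed

lemma inverse_sum_less_imp:
  fixes a b :: real
  assumes "0 < a" "0 < b" "b \<le> 1" "a + 1 / a < b + 1 / b" "a \<le> 1"
  shows "b < a"
  using inverse_sum_antimono[of a b] assms by linarith

lemma inverse_sum_le_imp:
  fixes a b :: real
  assumes "0 < a" "0 < b" "b \<le> 1" "a + 1 / a \<le> b + 1 / b" "a \<le> 1"
  shows "b \<le> a"
proof (rule ccontr)
  assume "\<not> b \<le> a"
  have "a * b \<le> a" using assms by (simp add: mult_left_le)
  then have "a * b < 1" using assms \<open>\<not> b \<le> a\<close> by linarith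
  then have "(b - a) * (1 - a * b) > 0"
    using \<open>\<not> b \<le> a\<close> by (intro mult_pos_pos) auto
  then have "b * (a * b) + a < a * (a * b) + b" by (simp add: algebra_simps)
  then have "b + 1 / b < a + 1 / a" using assms by (simp add: field_simps)
  with assms(4) show False by simp
qed

text \<open>On (0, 1] the function - 1 / d has slope at least 1, and the subtracted quotient
  decreases in both \<open>d\<close> and \<open>l\<close>. For \<open>l = l'\<close> the lemma says
  that \<open>tri l d - d\<close> is nondecreasing in \<open>d\<close>.\<close>

lemma tri_diff:
  assumes "l \<le> l'" "0 < l" "0 < d" "d \<le> d'" "d' \<le> 1" "l - 1 / l - 1 / d > 0"
  shows "(l' - l) + (d' - d) \<le> tri l' d' - tri l d"
proof -
  have inv: "1 / d' \<le> 1 / d" "1 \<le> 1 / d'" "1 / l' \<le> 1 / l" using assms by (auto simp: field_simps)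
  have "d * d' \<le> 1" using assms by (intro mult_le_one) auto
  have "(d' - d) * 1 \<le> (d' - d) * (1 / (d * d'))"
    using assms \<open>d * d' \<le> 1\<close> by (intro mult_left_mono) (auto simp: field_simps)
  also have "\<dots> = 1 / d - 1 / d'" using assms by (simp add: field_simps)
  finally have 1: "d' - d \<le> 1 / d - 1 / d'" by simp
  have "(1 / d' - 1)\<^sup>2 \<le> (1 / d - 1)\<^sup>2" using inv by (intro power_mono) auto
  then have "(1 - 1 / d')\<^sup>2 \<le> (1 - 1 / d)\<^sup>2" by (simp add: power2_commute)
  then have "(1 - 1 / d')\<^sup>2 / (l' - 1 / l' - 1 / d') \<le> (1 - 1 / d)\<^sup>2 / (l - 1 / l - 1 / d)"
    using inv assms by (intro frac_le) auto
  with 1 show ?thesis unfolding tri_def by linarith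
qed

text \<open>Triangles cannot leave the region above 1: with \<open>u = 1 / d\<close> the subtracted
  quotient is at most \<open>1 - u\<close>, because \<open>1 \<le> l - 1 / l\<close>, and this
  leaves at least \<open>l - 1\<close>.\<close>

lemma tri_ge_one:
  assumes "2 \<le> l" "1 \<le> d"
  shows "1 \<le> tri l d"
proof -
  define u where "u = 1 / d"
  have u: "0 < u" "u \<le> 1" using assms by (auto simp: u_def)
  have "1 / l \<le> 1 / 2" using assms by (intro divide_left_mono) auto
  then have y: "1 \<le> l - 1 / l" using assms by linarith
  have "(1 - u)\<^sup>2 \<le> (1 - u) * (l - 1 / l - u)"
    unfolding power2_eq_square using u y by (intro mult_left_mono) auto
  then have "(1 - u)\<^sup>2 / (l - 1 / l - u) \<le> 1 - u"
    by (cases "l - 1 / l - u = 0") (use u y in \<open>auto simp: divide_le_eq\<close>)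
  then show ?thesis unfolding tri_def using assms by (simp add: u_def)
qed

section \<open>Orbits of pivot pairs when no smallest eigenvalue lies in [- l', - l)\<close>

locale spectral_gap =
  fixes l l' t t' :: real
  assumes t: "0 < t" "t \<le> 1" and l_eq: "l = t + 1 / t"
    and t': "0 < t'" "t' \<le> 1" and l'_eq: "l' = t' + 1 / t'"
    and less: "l < l'"
    and gap: "\<And>n E. chain_graph n E \<Longrightarrow> (\<And>x. 0 \<le> chain_form n E l' x) \<Longrightarrow> 0 \<le> chain_form n E l x"
begin

lemma l_ge: "2 \<le> l"
  using inverse_sum_antimono[of t 1] t l_eq by simp

lemma l'_ge: "2 \<le> l'" using l_ge less by simp

lemma t'_less: "t' < t"
  using inverse_sum_less_imp[of t t'] t t' less l_eq l'_eq by simp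

text \<open>One more path vertex has a nonnegative pivot at level \<open>l'\<close>, so the longer
  graph is nonnegative there and, by \<open>gap\<close>, also at level \<open>l\<close>. With a
  nonpositive \<open>d\<close> it would be negative.\<close>

lemma pos_of_threshold:
  assumes "pivots l l' d d'" "t' \<le> d'"
  shows "0 < d"
proof (rule ccontr)
  assume "\<not> 0 < d"
  obtain n E z where *: "chain_graph n E" "pivot n E z l d" "pivot n E z l' d'"
    using assms(1) by (auto simp: pivots_def)
  have z: "z < n" using * by (simp add: pivot_def)
  have cg: "chain_graph (Suc n) (E \<union> star_edges n {z})"
    using z by (intro chain_graph_extend[OF *(1)]) auto
  have "0 < d'" using assms t' by simp
  have "1 / d' \<le> 1 / t'" using assms t' by (intro divide_left_mono) auto
  then have "0 \<le> l' - 1 / d'" using t' l'_eq by linarith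
  then have "0 \<le> chain_form (Suc n) (E \<union> star_edges n {z}) l' x" for x
    using pivot_nonneg_imp[OF pivot_path[OF *(1,3) \<open>0 < d'\<close>]] by blast
  then have "0 \<le> chain_form (Suc n) (E \<union> star_edges n {z}) l x" for x using gap[OF cg] by blast
  moreover obtain x where "chain_form (Suc n) (E \<union> star_edges n {z}) l x < 0"
    using pivot_nonpos_path[OF *(1,2)] \<open>\<not> 0 < d\<close> l_ge by auto
  ultimately show False by (simp add: not_le[symmetric])
qed

text \<open>The two fixed points separate all pairs in the same way. Below \<open>t\<close> every
  path vertex lowers the pivot by at least a constant \<open>c\<close>, while a pivot of at least
  \<open>t'\<close> stays there at level \<open>l'\<close>; finitely many steps contradict
  positivity. Through this lemma \<open>gap\<close> enters the later contradictions.\<close>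

lemma threshold:
  assumes "pivots l l' d d'" "d < t"
  shows "d' < t'"
proof (rule ccontr)
  assume "\<not> d' < t'"
  then have d': "t' \<le> d'" by simp
  have d: "0 < d" using pos_of_threshold[OF assms(1) d'] .
  define c where "c = d + 1 / d - l"
  have c: "c > 0"
  proof (rule ccontr)
    assume "\<not> c > 0"
    then have "d + 1 / d \<le> t + 1 / t" unfolding c_def l_eq by simp
    then show False using inverse_sum_le_imp[of d t] d t assms(2) by simp
  qed
  have "False" if "pivots l l' e e'" "t' \<le> e'" "e \<le> d" "e < real k * c" for k e e'
    using that
  proof (induction k arbitrary: e e')
    case 0
    then show ?case using pos_of_threshold[of e e'] by simp
  next
    case (Suc k)
    have e: "0 < e" using pos_of_threshold Suc.prems by blast
    have "0 < e'" using Suc.prems t' by simp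
    have "1 / e' \<le> 1 / t'" using Suc.prems t' by (intro divide_left_mono) auto
    then have "t' \<le> l' - 1 / e'" using l'_eq by linarith
    have "c \<le> e + 1 / e - l"
      using inverse_sum_antimono[of e d] e Suc.prems assms(2) t unfolding c_def by linarith
    then have "l - 1 / e \<le> e - c" by linarith
    then show False
      using Suc.IH[of "l - 1 / e" "l' - 1 / e'"] pivots_path[OF Suc.prems(1) e \<open>0 < e'\<close>]
        \<open>t' \<le> l' - 1 / e'\<close> Suc.prems c by (simp add: algebra_simps)
  qed
  moreover obtain k :: nat where "d < real k * c" using c reals_Archimedean3 by blast
  ultimately show False using assms(1) d' by blast
qed

lemma path_ge: "t \<le> d \<Longrightarrow> t \<le> l - 1 / d"
proof -
  assume "t \<le> d"
  then have "1 / d \<le> 1 / t" using t by (intro divide_left_mono) auto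
  then show ?thesis using l_eq by linarith
qed

text \<open>Leaves are attached as long as the pivot at level \<open>l\<close> stays at least
  \<open>t\<close>. The next leaf would push it below \<open>t\<close>, hence by
  \<open>threshold\<close> the other pivot below \<open>t'\<close>, which bounds both from above. A
  leaf costs less at level \<open>l'\<close>, so the difference does not shrink.\<close>

lemma greedy_leaves:
  assumes "pivots l l' d d'" "t \<le> d"
  shows "\<exists>e e'. pivots l l' e e' \<and> t \<le> e \<and> e < t + 1 / l \<and> e' < t' + 1 / l' \<and> d' - d \<le> e' - e"
proof -
  have inv: "1 / l' \<le> 1 / l" "0 < 1 / l" using less l_ge by (auto simp: field_simps)
  have "\<exists>e e'. pivots l l' e e' \<and> t \<le> e \<and> e < t + 1 / l \<and> e' < t' + 1 / l' \<and> d' - d \<le> e' - e"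
    if "pivots l l' d d'" "t \<le> d" "d < t + (real k + 1) * (1 / l)" for k d d'
    using that
  proof (induction k arbitrary: d d')
    case 0
    have "pivots l l' (d - 1 / l) (d' - 1 / l')" using pivots_leaf 0 l_ge l'_ge by simp
    then have "d' - 1 / l' < t'" using 0 by (intro threshold) auto
    with 0 show ?case by (intro exI[of _ d] exI[of _ d']) auto
  next
    case (Suc k)
    have p: "pivots l l' (d - 1 / l) (d' - 1 / l')" using pivots_leaf Suc.prems l_ge l'_ge by simp
    show ?case
    proof (cases "t \<le> d - 1 / l")
      case True
      have "d - 1 / l < t + (real k + 1) * (1 / l)"
        using Suc.prems(3) by (simp add: algebra_simps add_divide_distrib)
      from Suc.IH[OF p True this] show ?thesis using inv by force
    next
      case False
      then have "d' - 1 / l' < t'" using p by (intro threshold) auto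
      with False Suc.prems show ?thesis by (intro exI[of _ d] exI[of _ d']) auto
    qed
  qed
  moreover obtain k :: nat where "d - t < real k * (1 / l)" using inv reals_Archimedean3 by blast
  then have "d < t + (real k + 1) * (1 / l)" using inv(2) by (simp only: distrib_right)
  ultimately show ?thesis using assms by blast
qed

lemma path_diff:
  assumes "0 < d" "d \<le> d'" "d' \<le> 1"
  shows "(l' - l) + (d' - d) \<le> (l' - 1 / d') - (l - 1 / d)"
proof -
  have "d * d' \<le> 1" using assms by (intro mult_le_one) auto
  have "(d' - d) * 1 \<le> (d' - d) * (1 / (d * d'))"
    using assms \<open>d * d' \<le> 1\<close> by (intro mult_left_mono) (auto simp: field_simps)
  also have "\<dots> = 1 / d - 1 / d'" using assms by (simp add: field_simps)
  finally show ?thesis by simp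
qed

text \<open>If the window from \<open>t\<close> to \<open>t + 1 / l\<close> ends at 1 or earlier,
  the path map increases the difference by at least \<open>l' - l\<close> in each round, and greedy
  leaves return to the window. The difference would exceed 1.\<close>

lemma contradiction_large:
  assumes "t + 1 / l \<le> 1"
  shows False
proof -
  have inv: "1 / l' \<le> 1 / l" "0 < 1 / l" using less l_ge by (auto simp: field_simps)
  have "\<exists>d d'. pivots l l' d d' \<and> t \<le> d \<and> d < t + 1 / l \<and> d' < t' + 1 / l' \<and> real i * (l' - l) \<le> d' - d" for i
  proof (induction i)
    case 0
    have "t \<le> l" using t l_eq by simp
    from greedy_leaves[OF pivots_start this] less show ?case by force
  next
    case (Suc i)
    then obtain d d' where d: "pivots l l' d d'" "t \<le> d" "d < t + 1 / l" "d' < t' + 1 / l'"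
      "real i * (l' - l) \<le> d' - d" by blast
    have "0 \<le> real i * (l' - l)" using less by simp
    then have dd: "0 < d" "d \<le> d'" "d' \<le> 1" using d t inv assms t'_less by auto
    have p: "pivots l l' (l - 1 / d) (l' - 1 / d')" using pivots_path d(1) dd by simp
    obtain e e' where e: "pivots l l' e e'" "t \<le> e" "e < t + 1 / l" "e' < t' + 1 / l'"
      "(l' - 1 / d') - (l - 1 / d) \<le> e' - e"
      using greedy_leaves[OF p path_ge[OF d(2)]] by blast
    have "real (Suc i) * (l' - l) \<le> e' - e"
      using e(5) path_diff[OF dd] d(5) by (simp add: algebra_simps)
    with e show ?case by blast
  qed
  moreover obtain i :: nat where "1 < real i * (l' - l)" using less reals_Archimedean3[of "l' - l"] by auto
  ultimately obtain d d' where "t \<le> d" "d' < t' + 1 / l'" "1 < d' - d" by (meson less_le_trans)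
  with assms t inv t'_less show False by auto
qed

text \<open>Triangles give finer steps than leaves. A round in [t, c] is a triangle if this stays
  above \<open>t\<close>, and a path vertex otherwise. The condition on
  \<open>tri l (1 / (l - c))\<close> says that every point which the path map sends above
  \<open>c\<close> admits a triangle; \<open>tri l c < c\<close> makes triangles a strict decrease
  on the whole interval.\<close>

lemma contradiction_triangle:
  assumes c: "t \<le> c" "c \<le> 1" "t \<le> tri l (1 / (l - c))" "tri l c < c"
    and start: "pivots l l' d0 d0'" "t \<le> d0" "d0 \<le> c" "d0 \<le> d0'"
  shows False
proof -
  have "l * t = t * t + 1" using t by (simp add: l_eq field_simps)
  then have tl: "1 / l < t" using t l_ge by (simp add: field_simps)
  have dom: "l - 1 / l - 1 / d > 0" if "t \<le> d" for d
    using path_ge[OF that] tl by linarith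
  have dom': "l' - 1 / l' - 1 / d > 0" if "t \<le> d" for d
  proof -
    have "1 / l' < 1 / l" using less l_ge by (intro divide_strict_left_mono) auto
    then show ?thesis using dom[OF that] less by linarith
  qed
  have step: "pivots l l' (tri l d) (tri l' d')" if "pivots l l' d d'" "t \<le> d" "d \<le> d'" for d d'
    using that t l_ge l'_ge dom[of d] dom'[of d'] by (intro pivots_tri) auto
  have stept: "tri l d \<le> d - (c - tri l c)" if "t \<le> d" "d \<le> c" for d
    using tri_diff[of l l d c] l_ge t c that dom[of d] by simp
  have path_c: "l - 1 / d \<le> c" if d: "t \<le> d" "d \<le> c" "tri l d < t" for d
  proof (rule ccontr)
    assume "\<not> l - 1 / d \<le> c"
    then have "1 / d < l - c" by simp
    have lc: "1 \<le> l - c" using l_ge c by simp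
    have "0 < d" using d t by simp
    then have m: "1 / (l - c) \<le> d" using \<open>1 / d < l - c\<close> lc by (simp add: field_simps)
    have "t \<le> 1 / (l - c)"
    proof -
      have "l - c \<le> 1 / t" using c(1) l_eq by linarith
      then show ?thesis using lc t by (simp add: field_simps)
    qed
    then have "tri l (1 / (l - c)) \<le> tri l d"
      using tri_diff[of l l "1 / (l - c)" d] m d c l_ge t dom lc by fastforce
    with d c(3) show False by simp
  qed
  \<comment> \<open>While \<open>d' \<ge> 1\<close>, triangles keep it there but lower
    \<open>d\<close> by at least \<open>c - tri l c\<close>, until \<open>threshold\<close> gives a
    contradiction. Hence \<open>d' < 1\<close> throughout, in the region where differences
    expand.\<close>
  have big: False if "pivots l l' d d'" "t \<le> d" "d \<le> c" "1 \<le> d'"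
    "d < t + real k * (c - tri l c)" for k d d'
    using that
  proof (induction k arbitrary: d d')
    case 0 then show ?case by simp
  next
    case (Suc k)
    have "d \<le> d'" using Suc.prems c by simp
    then have p: "pivots l l' (tri l d) (tri l' d')" using step Suc.prems by simp
    have one: "1 \<le> tri l' d'" using tri_ge_one l'_ge Suc.prems by simp
    show ?case
    proof (cases "t \<le> tri l d")
      case True
      have "tri l d < t + real k * (c - tri l c)" "tri l d \<le> c"
        using stept[of d] Suc.prems c by (auto simp: algebra_simps)
      then show ?thesis using Suc.IH[OF p True _ one] by simp
    next
      case False
      then have "tri l' d' < t'" using threshold[OF p] by simp
      with one t' show ?thesis by simp
    qed
  qed
  have small: "d' < 1" if "pivots l l' d d'" "t \<le> d" "d \<le> c" for d d'
  proof (rule ccontr)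
    assume "\<not> d' < 1"
    obtain k :: nat where "d - t < real k * (c - tri l c)"
      using c reals_Archimedean3[of "c - tri l c"] by auto
    then show False using big[OF that, of k] \<open>\<not> d' < 1\<close> by simp
  qed
  have "\<exists>d d'. pivots l l' d d' \<and> t \<le> d \<and> d \<le> c \<and> real i * (l' - l) \<le> d' - d" for i
  proof (induction i)
    case 0
    show ?case using start by force
  next
    case (Suc i)
    then obtain d d' where d: "pivots l l' d d'" "t \<le> d" "d \<le> c"
      "real i * (l' - l) \<le> d' - d" by blast
    have "0 \<le> real i * (l' - l)" using less by simp
    then have dd: "0 < d" "d \<le> d'" "d' \<le> 1" using d t small[OF d(1-3)] by auto
    show ?case
    proof (cases "t \<le> tri l d")
      case True
      have "real (Suc i) * (l' - l) \<le> tri l' d' - tri l d"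
        using tri_diff[of l l' d d'] dd less l_ge dom d by (simp add: algebra_simps)
      moreover have "tri l d \<le> c" using stept[of d] d c by simp
      ultimately show ?thesis using step[OF d(1,2) dd(2)] True by blast
    next
      case False
      have "real (Suc i) * (l' - l) \<le> (l' - 1 / d') - (l - 1 / d)"
        using path_diff[OF dd] d(4) by (simp add: algebra_simps)
      moreover have "l - 1 / d \<le> c" using path_c d False by simp
      moreover have "pivots l l' (l - 1 / d) (l' - 1 / d')" using pivots_path[OF d(1)] dd by simp
      ultimately show ?thesis using path_ge[OF d(2)] by blast
    qed
  qed
  moreover obtain i :: nat where "1 < real i * (l' - l)" using less reals_Archimedean3[of "l' - l"] by auto
  ultimately obtain d d' where "pivots l l' d d'" "t \<le> d" "d \<le> c" "1 < d' - d"
    by (meson less_le_trans)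
  with small[of d d'] t show False by auto
qed

text \<open>A leaf of weight \<open>s\<close> does not lower the cross-ratio of two points e, e'
  with t and 1 / t, because the difference of the two sides factors. The letters are A = e - t, B =
  1 / t - e', C = e' - t, D = 1 / t - e; the last condition then reads e + e' <= l + s.\<close>

lemma leaf_cross_ratio:
  fixes A B C D s h :: real
  assumes "C = A + h" "B = D - h" "0 \<le> h" "0 \<le> s" "0 \<le> A + D" "A - D + h \<le> s"
  shows "(A - s) * (B + s) * (C * D) \<le> (C - s) * (D + s) * (A * B)"
proof -
  have "(C - s) * (D + s) * (A * B) - (A - s) * (B + s) * (C * D) = s * h * (A + D) * (s - (A - D + h))"
    unfolding assms(1,2) by (simp add: algebra_simps)
  moreover have "0 \<le> s * h * (A + D) * (s - (A - D + h))"
    using assms by (intro mult_nonneg_nonneg) auto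
  ultimately show ?thesis by linarith
qed

text \<open>The quantity that grows is the cross-ratio of \<open>d\<close> and \<open>d'\<close>
  with the fixed points \<open>t\<close> and \<open>1 / t\<close>. The path map at level
  \<open>l\<close> preserves it, the larger level for \<open>d'\<close> multiplies it by at least
  \<open>\<kappa> > 1\<close>, and leaves do not lower it: \<open>few\<close> limits them to one per
  round and \<open>sum\<close> yields the condition of \<open>leaf_cross_ratio\<close>. A large
  cross-ratio forces \<open>d\<close> close to \<open>t\<close>; leaves are no longer needed, and
  \<open>d'\<close> grows past its bound.\<close>

lemma contradiction_medium:
  assumes wide: "t + 1 / l < 1 / t" and few: "l < 2 * t + 3 / l"
    and sum: "l' - 2 / (t + 1 / l) \<le> 1 / l"
  shows False
proof -
  define s where "s = 1 / l"
  define s' where "s' = 1 / l'"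
  define W where "W = 1 / t - t"
  define \<eta> where "\<eta> = 1 / t - t - s"
  define \<kappa> where "\<kappa> = 1 + (l' - l) * t\<^sup>2"
  have s: "0 < s" "s' \<le> s" using less l_ge by (auto simp: s_def s'_def field_simps)
  have eta: "0 < \<eta>" using wide by (simp add: \<eta>_def s_def)
  have W: "0 < W" using eta s by (simp add: W_def \<eta>_def)
  have kappa: "1 < \<kappa>" using less t by (simp add: \<kappa>_def)
  \<comment> \<open>\<open>K\<close> is a lower bound for the cross-ratio, in multiplied form
    because \<open>d = t\<close> may occur.\<close>
  define S where "S = (\<lambda>K d d'. pivots l l' d d' \<and> t \<le> d \<and> d < t + s \<and> d \<le> d' \<and> d' < t' + s' \<and>
    (d - t) * (1 / t - d') * K \<le> (d' - t) * (1 / t - d))"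
  have step: "\<exists>e e'. S (\<kappa> * K) e e' \<and> (l - 1 / d < t + s \<longrightarrow> e' = l' - 1 / d')"
    if "S K d d'" "0 \<le> K" for K d d'
  proof -
    have d: "pivots l l' d d'" "t \<le> d" "d < t + s" "d \<le> d'" "d' < t' + s'"
      "(d - t) * (1 / t - d') * K \<le> (d' - t) * (1 / t - d)" using that by (auto simp: S_def)
    have pos: "0 < d" "0 < d'" using d t by auto
    have lt: "d < 1 / t" "d' < 1 / t" "d' < t + s" using d s t'_less eta by (auto simp: \<eta>_def)
    define e where "e = l - 1 / d"
    define e' where "e' = l' - 1 / d'"
    have p: "pivots l l' e e'" unfolding e_def e'_def using pivots_path d(1) pos by simp
    have e1: "e - t = (d - t) / (t * d)" "1 / t - e = t * (1 / t - d) / d"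
      using t pos by (simp_all add: e_def l_eq field_simps)
    have e2: "e' - t = (d' - t) / (t * d') + (l' - l)" "1 / t - e' = t * (1 / t - d') / d' - (l' - l)"
      using t pos by (simp_all add: e'_def l_eq field_simps)
    have ee: "t \<le> e" "e < 1 / t" using e1 d lt t pos
      by (metis diff_ge_0_iff_ge divide_nonneg_nonneg mult_nonneg_nonneg less_imp_le)
         (metis e1(2) lt(1) t(1) pos(1) diff_gt_0_iff_gt divide_pos_pos mult_pos_pos)
    have "1 / d' \<le> 1 / d" using pos d by (intro divide_left_mono) auto
    then have le: "e \<le> e'" unfolding e_def e'_def using less by linarith
    have cross: "(e - t) * (1 / t - e') * (\<kappa> * K) \<le> (e' - t) * (1 / t - e)"
    proof -
      have "(e - t) * (1 / t - e') * (\<kappa> * K) \<le> (e - t) * (t * (1 / t - d') / d') * (\<kappa> * K)"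
        unfolding e2(2) using ee less kappa that(2) by (intro mult_right_mono mult_left_mono) auto
      also have "\<dots> = \<kappa> / (d * d') * ((d - t) * (1 / t - d') * K)"
        unfolding e1(1) using t pos by simp
      also have "\<dots> \<le> \<kappa> / (d * d') * ((d' - t) * (1 / t - d))"
        using d(6) kappa pos by (intro mult_left_mono) auto
      also have "\<dots> = (1 / t - d) / d * (\<kappa> * ((d' - t) / d'))" using pos by simp
      also have "\<dots> \<le> (1 / t - d) / d * ((d' - t) / d' + (l' - l) * t)"
      proof (rule mult_left_mono)
        have "(d' - t) / d' \<le> 1" using pos t by (simp add: field_simps)
        then have *: "(l' - l) * t * (t * ((d' - t) / d')) \<le> (l' - l) * t * (1 * 1)"
          using less t d pos by (intro mult_left_mono mult_mono) auto
        have "\<kappa> * r = r + (l' - l) * t * (t * r)" for r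
          unfolding \<kappa>_def by (simp add: algebra_simps power2_eq_square)
        then show "\<kappa> * ((d' - t) / d') \<le> (d' - t) / d' + (l' - l) * t"
          using * by (metis add_left_mono mult_1_right)
        show "0 \<le> (1 / t - d) / d" using lt pos by simp
      qed
      also have "\<dots> = (e' - t) * (1 / t - e)"
        unfolding e1(2) e2(1) using t pos by (simp add: field_simps)
      finally show ?thesis .
    qed
    have leaf: "pivots l l' (e - s) (e' - s')"
      unfolding s_def s'_def using pivots_leaf[OF p] l_ge l'_ge by simp
    show ?thesis
    proof (cases "e < t + s")
      case True
      then have "e' - s' < t'" using threshold[OF leaf] by simp
      then have "S (\<kappa> * K) e e'" unfolding S_def using p ee True le cross by auto
      then show ?thesis unfolding e'_def[symmetric] by blast
    next
      case False
      have "1 / (t + s) \<le> 1 / d" "1 / (t + s) \<le> 1 / d'"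
        using pos d lt t s by (auto intro!: divide_left_mono)
      then have ub: "e + e' \<le> l + s"
        unfolding e_def e'_def using sum by (simp add: s_def)
      then have e2s: "e < t + 2 * s" using le few by (simp add: s_def)
      have leaf2: "pivots l l' (e - s - s) (e' - s' - s')"
        unfolding s_def s'_def using pivots_leaf[OF pivots_leaf[OF p]] l_ge l'_ge by simp
      have "e' - s' - s' < t'" using threshold[OF leaf2] e2s by simp
      have C: "0 < e' - t" using False le s by simp
      have D: "0 < 1 / t - e" using ee by simp
      have "(e - t - s) * (1 / t - e' + s) * ((e' - t) * (1 / t - e))
          \<le> (e' - t - s) * (1 / t - e + s) * ((e - t) * (1 / t - e'))"
        by (rule leaf_cross_ratio[of _ _ "e' - e"]) (use le s ub W t l_eq in \<open>auto simp: W_def\<close>)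
      then have "(e - t - s) * (1 / t - e' + s) * ((e' - t) * (1 / t - e)) * (\<kappa> * K)
          \<le> (e' - t - s) * (1 / t - e + s) * ((e - t) * (1 / t - e')) * (\<kappa> * K)"
        using kappa that(2) by (intro mult_right_mono) auto
      also have "\<dots> = (e' - t - s) * (1 / t - e + s) * ((e - t) * (1 / t - e') * (\<kappa> * K))" by simp
      also have "\<dots> \<le> (e' - t - s) * (1 / t - e + s) * ((e' - t) * (1 / t - e))"
        using cross False le D s by (intro mult_left_mono) auto
      finally have "((e - t - s) * (1 / t - e' + s) * (\<kappa> * K)) * ((e' - t) * (1 / t - e))
          \<le> ((e' - t - s) * (1 / t - e + s)) * ((e' - t) * (1 / t - e))"
        by (simp only: mult_ac)
      then have *: "(e - t - s) * (1 / t - e' + s) * (\<kappa> * K) \<le> (e' - t - s) * (1 / t - e + s)"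
        using C D by (metis mult_le_cancel_right_pos mult_pos_pos)
      have eq: "e - s - t = e - t - s" by simp
      have "(e - s - t) * (1 / t - (e' - s')) \<le> (e - t - s) * (1 / t - e' + s)"
        unfolding eq using False s by (intro mult_left_mono) auto
      then have "(e - s - t) * (1 / t - (e' - s')) * (\<kappa> * K) \<le> (e - t - s) * (1 / t - e' + s) * (\<kappa> * K)"
        using kappa that(2) by (intro mult_right_mono) auto
      also note *
      also have "(e' - t - s) * (1 / t - e + s) \<le> (e' - s' - t) * (1 / t - (e - s))"
        using s D by (intro mult_mono') (use False le in auto)
      finally have "S (\<kappa> * K) (e - s) (e' - s')"
        unfolding S_def using leaf False e2s le s \<open>e' - s' - s' < t'\<close> by auto
      then show ?thesis using False unfolding e_def by blast
    qed
  qed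
  have grow: "\<exists>d d'. S (\<kappa> ^ i) d d'" for i
  proof (induction i)
    case 0
    have "t \<le> l" using t l_eq by simp
    from greedy_leaves[OF pivots_start this] obtain d d' where d: "pivots l l' d d'" "t \<le> d"
      "d < t + s" "d' < t' + s'" "l' - l \<le> d' - d" unfolding s_def s'_def by blast
    have "(d - t) * (1 / t - d') \<le> (d' - t) * (1 / t - d)"
    proof -
      have "(d' - t) * (1 / t - d) - (d - t) * (1 / t - d') = (d' - d) * (1 / t - t)"
        by (simp add: algebra_simps diff_divide_distrib)
      moreover have "0 \<le> (d' - d) * (1 / t - t)" using d less W by (simp add: W_def)
      ultimately show ?thesis by linarith
    qed
    moreover have "d \<le> d'" using d(5) less by linarith
    ultimately have "S (\<kappa> ^ 0) d d'" unfolding S_def using d(1-4) by simp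
    then show ?case by blast
  next
    case (Suc i)
    then obtain d d' where "S (\<kappa> ^ i) d d'" by blast
    then obtain e e' where "S (\<kappa> * \<kappa> ^ i) e e'" using step[of "\<kappa> ^ i" d d'] kappa by auto
    then have "S (\<kappa> ^ Suc i) e e'" by simp
    then show ?case by blast
  qed
  \<comment> \<open>Here \<open>1 / t - d' \<ge> \<eta>\<close>, and a path vertex that leaves the
    window requires \<open>d - t \<ge> t\<^sup>2 * s\<close>. Since the other product is at most
    \<open>W\<^sup>2\<close>, a large \<open>K\<close> excludes this.\<close>
  have small: "l - 1 / d < t + s" if S: "S K d d'" and K: "K * (\<eta> * (t\<^sup>2 * s)) > W\<^sup>2" "0 < K" for K d d'
  proof (rule ccontr)
    assume "\<not> l - 1 / d < t + s"
    have d: "t \<le> d" "d < t + s" "d \<le> d'" "d' < t' + s'"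
      "(d - t) * (1 / t - d') * K \<le> (d' - t) * (1 / t - d)" using S by (auto simp: S_def)
    have pos: "0 < d" using d t by auto
    have "l - 1 / d - t = (d - t) / (t * d)" using t pos by (simp add: l_eq field_simps)
    then have "s \<le> (d - t) / (t * d)" using \<open>\<not> l - 1 / d < t + s\<close> by simp
    then have "s * (t * d) \<le> d - t" using t pos by (simp add: field_simps)
    moreover have "s * (t * t) \<le> s * (t * d)" using s t d by (intro mult_left_mono) auto
    ultimately have "t\<^sup>2 * s \<le> d - t" by (simp add: power2_eq_square mult_ac)
    moreover have e: "\<eta> \<le> 1 / t - d'" using d s t'_less by (simp add: \<eta>_def)
    ultimately have "(t\<^sup>2 * s) * \<eta> * K \<le> (d - t) * (1 / t - d') * K"
      using s eta K d(1) by (intro mult_right_mono mult_mono) auto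
    also note d(5)
    also have "(d' - t) * (1 / t - d) \<le> W * W"
      using d t e eta W by (intro mult_mono) (auto simp: W_def)
    finally show False using K(1) by (simp add: power2_eq_square mult_ac)
  qed
  have final: False if "S K d d'" "K * (\<eta> * (t\<^sup>2 * s)) > W\<^sup>2" "0 < K" "t' + s' < d' + real j * (l' - l)" for j K d d'
    using that
  proof (induction j arbitrary: K d d')
    case 0 then show ?case by (simp add: S_def)
  next
    case (Suc j)
    obtain e e' where e: "S (\<kappa> * K) e e'" "e' = l' - 1 / d'"
      using step[OF Suc.prems(1)] small[OF Suc.prems(1-3)] Suc.prems(3) by auto
    have d: "t \<le> d'" "d' < 1 / t" using Suc.prems(1) s t'_less eta by (auto simp: S_def \<eta>_def)
    have "d' + 1 / d' \<le> l"
    proof -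
      have "(d' - t) * (1 / t - d') \<ge> 0" using d by simp
      then have "d' * d' + 1 \<le> d' * (t + 1 / t)" using t by (simp add: algebra_simps diff_divide_distrib)
      then show ?thesis unfolding l_eq using d t by (simp add: field_simps)
    qed
    then have "d' + (l' - l) \<le> e'" using e(2) by simp
    then have j: "t' + s' < e' + real j * (l' - l)" using Suc.prems(4) by (simp add: algebra_simps)
    have "K \<le> \<kappa> * K" using kappa Suc.prems(3) by simp
    then have "K * (\<eta> * (t\<^sup>2 * s)) \<le> \<kappa> * K * (\<eta> * (t\<^sup>2 * s))"
      using eta s by (intro mult_right_mono) auto
    then have "W\<^sup>2 < \<kappa> * K * (\<eta> * (t\<^sup>2 * s))" using Suc.prems(2) by linarith
    moreover have "0 < \<kappa> * K" using Suc.prems(3) kappa by simp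
    ultimately show ?case using Suc.IH[OF e(1) _ _ j] by blast
  qed
  have "0 < \<eta> * (t\<^sup>2 * s)" using eta s t by simp
  then obtain M :: nat where M: "W\<^sup>2 < real M * (\<eta> * (t\<^sup>2 * s))" using reals_Archimedean3 by blast
  obtain i where "real M < \<kappa> ^ i" using real_arch_pow[OF kappa] by blast
  then have K: "W\<^sup>2 < \<kappa> ^ i * (\<eta> * (t\<^sup>2 * s))"
    using M \<open>0 < \<eta> * (t\<^sup>2 * s)\<close> by (meson less_trans mult_strict_right_mono)
  obtain d d' where "S (\<kappa> ^ i) d d'" using grow by blast
  moreover obtain j :: nat where "t' + s' - d' < real j * (l' - l)"
    using less reals_Archimedean3[of "l' - l"] by auto
  ultimately show False using final[OF _ K, of d d' j] kappa by simp
qed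

end

text \<open>The pivot at a vertex that carries one leaf and a path with 2 further vertices; in
  \<open>arm3\<close> the path has 3 further vertices.\<close>

definition arm2 :: "real \<Rightarrow> real" where "arm2 l = l - 1 / (l - 1 / l) - 1 / l"
definition arm3 :: "real \<Rightarrow> real" where "arm3 l = l - 1 / (l - 1 / (l - 1 / l)) - 1 / l"

lemma path_pivot_mono:
  fixes x y :: real
  assumes "l \<le> l'" "0 < x" "x \<le> y"
  shows "l - 1 / x \<le> l' - 1 / y"
proof -
  have "1 / y \<le> 1 / x" using assms by (intro divide_left_mono) auto
  with assms show ?thesis by linarith
qed

lemma path_pivot_gt_one:
  assumes "2 \<le> (l :: real)"
  shows "1 < l - 1 / l" "1 < l - 1 / (l - 1 / l)"
proof -
  have step: "1 < l - 1 / x" if "1 < x" for x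
  proof -
    have "1 / x < 1" using that by simp
    then show ?thesis using assms by linarith
  qed
  show "1 < l - 1 / l" using step[of l] assms by simp
  then show "1 < l - 1 / (l - 1 / l)" by (rule step)
qed

lemma arm_mono:
  assumes "2 \<le> l" "l \<le> l'"
  shows "arm2 l \<le> arm2 l'" "arm3 l \<le> arm3 l'"
proof -
  have 1: "l - 1 / l \<le> l' - 1 / l'" using assms by (intro path_pivot_mono) auto
  have 2: "l - 1 / (l - 1 / l) \<le> l' - 1 / (l' - 1 / l')"
    using assms 1 path_pivot_gt_one[of l] by (intro path_pivot_mono) auto
  have 3: "l - 1 / (l - 1 / (l - 1 / l)) \<le> l' - 1 / (l' - 1 / (l' - 1 / l'))"
    using assms 2 path_pivot_gt_one[of l] by (intro path_pivot_mono) auto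
  have "1 / l' \<le> 1 / l" using assms by (intro divide_left_mono) auto
  with 2 3 show "arm2 l \<le> arm2 l'" "arm3 l \<le> arm3 l'" unfolding arm2_def arm3_def by linarith+
qed

section \<open>Numerical verification near the threshold\<close>

context spectral_gap
begin

lemma pivots_arm:
  shows "pivots l l' (arm2 l) (arm2 l')" "pivots l l' (arm3 l) (arm3 l')"
proof -
  have pos: "0 < l" "0 < l'" using l_ge l'_ge by auto
  have 1: "pivots l l' (l - 1 / l) (l' - 1 / l')"
    using pivots_path[OF pivots_start pos] .
  have 2: "pivots l l' (l - 1 / (l - 1 / l)) (l' - 1 / (l' - 1 / l'))"
    using path_pivot_gt_one[OF l_ge] path_pivot_gt_one[OF l'_ge] by (intro pivots_path[OF 1]) auto
  have 3: "pivots l l' (l - 1 / (l - 1 / (l - 1 / l))) (l' - 1 / (l' - 1 / (l' - 1 / l')))"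
    using path_pivot_gt_one[OF l_ge] path_pivot_gt_one[OF l'_ge] by (intro pivots_path[OF 2]) auto
  show "pivots l l' (arm2 l) (arm2 l')" "pivots l l' (arm3 l) (arm3 l')"
    unfolding arm2_def arm3_def using pivots_leaf[OF 2 pos] pivots_leaf[OF 3 pos] by auto
qed

text \<open>Monotonicity reduces the hypotheses of \<open>contradiction_triangle\<close> for all
  \<open>l\<close> between \<open>L\<close> and \<open>H\<close> to checks at end points. In the
  first alternative of \<open>start\<close> the inequality \<open>t \<le> arm2 l\<close> is kept as
  it stands, since its margin vanishes at the threshold and no end point estimate could give
  it.\<close>

lemma contradiction_interval:
  assumes l: "L \<le> l" "l \<le> H" and tb: "t \<le> tb" "tb \<le> c" and c: "c \<le> 1" "1 / L < c" "0 < L"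
    and c1: "tb \<le> c - (H - c - 1)\<^sup>2 / (c - 1 / L)"
    and c2: "tri H c < c"
    and start: "t \<le> arm2 l \<and> arm2 H \<le> c \<or> tb \<le> arm3 L \<and> arm3 H \<le> c \<and> 2 \<le> L"
  shows False
proof (rule contradiction_triangle)
  have "l * t = t * t + 1" using t by (simp add: l_eq field_simps)
  then have tl: "1 / l < t" using t l_ge by (simp add: field_simps)
  show "t \<le> c" using tb by simp
  then have c0: "0 < c" using t by simp
  show "c \<le> 1" using c by simp
  have "l - 1 / l - 1 / c > 0" using path_ge[OF \<open>t \<le> c\<close>] tl by linarith
  then show "tri l c < c"
    using tri_diff[of l H c c] l l_ge c c0 c2 by simp
  have "1 / l \<le> 1 / L" using l c by (intro divide_left_mono) auto
  then have "(l - c - 1)\<^sup>2 / (c - 1 / l) \<le> (H - c - 1)\<^sup>2 / (c - 1 / L)"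
    using l l_ge c by (intro frac_le power_mono) auto
  moreover have "tri l (1 / (l - c)) = c - (l - c - 1)\<^sup>2 / (c - 1 / l)"
  proof -
    have "(1 - (l - c))\<^sup>2 = (l - c - 1)\<^sup>2" by (simp add: power2_eq_square algebra_simps)
    then show ?thesis unfolding tri_def by simp
  qed
  ultimately show "t \<le> tri l (1 / (l - c))" using c1 tb by linarith
  let ?d = "if t \<le> arm2 l \<and> arm2 H \<le> c then arm2 else arm3"
  show "pivots l l' (?d l) (?d l')" using pivots_arm by simp
  show "t \<le> ?d l" using start tb arm_mono(2)[of L l] l by auto
  show "?d l \<le> c" using start arm_mono[of l H] l l_ge by auto
  show "?d l \<le> ?d l'" using arm_mono[of l l'] less l_ge by auto
qed

text \<open>With \<open>s = t\<^sup>2\<close> the difference \<open>arm2 l - t\<close> is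
  \<open>1 - (s\<^sup>2 + s ^ 3)\<close> over a positive denominator. This is the origin of the
  polynomial behind \<open>lambda_star\<close>.\<close>

lemma threshold_arm2:
  assumes "t ^ 4 + t ^ 6 \<le> 1"
  shows "t \<le> arm2 l"
proof -
  define s where "s = t\<^sup>2"
  have s: "0 < s" "s\<^sup>2 + s ^ 3 \<le> 1" using t assms by (auto simp: s_def power_mult[symmetric])
  have tt: "t * t = s" by (simp add: s_def power2_eq_square)
  have "l = (1 + s) / t" using t by (simp add: l_eq tt[symmetric] field_simps)
  then have "l - 1 / l = (1 + s) / t - t / (1 + s)" by simp
  also have "\<dots> = ((1 + s) * (1 + s) - t * t) / (t * (1 + s))"
    using t s(1) by (subst diff_frac_eq) auto
  also have "(1 + s) * (1 + s) - t * t = 1 + s + s\<^sup>2"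
    unfolding tt by (simp add: algebra_simps power2_eq_square)
  finally have x: "l - 1 / l = (1 + s + s\<^sup>2) / (t * (1 + s))" .
  have "(1 + s + s\<^sup>2) / (t * (1 + s)) - t = (1 + s + s\<^sup>2 - t * t * (1 + s)) / (t * (1 + s))"
    using t s(1) by (simp add: diff_divide_distrib)
  also have "1 + s + s\<^sup>2 - t * t * (1 + s) = 1" unfolding tt by (simp add: algebra_simps power2_eq_square)
  finally have y: "(1 + s + s\<^sup>2) / (t * (1 + s)) - t = 1 / (t * (1 + s))" .
  have "arm2 l - t = ((l - 1 / l) - t) - 1 / (l - 1 / l)" by (simp add: arm2_def)
  also have "\<dots> = 1 / (t * (1 + s)) - t * (1 + s) / (1 + s + s\<^sup>2)" unfolding x y by simp
  also have "\<dots> = (1 * (1 + s + s\<^sup>2) - t * (1 + s) * (t * (1 + s))) / (t * (1 + s) * (1 + s + s\<^sup>2))"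
    using t s(1) by (intro diff_frac_eq) (auto simp: add_pos_pos less_imp_neq[symmetric])
  also have "1 * (1 + s + s\<^sup>2) - t * (1 + s) * (t * (1 + s)) = 1 + s + s\<^sup>2 - s * (1 + s)\<^sup>2"
    unfolding tt[symmetric] by (simp add: power2_eq_square)
  also have "1 + s + s\<^sup>2 - s * (1 + s)\<^sup>2 = 1 - (s\<^sup>2 + s ^ 3)" 
    by (simp add: algebra_simps power2_eq_square power3_eq_cube)
  also have "0 \<le> (1 - (s\<^sup>2 + s ^ 3)) / (t * (1 + s) * (1 + s + s\<^sup>2))"
    using s t by (intro divide_nonneg_nonneg) auto
  finally show ?thesis by simp
qed

lemma l_bounds:
  assumes "a \<le> t" "t \<le> b" "0 < a" "b \<le> 1" "a + 1 / a \<le> H" "L \<le> b + 1 / b"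
  shows "L \<le> l" "l \<le> H"
  using inverse_sum_antimono[of a t] inverse_sum_antimono[of t b] assms t l_eq by linarith+

text \<open>Five intervals for \<open>t\<close>, each with its own \<open>c\<close>. The two with
  the largest \<open>t\<close> start from \<open>arm2\<close>; for smaller \<open>t\<close> this
  pivot exceeds the chosen \<open>c\<close>, and \<open>arm3\<close> takes its place.\<close>

lemma contradiction_small:
  assumes "t ^ 4 + t ^ 6 \<le> 1" "0.78 \<le> t" "t \<le> 0.8689"
  shows False
proof -
  note E = threshold_arm2[OF assms(1)]
  consider "0.8349 \<le> t" | "0.8234 \<le> t" "t \<le> 0.8349" | "0.8009 \<le> t" "t \<le> 0.8234"
    | "0.7869 \<le> t" "t \<le> 0.8009" | "t \<le> 0.7869" by linarith
  then show False
  proof cases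
    case 1
    from l_bounds[OF 1 assms(3), of "2.03265" "2.01978"]
    have "2.01978 \<le> l" "l \<le> 2.03265" by simp_all
    from contradiction_interval[OF this assms(3), of "0.908"] E show False
      by (simp add: tri_def arm2_def power2_eq_square)
  next
    case 2
    from l_bounds[OF 2, of "2.03788" "2.03264"]
    have "2.03264 \<le> l" "l \<le> 2.03788" by simp_all
    from contradiction_interval[OF this 2(2), of "0.901"] E show False
      by (simp add: tri_def arm2_def power2_eq_square)
  next
    case 3
    from l_bounds[OF 3, of "2.0495" "2.03787"]
    have "2.03787 \<le> l" "l \<le> 2.0495" by simp_all
    from contradiction_interval[OF this 3(2), of "0.889"] show False
      by (simp add: tri_def arm3_def power2_eq_square)
  next
    case 4
    from l_bounds[OF 4, of "2.05771" "2.04949"]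
    have "2.04949 \<le> l" "l \<le> 2.05771" by simp_all
    from contradiction_interval[OF this 4(2), of "0.881"] show False
      by (simp add: tri_def arm3_def power2_eq_square)
  next
    case 5
    from l_bounds[OF assms(2) 5, of "2.06212" "2.0577"]
    have "2.0577 \<le> l" "l \<le> 2.06212" by simp_all
    from contradiction_interval[OF this 5, of "0.877"] show False
      by (simp add: tri_def arm3_def power2_eq_square)
  qed
qed

text \<open>Since \<open>1 / l = t / (1 + t\<^sup>2)\<close>, the claim
  \<open>t + 1 / l \<le> 1\<close> is t^3 - t^2 + 2 t - 1 <= 0, whose real root is slightly below
  0.57.\<close>

lemma contradiction_wide:
  assumes "t \<le> 0.566"
  shows False
proof (rule contradiction_large)
  have "l = (1 + t\<^sup>2) / t" using t by (simp add: l_eq field_simps power2_eq_square)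
  then have eq: "1 / l = t / (1 + t\<^sup>2)" by simp
  have pos: "0 < 1 + t\<^sup>2" by (simp add: add_pos_nonneg)
  have 1: "t * (t * t) \<le> 0.566 * (t * t)" using assms t by (intro mult_right_mono) auto
  have "(k - t) * (2 - (1 - k) * (k + t)) = 2 * k - (1 - k) * (k * k) - 2 * t + (1 - k) * (t * t)" for k
    by (simp add: algebra_simps)
  note * = this[of "0.566"]
  have "0 \<le> (0.566 - t) * (2 - (1 - 0.566) * (0.566 + t))"
    using assms t by (intro mult_nonneg_nonneg) auto
  also note *
  finally have "t + t * (t * t) + t \<le> 1 + t * t" using 1 by simp
  then have "t * (1 + t\<^sup>2) + t \<le> 1 + t\<^sup>2" by (simp add: distrib_left power2_eq_square)
  then show "t + 1 / l \<le> 1" unfolding eq using pos by (simp add: field_simps)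
qed

end

definition qstar :: real where "qstar = 1 / sqrt rho"

text \<open>Because \<open>qstar\<^sup>2 = 1 / rho\<close>, dividing
  \<open>rho ^ 3 = 1 + rho\<close> by \<open>rho ^ 3\<close> gives the last equation. So
  \<open>qstar\<close> is the value of \<open>t\<close> that belongs to
  \<open>l = lambda_star\<close>.\<close>

lemma qstar:
  "0.8688 < qstar" "qstar < 0.8689" "lambda_star = qstar + 1 / qstar" "qstar ^ 4 + qstar ^ 6 = 1"
proof -
  have r: "1.324717 \<le> rho" "rho \<le> 1.324718" by (rule rho_root_bounds)+
  have s: "0 < sqrt rho" "(sqrt rho)\<^sup>2 = rho" using r by auto
  have q2: "qstar\<^sup>2 = 1 / rho" unfolding qstar_def using s by (simp add: power_divide)
  have pos: "0 < qstar" using s by (simp add: qstar_def)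
  have rpos: "0 < rho" using r by simp
  have "(0.8688 :: real)\<^sup>2 * rho \<le> 0.8688\<^sup>2 * 1.324718" using r by (intro mult_left_mono) auto
  also have "\<dots> < 1" by (simp add: power2_eq_square)
  finally have "(0.8688 :: real)\<^sup>2 < qstar\<^sup>2" unfolding q2 using rpos by (subst pos_less_divide_eq)
  then show "0.8688 < qstar" using pos by (rule power2_less_imp_less[OF _ less_imp_le])
  have "(1 :: real) < 0.8689\<^sup>2 * 1.324717" by (simp add: power2_eq_square)
  also have "\<dots> \<le> 0.8689\<^sup>2 * rho" using r by (intro mult_left_mono) auto
  finally have "qstar\<^sup>2 < (0.8689 :: real)\<^sup>2" unfolding q2 using rpos by (subst pos_divide_less_eq)
  then show "qstar < 0.8689" by (rule power2_less_imp_less) simp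
  show "lambda_star = qstar + 1 / qstar"
    using r unfolding lambda_star_def qstar_def by (simp add: powr_half_sqrt powr_minus_divide)
  have "qstar ^ 4 + qstar ^ 6 = (qstar\<^sup>2)\<^sup>2 + (qstar\<^sup>2) ^ 3" by (simp flip: power_mult)
  also have "\<dots> = (1 + rho) / rho ^ 3"
    unfolding q2 using rpos by (simp add: field_simps power2_eq_square power3_eq_cube)
  also have "\<dots> = 1" using rpos rho_root_bounds(1) by simp
  finally show "qstar ^ 4 + qstar ^ 6 = 1" .
qed

lemma exists_inverse_sum:
  assumes "2 \<le> (l :: real)"
  shows "\<exists>t. 0 < t \<and> t \<le> 1 \<and> l = t + 1 / t"
proof -
  define r where "r = sqrt (l\<^sup>2 - 4)"
  have "2\<^sup>2 \<le> l\<^sup>2" using assms by (intro power_mono) auto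
  then have r: "r\<^sup>2 = l\<^sup>2 - 4" "0 \<le> r" by (auto simp: r_def)
  have "r < l" by (rule power2_less_imp_less) (use r assms in auto)
  have "(l - 2)\<^sup>2 \<le> r\<^sup>2" unfolding r(1) using assms by (simp add: power2_eq_square algebra_simps)
  then have "l - 2 \<le> r" using r(2) by (rule power2_le_imp_le)
  define t where "t = (l - r) / 2"
  have "t * ((l + r) / 2) = 1" using r(1) by (simp add: t_def field_simps power2_eq_square)
  then have "1 / t = (l + r) / 2" by (metis divide_eq_eq mult_zero_left zero_neq_one mult.commute)
  then show ?thesis using \<open>r < l\<close> \<open>l - 2 \<le> r\<close>
    by (intro exI[of _ t]) (auto simp: t_def field_simps)
qed

text \<open>For \<open>s = t\<^sup>2\<close> the condition \<open>t + 1 / l < 1 / t\<close> is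
  \<open>s * s + s < 1\<close>; the limit for \<open>t\<close> is the square root of the inverse
  golden ratio, just above 0.786.\<close>

lemma (in spectral_gap) contradiction_between:
  assumes "0.566 \<le> t" "t \<le> 0.786" "l' \<le> 1 / l + 2 / (t + 1 / l)"
  shows False
proof (rule contradiction_medium)
  define s where "s = t\<^sup>2"
  have tt: "t * t = s" by (simp add: s_def power2_eq_square)
  have "t * t \<le> 0.786 * 0.786" using assms t by (intro mult_mono) auto
  then have s: "0 < s" "s \<le> 0.617796" using t unfolding tt by (simp_all add: s_def)
  have l1: "l = (1 + s) / t" using t by (simp add: l_eq tt[symmetric] field_simps)
  then have l2: "1 / l = t / (1 + s)" by simp
  have "s * s \<le> 0.617796 * 0.617796" using s by (intro mult_mono) auto
  then have ss: "s * s + s < 1" using s by simp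
  have "1 / t - t - t / (1 + s) = (1 - s - s * s) / (t * (1 + s))"
    using t s(1) by (simp add: field_simps) (simp add: tt[symmetric])
  also have "\<dots> > 0" using ss s t by simp
  finally show "t + 1 / l < 1 / t" unfolding l2 by simp
  have l_ub: "l \<le> 0.566 + 1 / 0.566"
    unfolding l_eq using assms t by (intro inverse_sum_antimono) auto
  have "1 / (0.566 + 1 / 0.566) \<le> 1 / l" using l_ub l_ge by (intro divide_left_mono) auto
  then have "0.4286 < 1 / l" by simp
  then show "l < 2 * t + 3 / l" using l_ub assms(1) by simp
  show "l' - 2 / (t + 1 / l) \<le> 1 / l" using assms(3) by simp
qed

text \<open>If the claim failed for \<open>d\<close>, then \<open>gap\<close> would hold between
  \<open>l\<close> and every larger \<open>l'\<close> up to \<open>l + d\<close>. The three ranges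
  of \<open>t\<close> correspond to expansion below 1, to the cross-ratio, and to triangles.\<close>

lemma spectral_limit_ge_lambda_star:
  assumes "p \<ge> 3" "lambda_star \<le> l" "d > 0"
  shows "\<exists>G \<in> colorable_class p. \<not> psd (adj_entry G) (verts G) l \<and> psd (adj_entry G) (verts G) (l + d)"
proof (rule ccontr)
  assume "\<not> ?thesis"
  then have H: "psd (adj_entry G) (verts G) l" if "G \<in> colorable_class p" "psd (adj_entry G) (verts G) (l + d)" for G
    using that by blast
  have l2: "2 \<le> l" using assms(2) inverse_sum_antimono[of qstar 1] qstar(1,2,3) by simp
  obtain t where t: "0 < t" "t \<le> 1" "l = t + 1 / t" using exists_inverse_sum[OF l2] by blast
  have gap: "spectral_gap l l' t t'" if "l < l'" "l' \<le> l + d" "0 < t'" "t' \<le> 1" "l' = t' + 1 / t'" for l' t'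
  proof
    fix n E x assume cg: "chain_graph n E" and pos: "\<And>x. 0 \<le> chain_form n E l' x"
    obtain G where G: "G \<in> colorable_class p"
      "\<And>l. psd (adj_entry G) (verts G) l \<longleftrightarrow> (\<forall>x. 0 \<le> chain_form n E l x)"
      using chain_graph_realize[OF cg assms(1)] by blast
    have "psd (adj_entry G) (verts G) l'" using G(2) pos by blast
    then have "psd (adj_entry G) (verts G) (l + d)" using that(2) by (rule psd_mono)
    then have "psd (adj_entry G) (verts G) l" using H G(1) by blast
    then show "0 \<le> chain_form n E l x" using G(2) by blast
  qed (use t that in auto)
  have gap': "\<exists>t'. spectral_gap l l' t t'" if "l < l'" "l' \<le> l + d" for l'
    using exists_inverse_sum[of l'] gap[OF that] that l2 by (meson less_imp_le order_trans)
  have "t \<le> qstar"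
  proof (rule inverse_sum_le_imp)
    show "qstar + 1 / qstar \<le> t + 1 / t" using assms(2) t(3) qstar(3) by simp
  qed (use t qstar in auto)
  consider "t \<le> 0.566" | "0.566 \<le> t" "t \<le> 0.786" | "0.786 \<le> t" by linarith
  then show False
  proof cases
    case 1
    obtain t' where "spectral_gap l (l + d) t t'" using gap'[of "l + d"] assms by auto
    then show False using 1 by (rule spectral_gap.contradiction_wide)
  next
    case 2
    have "l < 1 / l + 2 / (t + 1 / l)"
    proof -
      define s where "s = t\<^sup>2"
      have tt: "t * t = s" by (simp add: s_def power2_eq_square)
      have "t * t \<le> 0.786 * 0.786" using 2 t by (intro mult_mono) auto
      then have s: "0 < s" "s \<le> 0.617796" using t unfolding tt by (simp_all add: s_def)
      have "s * s \<le> 0.617796 * 0.617796" using s by (intro mult_mono) auto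
      then have ss: "s * s + s < 1" using s by simp
      have "l = (1 + s) / t" using t by (simp add: tt[symmetric] field_simps)
      then have l': "l = (1 + s) / t" "1 / l = t / (1 + s)" by simp_all
      have a: "t + 1 / l = t * (2 + s) / (1 + s)" unfolding l' using s t by (simp add: field_simps)
      have b: "l - 1 / l = (1 + s + s * s) / (t * (1 + s))"
        unfolding l' using s t by (simp add: field_simps) (simp add: tt[symmetric])
      have "s * (s * s + s) < s * 1" using ss s by (intro mult_strict_left_mono) auto
      then have "(1 + s + s * s) * (2 + s) < 2 * ((1 + s) * (1 + s))"
        by (simp add: algebra_simps)
      then have "(1 + s + s * s) / (t * (1 + s)) < 2 * (1 + s) / (t * (2 + s))"
        using s t by (simp add: divide_less_eq less_divide_eq frac_less_eq mult_ac)
      also have "\<dots> = 2 / (t + 1 / l)" unfolding a by simp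
      finally show ?thesis using b by simp
    qed
    \<comment> \<open>The middle range needs \<open>l'\<close> close to \<open>l\<close>, and a
      shorter gap is still a gap.\<close>
    define l' where "l' = min (l + d) (1 / l + 2 / (t + 1 / l))"
    have "l < l'" "l' \<le> l + d" "l' \<le> 1 / l + 2 / (t + 1 / l)"
      using \<open>l < 1 / l + 2 / (t + 1 / l)\<close> assms(3) by (auto simp: l'_def)
    then obtain t' where "spectral_gap l l' t t'" using gap' by blast
    then show False
      using 2 \<open>l' \<le> 1 / l + 2 / (t + 1 / l)\<close> by (rule spectral_gap.contradiction_between)
  next
    case 3
    obtain t' where g: "spectral_gap l (l + d) t t'" using gap'[of "l + d"] assms by auto
    have "t ^ 4 + t ^ 6 \<le> qstar ^ 4 + qstar ^ 6"
      using \<open>t \<le> qstar\<close> t by (intro add_mono power_mono) auto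
    then have "t ^ 4 + t ^ 6 \<le> 1" using qstar(4) by simp
    moreover have "t \<le> 0.8689" using \<open>t \<le> qstar\<close> qstar(2) by linarith
    moreover have "0.78 \<le> t" using 3 by simp
    ultimately show False using spectral_gap.contradiction_small[OF g] by blast
  qed
qed

section \<open>Routing charges along a rooted tree\<close>

definition delta :: "nat \<Rightarrow> nat \<Rightarrow> real" where
  "delta i = (\<lambda>x. if x = i then 1 else 0)"

lemma delta_simps [simp]: "delta i i = 1" "i \<noteq> j \<Longrightarrow> delta i j = 0" "j \<noteq> i \<Longrightarrow> delta i j = 0"
  by (auto simp: delta_def)

text \<open>The coordinates \<open>I\<close> form a graph whose edges are the vectors
  \<open>r u\<close> of the represented vertices \<open>u\<close>. Its breadth-first tree is given
  by the depth \<open>dep\<close>, the parent \<open>par\<close> and the vertex \<open>pe i\<close>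
  whose vector joins \<open>i\<close> to its parent with signs \<open>s i\<close> and
  \<open>t i\<close>; coordinates outside \<open>I\<close> also get depth 0. The adjacency to the
  new vertex is \<open>f\<close>, and \<open>far\<close> keeps its neighbors away from the root.
  \<open>energy\<close> is the quadratic form at a vector with value 1 at the new vertex; it
  requires a represented vertex with value 0, since only proper induced subgraphs are known to be
  nonnegative.\<close>

locale rooted_frame =
  fixes H I :: "nat set" and r :: "nat \<Rightarrow> nat \<Rightarrow> real" and f :: "nat \<Rightarrow> real" and q l :: real
    and dep par pe :: "nat \<Rightarrow> nat" and s t :: "nat \<Rightarrow> real" and N :: nat
  assumes finH: "finite H" and finI: "finite I"
    and q_bounds: "0.8688 < q" "q < 0.8692" and q_large: "1 < q ^ 4 + q ^ 6"
    and l_def: "l = q + 1 / q"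
    and N_pos: "0 < N" and N_large: "100 * q ^ (2 * N - 1) < q ^ 4 + q ^ 6 - 1" "10000 * q ^ (2 * N - 1) < 1"
    and tree: "\<And>i. 0 < dep i \<Longrightarrow> i \<in> I \<and> par i \<in> I \<and> dep i = Suc (dep (par i)) \<and> pe i \<in> H"
    and tree_edge: "\<And>i. 0 < dep i \<Longrightarrow> r (pe i) = (\<lambda>x. s i * delta i x + t i * delta (par i) x)"
    and signs: "\<And>i. 0 < dep i \<Longrightarrow> s i \<in> {-1, 1} \<and> t i \<in> {-1, 1}"
    and root_unique: "\<And>i j. i \<in> I \<Longrightarrow> j \<in> I \<Longrightarrow> dep i = 0 \<Longrightarrow> dep j = 0 \<Longrightarrow> i = j"
    and f_values: "\<And>u. u \<in> H \<Longrightarrow> f u \<in> {-1, 0, 1}"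
    and edge: "\<And>u. u \<in> H \<Longrightarrow> \<exists>i\<in>I. \<exists>j\<in>I. i \<noteq> j \<and>
        (\<exists>a\<in>{-1, 1}. \<exists>b\<in>{-1, 1}. r u = (\<lambda>x. a * delta i x + b * delta j x))"
    and bfs: "\<And>u i j. u \<in> H \<Longrightarrow> r u i \<noteq> 0 \<Longrightarrow> r u j \<noteq> 0 \<Longrightarrow> dep i \<le> Suc (dep j)"
    and far: "\<And>u i. u \<in> H \<Longrightarrow> f u \<noteq> 0 \<Longrightarrow> r u i \<noteq> 0 \<Longrightarrow> N < dep i"
    and inner_values: "\<And>u v. u \<in> H \<Longrightarrow> v \<in> H \<Longrightarrow> u \<noteq> v \<Longrightarrow> (\<Sum>i\<in>I. r u i * r v i) \<in> {-1, 0, 1}"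
    and energy: "\<And>x. (\<exists>u\<in>H. x u = 0) \<Longrightarrow> 0 \<le> l + 2 * (\<Sum>u\<in>H. x u * f u) +
        (\<Sum>i\<in>I. (\<Sum>u\<in>H. x u * r u i)\<^sup>2) + (l - 2) * (\<Sum>u\<in>H. (x u)\<^sup>2)"
begin

text \<open>\<open>k\<close> is the least cost of a unit charge on an infinite ray,
  \<open>\<epsilon>\<close> the weight of squared flows, \<open>\<eta>\<close> a bound for the extra
  cost of stopping before the root, and \<open>\<sigma> i\<close> the factor that a charge receives
  when it moves from \<open>i\<close> to its parent.\<close>

definition k :: real where "k = 1 - q"
definition \<epsilon> :: real where "\<epsilon> = l - 2"
definition \<eta> :: real where "\<eta> = q ^ (2 * N - 1)"
definition \<sigma> :: "nat \<Rightarrow> real" where "\<sigma> i = - s i * t i"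

lemma q_pos: "0 < q" "q < 1" using q_bounds by auto

lemma eps: "\<epsilon> = (1 - q)\<^sup>2 / q"
proof -
  have "(1 - q)\<^sup>2 / q = 1 / q - 2 + q"
    using q_pos by (simp add: field_simps power2_eq_square)
  then show ?thesis using \<epsilon>_def l_def by linarith
qed

lemma eps_nonneg: "0 \<le> \<epsilon>" using q_pos by (simp add: eps)

lemma s_sq: "0 < dep i \<Longrightarrow> s i * s i = 1" using signs[of i] by auto
lemma sigma_abs: "0 < dep i \<Longrightarrow> \<bar>\<sigma> i\<bar> = 1" using signs[of i] by (auto simp: \<sigma>_def)
lemma sigma_sq: "0 < dep i \<Longrightarrow> (\<sigma> i)\<^sup>2 = 1" using signs[of i] by (auto simp: \<sigma>_def)

lemma dep_par: "0 < dep i \<Longrightarrow> dep (par i) < dep i" using tree[of i] by simp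

lemma par_neq: "0 < dep i \<Longrightarrow> par i \<noteq> i" using dep_par[of i] by auto

lemma pe_inj:
  assumes "0 < dep i" "0 < dep j" "pe i = pe j"
  shows "i = j"
proof (rule ccontr)
  assume "i \<noteq> j"
  have e: "(\<lambda>x. s i * delta i x + t i * delta (par i) x) =
      (\<lambda>x. s j * delta j x + t j * delta (par j) x)"
    using tree_edge[OF assms(1)] tree_edge[OF assms(2)] assms(3) by simp
  have "i = par j"
    using fun_cong[OF e, of i] signs[OF assms(1)] signs[OF assms(2)] \<open>i \<noteq> j\<close> par_neq[OF assms(1)]
    by (auto simp: delta_def split: if_splits)
  moreover have "j = par i"
    using fun_cong[OF e, of j] signs[OF assms(1)] signs[OF assms(2)] \<open>i \<noteq> j\<close> par_neq[OF assms(2)]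
    by (auto simp: delta_def split: if_splits)
  ultimately show False using dep_par[OF assms(1)] dep_par[OF assms(2)] by simp
qed

text \<open>A unit charge at \<open>i\<close> flows towards the root, losing the fraction \<open>1 - q\<close> at every vertex;
  \<open>Y i\<close> is the charge left behind and \<open>X i\<close> are the flows. The flow stops at depth 1, so that
  the edges at the root are never used.\<close>

function Y :: "nat \<Rightarrow> nat \<Rightarrow> real" where
  "Y i = (if dep i \<le> 1 then delta i
          else (\<lambda>x. (1 - q) * delta i x + q * \<sigma> i * Y (par i) x))"
  by auto
termination by (relation "Wellfounded.measure dep") (auto intro!: dep_par)

function X :: "nat \<Rightarrow> nat \<Rightarrow> real" where
  "X i = (if dep i \<le> 1 then (\<lambda>_. 0)
          else (\<lambda>u. - q * s i * delta (pe i) u + q * \<sigma> i * X (par i) u))"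
  by auto
termination by (relation "Wellfounded.measure dep") (auto intro!: dep_par)

declare Y.simps [simp del] X.simps [simp del]

lemma Y_support: "Y i x \<noteq> 0 \<Longrightarrow> x = i \<or> dep x < dep i"
proof (induction i rule: measure_induct_rule[of dep])
  case (less i)
  show ?case
  proof (cases "dep i \<le> 1")
    case True then show ?thesis using less.prems by (auto simp: Y.simps[of i] delta_def split: if_splits)
  next
    case False
    then have "0 < dep i" by simp
    have "x = i \<or> Y (par i) x \<noteq> 0"
      using less.prems False by (auto simp: Y.simps[of i] delta_def split: if_splits)
    then show ?thesis using less.IH[OF dep_par[OF \<open>0 < dep i\<close>]] dep_par[OF \<open>0 < dep i\<close>] by auto
  qed
qed

lemma X_support: "X i u \<noteq> 0 \<Longrightarrow> \<exists>j. u = pe j \<and> 2 \<le> dep j \<and> (j = i \<or> dep j < dep i)"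
proof (induction i rule: measure_induct_rule[of dep])
  case (less i)
  show ?case
  proof (cases "dep i \<le> 1")
    case True then show ?thesis using less.prems by (simp add: X.simps[of i])
  next
    case False
    then have "0 < dep i" by simp
    have "u = pe i \<or> X (par i) u \<noteq> 0"
      using less.prems False by (auto simp: X.simps[of i] delta_def split: if_splits)
    then show ?thesis
    proof
      assume "u = pe i" then show ?thesis using False by auto
    next
      assume "X (par i) u \<noteq> 0"
      from less.IH[OF dep_par[OF \<open>0 < dep i\<close>] this] show ?thesis
        using dep_par[OF \<open>0 < dep i\<close>] by auto
    qed
  qed
qed

lemma X_pe_zero:
  assumes "0 < dep j" "j \<noteq> i" "dep i \<le> dep j"
  shows "X i (pe j) = 0"
proof (rule ccontr)
  assume "X i (pe j) \<noteq> 0"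
  then obtain m where m: "pe j = pe m" "2 \<le> dep m" "m = i \<or> dep m < dep i" using X_support by blast
  then have "j = m" using pe_inj[OF assms(1), of m] by simp
  with m assms show False by auto
qed

section \<open>Boundary and cost of routed charges\<close>

lemma sum_delta: "finite A \<Longrightarrow> i \<in> A \<Longrightarrow> (\<Sum>x\<in>A. delta i x * g x) = g i"
  by (simp add: delta_def if_distrib[of "\<lambda>z. z * _"] cong: if_cong)

text \<open>The flow telescopes along the path to the root: it removes the unit charge at
  \<open>i\<close> and deposits \<open>Y i\<close>. The factor \<open>- s i\<close> in the flow
  compensates for the sign of the root vector at \<open>i\<close>.\<close>

lemma boundary_X: "i \<in> I \<Longrightarrow> (\<Sum>u\<in>H. X i u * r u x) = Y i x - delta i x"
proof (induction i rule: measure_induct_rule[of dep])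
  case (less i)
  show ?case
  proof (cases "dep i \<le> 1")
    case True then show ?thesis by (simp add: X.simps[of i] Y.simps[of i])
  next
    case False
    then have d: "0 < dep i" by simp
    have "(\<Sum>u\<in>H. X i u * r u x) = (\<Sum>u\<in>H. - q * s i * (delta (pe i) u * r u x) + q * \<sigma> i * (X (par i) u * r u x))"
      using False by (intro sum.cong) (simp_all add: X.simps[of i] algebra_simps)
    also have "\<dots> = - q * s i * (\<Sum>u\<in>H. delta (pe i) u * r u x) + q * \<sigma> i * (\<Sum>u\<in>H. X (par i) u * r u x)"
      by (simp only: sum.distrib sum_distrib_left)
    also have "(\<Sum>u\<in>H. delta (pe i) u * r u x) = r (pe i) x"
      using tree[OF d] finH by (intro sum_delta) auto
    also have "(\<Sum>u\<in>H. X (par i) u * r u x) = Y (par i) x - delta (par i) x"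
      using less.IH[OF dep_par[OF d]] tree[OF d] by simp
    also have "- q * s i * r (pe i) x + q * \<sigma> i * (Y (par i) x - delta (par i) x) =
        - q * (s i * s i) * delta i x + q * \<sigma> i * Y (par i) x"
      unfolding tree_edge[OF d] \<sigma>_def by (simp add: algebra_simps)
    finally show ?thesis using False unfolding s_sq[OF d] by (simp add: Y.simps[of i] algebra_simps)
  qed
qed

text \<open>The mixed energy of two unit charges routed towards the root; every later estimate of a
  test vector is expressed by it.\<close>

definition M :: "nat \<Rightarrow> nat \<Rightarrow> real" where
  "M i j = (\<Sum>x\<in>I. Y i x * Y j x) + \<epsilon> * (\<Sum>u\<in>H. X i u * X j u)"

lemma M_commute: "M i j = M j i"
  by (simp add: M_def mult.commute)

text \<open>The route from \<open>j\<close> starts no deeper than \<open>i\<close> and elsewhere, so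
  it meets neither \<open>i\<close> nor the edge above it. The first step from \<open>i\<close>
  contributes only the factor \<open>q * \<sigma> i\<close>.\<close>

lemma M_step:
  assumes "2 \<le> dep i" "j \<noteq> i" "dep j \<le> dep i"
  shows "M i j = q * \<sigma> i * M (par i) j"
proof -
  have d: "0 < dep i" using assms by simp
  have "Y j i = 0" using Y_support[of j i] assms by auto
  have "X j (pe i) = 0" using X_pe_zero[OF d] assms by auto
  have "(\<Sum>x\<in>I. Y i x * Y j x) = (\<Sum>x\<in>I. (1 - q) * (delta i x * Y j x) + q * \<sigma> i * (Y (par i) x * Y j x))"
    using assms by (intro sum.cong) (simp_all add: Y.simps[of i] algebra_simps)
  also have "\<dots> = (1 - q) * (\<Sum>x\<in>I. delta i x * Y j x) + q * \<sigma> i * (\<Sum>x\<in>I. Y (par i) x * Y j x)"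
    by (simp only: sum.distrib sum_distrib_left)
  also have "(\<Sum>x\<in>I. delta i x * Y j x) = 0"
    using tree[OF d] finI \<open>Y j i = 0\<close> by (subst sum_delta) auto
  finally have 1: "(\<Sum>x\<in>I. Y i x * Y j x) = q * \<sigma> i * (\<Sum>x\<in>I. Y (par i) x * Y j x)" by simp
  have "(\<Sum>u\<in>H. X i u * X j u) = (\<Sum>u\<in>H. - q * s i * (delta (pe i) u * X j u) + q * \<sigma> i * (X (par i) u * X j u))"
    using assms by (intro sum.cong) (simp_all add: X.simps[of i] algebra_simps)
  also have "\<dots> = - q * s i * (\<Sum>u\<in>H. delta (pe i) u * X j u) + q * \<sigma> i * (\<Sum>u\<in>H. X (par i) u * X j u)"
    by (simp only: sum.distrib sum_distrib_left)
  also have "(\<Sum>u\<in>H. delta (pe i) u * X j u) = 0"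
    using tree[OF d] finH \<open>X j (pe i) = 0\<close> by (subst sum_delta) auto
  finally have 2: "(\<Sum>u\<in>H. X i u * X j u) = q * \<sigma> i * (\<Sum>u\<in>H. X (par i) u * X j u)" by simp
  show ?thesis unfolding M_def 1 2 by (simp add: algebra_simps)
qed

text \<open>The recursion is \<open>M i i = (1 - q)\<^sup>2 + \<epsilon> * q\<^sup>2 + q\<^sup>2 * M
  (par i) (par i)\<close>, with fixed point \<open>k\<close>; among all fractions that could be
  passed on, \<open>q\<close> makes this fixed point least. The start value 1 at depth 1 leaves the
  excess \<open>q ^ (2 * dep i - 1)\<close>.\<close>

lemma M_diag: "1 \<le> dep i \<Longrightarrow> M i i = k + q ^ (2 * dep i - 1)"
proof (induction i rule: measure_induct_rule[of dep])
  case (less i)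
  then have d: "0 < dep i" by simp
  note i = tree[OF d]
  show ?case
  proof (cases "dep i = 1")
    case True
    have "(\<Sum>x\<in>I. delta i x * delta i x) = 1" using i finI by (subst sum_delta) auto
    with True show ?thesis by (simp add: M_def Y.simps[of i] X.simps[of i] k_def)
  next
    case False
    then have d2: "2 \<le> dep i" using d by simp
    have Yp: "Y (par i) i = 0" using Y_support[of "par i" i] dep_par[OF d] by fastforce
    have Xp: "X (par i) (pe i) = 0" using X_pe_zero[OF d, of "par i"] dep_par[OF d] par_neq[OF d] by simp
    have "(\<Sum>x\<in>I. Y i x * Y i x) = (\<Sum>x\<in>I. delta i x * ((1 - q)\<^sup>2 * delta i x + 2 * (1 - q) * q * \<sigma> i * Y (par i) x)
        + (q * \<sigma> i)\<^sup>2 * (Y (par i) x * Y (par i) x))"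
      using d2 by (intro sum.cong) (simp_all add: Y.simps[of i] algebra_simps power2_eq_square)
    also have "\<dots> = (\<Sum>x\<in>I. delta i x * ((1 - q)\<^sup>2 * delta i x + 2 * (1 - q) * q * \<sigma> i * Y (par i) x))
        + (q * \<sigma> i)\<^sup>2 * (\<Sum>x\<in>I. Y (par i) x * Y (par i) x)"
      by (simp only: sum.distrib sum_distrib_left)
    also have "(\<Sum>x\<in>I. delta i x * ((1 - q)\<^sup>2 * delta i x + 2 * (1 - q) * q * \<sigma> i * Y (par i) x)) = (1 - q)\<^sup>2"
      using i finI Yp by (subst sum_delta) auto
    finally have 1: "(\<Sum>x\<in>I. Y i x * Y i x) = (1 - q)\<^sup>2 + q\<^sup>2 * (\<Sum>x\<in>I. Y (par i) x * Y (par i) x)"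
      using sigma_sq[OF d] by (simp add: power_mult_distrib)
    have "(\<Sum>u\<in>H. X i u * X i u) = (\<Sum>u\<in>H. delta (pe i) u * ((q * s i)\<^sup>2 * delta (pe i) u - 2 * q * s i * q * \<sigma> i * X (par i) u)
        + (q * \<sigma> i)\<^sup>2 * (X (par i) u * X (par i) u))"
      using d2 by (intro sum.cong) (simp_all add: X.simps[of i] algebra_simps power2_eq_square)
    also have "\<dots> = (\<Sum>u\<in>H. delta (pe i) u * ((q * s i)\<^sup>2 * delta (pe i) u - 2 * q * s i * q * \<sigma> i * X (par i) u))
        + (q * \<sigma> i)\<^sup>2 * (\<Sum>u\<in>H. X (par i) u * X (par i) u)"
      by (simp only: sum.distrib sum_distrib_left)
    also have "(\<Sum>u\<in>H. delta (pe i) u * ((q * s i)\<^sup>2 * delta (pe i) u - 2 * q * s i * q * \<sigma> i * X (par i) u)) = (q * s i)\<^sup>2"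
      using i finH Xp by (subst sum_delta) auto
    finally have 2: "(\<Sum>u\<in>H. X i u * X i u) = q\<^sup>2 + q\<^sup>2 * (\<Sum>u\<in>H. X (par i) u * X (par i) u)"
      using sigma_sq[OF d] s_sq[OF d] by (simp add: power_mult_distrib power2_eq_square[of "s i"])
    have "M i i = (1 - q)\<^sup>2 + \<epsilon> * q\<^sup>2 + q\<^sup>2 * M (par i) (par i)"
      unfolding M_def 1 2 by (simp add: algebra_simps)
    also have "M (par i) (par i) = k + q ^ (2 * dep (par i) - 1)"
      using less.IH[OF dep_par[OF d]] i d2 by simp
    also have "\<epsilon> * q\<^sup>2 = (1 - q)\<^sup>2 * q" unfolding eps using q_pos by (simp add: power2_eq_square)
    also have "(1 - q)\<^sup>2 + (1 - q)\<^sup>2 * q + q\<^sup>2 * (k + q ^ (2 * dep (par i) - 1)) = k + q\<^sup>2 * q ^ (2 * dep (par i) - 1)"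
      by (simp add: k_def algebra_simps power2_eq_square)
    also have "q\<^sup>2 * q ^ (2 * dep (par i) - 1) = q ^ (2 * dep i - 1)"
      using i d2 by (simp flip: power_add)
    finally show ?thesis .
  qed
qed

text \<open>Tree distance, computed by moving the deeper coordinate to its parent, the same
  recursion as in \<open>M_step\<close>. The value 1 for two different coordinates of depth 0 is a
  default: \<open>I\<close> contains at most one such coordinate.\<close>

function td :: "nat \<Rightarrow> nat \<Rightarrow> nat" where
  "td i j = (if i = j then 0
     else if dep j \<le> dep i then (if dep i = 0 then 1 else Suc (td (par i) j))
     else Suc (td i (par j)))"
  by auto
termination by (relation "Wellfounded.measure (\<lambda>(i, j). dep i + dep j)") (auto simp: not_le intro!: dep_par)

declare td.simps [simp del]

lemma td_commute: "td i j = td j i"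
proof (induction "dep i + dep j" arbitrary: i j rule: less_induct)
  case less
  consider "i = j" | "i \<noteq> j" "dep j < dep i" | "i \<noteq> j" "dep i < dep j" | "i \<noteq> j" "dep i = dep j" by linarith
  then show ?case
  proof cases
    case 2
    then have "0 < dep i" by simp
    then have "td (par i) j = td j (par i)" using less[of "par i" j] dep_par[of i] by simp
    then show ?thesis using 2 by (simp add: td.simps[of i j] td.simps[of j i])
  next
    case 3
    then have "0 < dep j" by simp
    then have "td i (par j) = td (par j) i" using less[of i "par j"] dep_par[of j] by simp
    then show ?thesis using 3 by (simp add: td.simps[of i j] td.simps[of j i])
  next
    case 4
    show ?thesis
    proof (cases "dep i = 0")
      case True then show ?thesis using 4 by (simp add: td.simps[of i j] td.simps[of j i])
    next
      case False
      then have "0 < dep i" "0 < dep j" using 4 by auto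
      then have d: "dep (par i) < dep i" "dep (par j) < dep j" using dep_par by auto
      have "td (par i) (par j) = td (par j) (par i)" using less[of "par i" "par j"] d by simp
      moreover have "td (par i) j = Suc (td (par i) (par j))"
        using d 4 by (subst td.simps) auto
      moreover have "td (par j) i = Suc (td (par j) (par i))"
        using d 4 by (subst td.simps) auto
      ultimately show ?thesis using 4 False by (simp add: td.simps[of i j] td.simps[of j i])
    qed
  qed simp
qed

text \<open>Each step towards the meeting point costs a factor \<open>q\<close>, and there a
  diagonal entry remains. Routes that reach different coordinates of depth 1 stop without meeting,
  and the entry is 0.\<close>

lemma M_bound:
  assumes "1 \<le> dep i" "1 \<le> dep j"
  shows "\<bar>M i j\<bar> \<le> k * q ^ td i j + q ^ (dep i + dep j - 1)"
  using assms
proof (induction "dep i + dep j" arbitrary: i j rule: less_induct)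
  case less
  have k0: "0 \<le> k" using q_pos by (simp add: k_def)
  have q0: "0 \<le> q" using q_pos by simp
  have main: "\<bar>M i j\<bar> \<le> k * q ^ Suc (td (par i) j) + q ^ (dep i + dep j - 1)"
    if ij: "i \<noteq> j" "dep j \<le> dep i" "1 \<le> dep j"
      and IH: "2 \<le> dep i \<Longrightarrow> \<bar>M (par i) j\<bar> \<le> k * q ^ td (par i) j + q ^ (dep (par i) + dep j - 1)"
    for i j
  proof (cases "2 \<le> dep i")
    case True
    have d: "0 < dep i" using True by simp
    have "\<bar>M i j\<bar> = q * \<bar>M (par i) j\<bar>"
      using M_step[OF True, of j] ij sigma_abs[OF d] q_pos by (simp add: abs_mult)
    also have "\<dots> \<le> q * (k * q ^ td (par i) j + q ^ (dep (par i) + dep j - 1))"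
      using IH[OF True] q0 by (intro mult_left_mono) auto
    also have "\<dots> = k * q ^ Suc (td (par i) j) + q ^ (dep i + dep j - 1)"
    proof -
      have "dep i + dep j - 1 = Suc (dep (par i) + dep j - 1)" using tree[OF d] True by simp
      then show ?thesis by (simp add: algebra_simps)
    qed
    finally show ?thesis .
  next
    case False
    then have one: "dep i = 1" "dep j = 1" using ij by auto
    have "(\<Sum>x\<in>I. delta i x * delta j x) = 0"
      using ij(1) tree[of i] one finI by (subst sum_delta) auto
    then have "M i j = 0" using one by (simp add: M_def Y.simps[of i] Y.simps[of j] X.simps[of i])
    then show ?thesis using k0 q0 by simp
  qed
  show ?case
  proof (cases "i = j")
    case True
    then show ?thesis
      using M_diag[of i] less.prems k0 q0 by (simp add: td.simps[of j j] mult_2)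
  next
    case False
    show ?thesis
    proof (cases "dep j \<le> dep i")
      case True
      have "td i j = Suc (td (par i) j)" using False True less.prems by (subst td.simps) auto
      moreover have "\<bar>M (par i) j\<bar> \<le> k * q ^ td (par i) j + q ^ (dep (par i) + dep j - 1)" if "2 \<le> dep i"
        using that less.hyps[of "par i" j] tree[of i] less.prems by simp
      ultimately show ?thesis using main[OF False True less.prems(2)] by simp
    next
      case False2: False
      then have ji: "j \<noteq> i" "dep i \<le> dep j" using False by auto
      have "td i j = Suc (td (par j) i)"
        unfolding td_commute[of i j] using ji less.prems by (subst td.simps) auto
      moreover have "\<bar>M (par j) i\<bar> \<le> k * q ^ td (par j) i + q ^ (dep (par j) + dep i - 1)" if "2 \<le> dep j"
        using that less.hyps[of "par j" i] tree[of j] less.prems by simp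
      ultimately show ?thesis
        using main[OF ji less.prems(1)] by (simp add: M_commute[of i j] add.commute[of "dep i"])
    qed
  qed
qed

lemma M_bound_deep:
  assumes "N \<le> dep i" "N \<le> dep j"
  shows "\<bar>M i j\<bar> \<le> k * q ^ td i j + \<eta>"
proof -
  have "q ^ (dep i + dep j - 1) \<le> q ^ (2 * N - 1)"
    using assms q_pos by (intro power_decreasing) auto
  then show ?thesis using M_bound[of i j] assms N_pos by (simp add: \<eta>_def)
qed

text \<open>A tree is bipartite. This later excludes triples of pairwise distances with odd sum,
  such as 1, 3, 3.\<close>

lemma td_even: "i \<in> I \<Longrightarrow> j \<in> I \<Longrightarrow> even (td i j + dep i + dep j)"
proof (induction "dep i + dep j" arbitrary: i j rule: less_induct)
  case less
  consider "i = j" | "i \<noteq> j" "dep j \<le> dep i" | "i \<noteq> j" "dep i < dep j" by linarith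
  then show ?case
  proof cases
    case 1 then show ?thesis by (simp add: td.simps)
  next
    case 2
    then have d: "0 < dep i" using root_unique[of i j] less.prems by fastforce
    have "even (td (par i) j + dep (par i) + dep j)"
      using less.hyps[of "par i" j] tree[OF d] less.prems by simp
    then show ?thesis using 2 d tree[OF d] by (simp add: td.simps[of i j])
  next
    case 3
    then have d: "0 < dep j" by simp
    have "even (td i (par j) + dep i + dep (par j))"
      using less.hyps[of i "par j"] tree[OF d] less.prems by simp
    then show ?thesis using 3 d tree[OF d] by (simp add: td.simps[of i j])
  qed
qed

lemma td_eq_0: "td i j = 0 \<longleftrightarrow> i = j"
  by (subst td.simps) auto

lemma td_1:
  assumes "dep j \<le> dep i" "0 < dep i" "td i j = 1"
  shows "par i = j"
proof -
  have "i \<noteq> j"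
  proof
    assume "i = j"
    then have "td i j = 0" by (simp add: td_eq_0)
    then show False using assms(3) by simp
  qed
  then have "td (par i) j = 0" using assms unfolding td.simps[of i j] by simp
  then show ?thesis by (simp add: td_eq_0)
qed

lemma td_2:
  assumes "dep j \<le> dep i" "0 < dep i" "0 < dep j" "td i j = 2"
  shows "dep j < dep i \<and> par (par i) = j \<or> dep j = dep i \<and> par i = par j"
proof -
  have ne: "i \<noteq> j"
  proof
    assume "i = j"
    then have "td i j = 0" by (simp add: td_eq_0)
    then show False using assms(4) by simp
  qed
  then have t1: "td (par i) j = 1" using assms(1,2,4) unfolding td.simps[of i j] by simp
  then have ne': "par i \<noteq> j" using td_eq_0[of "par i" j] by simp
  show ?thesis
  proof (cases "dep j \<le> dep (par i)")
    case True
    then have "par (par i) = j" using t1 assms by (intro td_1) auto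
    then show ?thesis using True dep_par[OF assms(2)] by auto
  next
    case False
    then have "td (par i) (par j) = 0" using t1 ne' unfolding td.simps[of "par i" j] by simp
    then have "par i = par j" by (simp add: td_eq_0)
    then show ?thesis using tree[OF assms(2)] tree[OF assms(3)] by simp
  qed
qed

section \<open>The potential and the energy of test vectors\<close>

text \<open>The potential forced by \<open>f\<close> along the tree: \<open>f u\<close> is the inner product of \<open>w\<close> with
  \<open>r u\<close> for every tree edge \<open>u\<close>.\<close>

function w :: "nat \<Rightarrow> real" where
  "w i = (if dep i = 0 then 0 else s i * (f (pe i) - t i * w (par i)))"
  by auto
termination by (relation "Wellfounded.measure dep") (auto intro!: dep_par)

declare w.simps [simp del]

lemma w_step: "0 < dep i \<Longrightarrow> s i * f (pe i) = w i - \<sigma> i * w (par i)"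
  by (simp add: w.simps[of i] \<sigma>_def algebra_simps)

lemma w_edge: "0 < dep i \<Longrightarrow> f (pe i) = s i * w i + t i * w (par i)"
proof -
  assume d: "0 < dep i"
  have "s i * w i = (s i * s i) * (f (pe i) - t i * w (par i))"
    using d by (simp add: w.simps[of i])
  then show ?thesis using s_sq[OF d] by simp
qed

lemma w_Ints: "w i \<in> \<int>"
proof (induction i rule: measure_induct_rule[of dep])
  case (less i)
  show ?case
  proof (cases "dep i = 0")
    case True then show ?thesis by (simp add: w.simps[of i])
  next
    case False
    then have d: "0 < dep i" by simp
    have "s i \<in> \<int>" "t i \<in> \<int>" "f (pe i) \<in> \<int>"
      using signs[OF d] f_values[of "pe i"] tree[OF d] by auto
    then show ?thesis using less[OF dep_par[OF d]] d
      by (simp add: w.simps[of i])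
  qed
qed

lemma w_far: "w i \<noteq> 0 \<Longrightarrow> N < dep i"
proof (induction i rule: measure_induct_rule[of dep])
  case (less i)
  then have d: "0 < dep i" by (intro gr0I) (simp add: w.simps[of i])
  have "f (pe i) \<noteq> 0 \<or> w (par i) \<noteq> 0" using less.prems d by (auto simp: w.simps[of i])
  then show ?case
  proof
    assume "f (pe i) \<noteq> 0"
    moreover have "r (pe i) i \<noteq> 0"
      using tree_edge[OF d] signs[OF d] par_neq[OF d] by auto
    ultimately show ?thesis using far[of "pe i" i] tree[OF d] by simp
  next
    assume "w (par i) \<noteq> 0"
    then show ?thesis using less.IH[OF dep_par[OF d]] dep_par[OF d] by simp
  qed
qed

lemma w_I: "w i \<noteq> 0 \<Longrightarrow> i \<in> I"
  using w_far[of i] tree[of i] by simp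

lemma w_adjacent: "0 < dep i \<Longrightarrow> \<bar>w i - \<sigma> i * w (par i)\<bar> \<le> 1"
  using w_step[of i] signs[of i] f_values[of "pe i"] tree[of i] by auto

lemma inner_tree_edge: "0 < dep j \<Longrightarrow> f (pe j) = (\<Sum>i\<in>I. w i * r (pe j) i)"
proof -
  assume d: "0 < dep j"
  have "(\<Sum>i\<in>I. w i * r (pe j) i) = (\<Sum>i\<in>I. delta j i * (s j * w i) + delta (par j) i * (t j * w i))"
    unfolding tree_edge[OF d] by (intro sum.cong) (simp_all add: algebra_simps)
  also have "\<dots> = s j * w j + t j * w (par j)"
    using tree[OF d] finI by (simp add: sum.distrib sum_delta)
  finally show ?thesis using w_edge[OF d] by simp
qed

lemma exists_depth_one: "0 < dep i \<Longrightarrow> \<exists>j. dep j = 1"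
proof (induction i rule: measure_induct_rule[of dep])
  case (less i)
  show ?case
  proof (cases "dep i = 1")
    case False
    then have "0 < dep (par i)" using tree[OF less.prems] by simp
    then show ?thesis using less.IH[OF dep_par[OF less.prems]] by simp
  qed blast
qed

lemma X_depth_one: "dep j = 1 \<Longrightarrow> X i (pe j) = 0"
proof (rule ccontr)
  assume j: "dep j = 1" "X i (pe j) \<noteq> 0"
  obtain m where m: "pe j = pe m" "2 \<le> dep m" using X_support[OF j(2)] by blast
  then have "j = m" using pe_inj[of j m] j by simp
  with m j show False by simp
qed

lemma sum_X_f:
  assumes "i \<in> I"
  shows "(\<Sum>u\<in>H. X i u * f u) = (\<Sum>m\<in>I. w m * Y i m) - w i"
proof -
  have "(\<Sum>u\<in>H. X i u * f u) = (\<Sum>u\<in>H. X i u * (\<Sum>m\<in>I. w m * r u m))"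
  proof (rule sum.cong[OF refl])
    fix u assume "u \<in> H"
    show "X i u * f u = X i u * (\<Sum>m\<in>I. w m * r u m)"
    proof (cases "X i u = 0")
      case False
      then obtain j where "u = pe j" "2 \<le> dep j" using X_support by blast
      then show ?thesis using inner_tree_edge[of j] by simp
    qed simp
  qed
  also have "\<dots> = (\<Sum>m\<in>I. w m * (\<Sum>u\<in>H. X i u * r u m))"
    unfolding sum_distrib_left by (subst sum.swap) (simp add: mult_ac)
  also have "\<dots> = (\<Sum>m\<in>I. w m * Y i m - delta i m * w m)"
    unfolding boundary_X[OF assms] by (intro sum.cong) (simp_all add: algebra_simps)
  also have "\<dots> = (\<Sum>m\<in>I. w m * Y i m) - w i"
    using assms finI by (simp add: sum_subtractf sum_delta)
  finally show ?thesis .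
qed

lemma sum_single:
  assumes "finite A" "z \<in> A" "\<And>i. i \<in> A \<Longrightarrow> i \<noteq> z \<Longrightarrow> g i = (0 :: real)"
  shows "sum g A = g z"
  using assms by (subst sum.remove[of A z]) (auto intro: sum.neutral)

text \<open>Charges are moved by explicit flows \<open>x\<close> to a vertex \<open>z\<close>, and from there along the tree.\<close>

lemma local_energy:
  assumes z: "z \<in> I" "0 < dep z"
    and disj: "\<And>u. u \<in> H \<Longrightarrow> x u \<noteq> 0 \<Longrightarrow> X z u = 0"
    and one: "\<And>j. dep j = 1 \<Longrightarrow> x (pe j) = 0"
    and P_def: "P = (\<lambda>i. \<Sum>u\<in>H. x u * r u i)"
    and P0: "\<And>i. dep i < dep z \<Longrightarrow> P i = 0"
    and w0: "\<And>i. dep i < dep z \<Longrightarrow> w i = 0"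
    and T_def: "T = P z + w z"
  shows "0 \<le> l + 2 * (\<Sum>u\<in>H. x u * f u) + (w z)\<^sup>2 - 2 * T * w z + (\<Sum>i\<in>I - {z}. (P i)\<^sup>2)
    + T\<^sup>2 * M z z + \<epsilon> * (\<Sum>u\<in>H. (x u)\<^sup>2)"
proof -
  let ?x = "\<lambda>u. x u + T * X z u"
  \<comment> \<open>The test vector vanishes at the vertex of an edge at the root: routed flows stop
    at depth 1, and \<open>one\<close> excludes the explicit flow there.\<close>
  obtain j where j: "dep j = 1" using exists_depth_one[OF z(2)] by blast
  have "?x (pe j) = 0" "pe j \<in> H" using one[OF j] X_depth_one[OF j] tree[of j] j by auto
  then have "0 \<le> l + 2 * (\<Sum>u\<in>H. ?x u * f u) + (\<Sum>i\<in>I. (\<Sum>u\<in>H. ?x u * r u i)\<^sup>2)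
      + (l - 2) * (\<Sum>u\<in>H. (?x u)\<^sup>2)" by (intro energy) blast
  also have "(\<Sum>u\<in>H. ?x u * f u) = (\<Sum>u\<in>H. x u * f u) + T * (w z * Y z z - w z)"
  proof -
    have "(\<Sum>u\<in>H. ?x u * f u) = (\<Sum>u\<in>H. x u * f u + T * (X z u * f u))"
      by (intro sum.cong) (simp_all add: algebra_simps)
    also have "\<dots> = (\<Sum>u\<in>H. x u * f u) + T * (\<Sum>u\<in>H. X z u * f u)"
      by (simp add: sum.distrib sum_distrib_left)
    also have "(\<Sum>m\<in>I. w m * Y z m) = w z * Y z z"
      using z finI w0 Y_support[of z] by (intro sum_single) force+
    then have "(\<Sum>u\<in>H. X z u * f u) = w z * Y z z - w z" using sum_X_f[OF z(1)] by simp
    finally show ?thesis .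
  qed
  also have "(\<Sum>i\<in>I. (\<Sum>u\<in>H. ?x u * r u i)\<^sup>2) =
      (\<Sum>i\<in>I - {z}. (P i)\<^sup>2) + T\<^sup>2 * (\<Sum>i\<in>I. Y z i * Y z i) - 2 * T * w z * Y z z + (w z)\<^sup>2"
  proof -
    have B: "(\<Sum>u\<in>H. ?x u * r u i) = P i + T * (Y z i - delta z i)" for i
    proof -
      have "(\<Sum>u\<in>H. ?x u * r u i) = (\<Sum>u\<in>H. x u * r u i + T * (X z u * r u i))"
        by (intro sum.cong) (simp_all add: algebra_simps)
      then show ?thesis unfolding P_def boundary_X[OF z(1), symmetric]
        by (simp add: sum.distrib sum_distrib_left)
    qed
    have "(\<Sum>i\<in>I. (\<Sum>u\<in>H. ?x u * r u i)\<^sup>2) =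
        (P z + T * (Y z z - 1))\<^sup>2 + (\<Sum>i\<in>I - {z}. (P i + T * (Y z i - delta z i))\<^sup>2)"
      unfolding B using z finI by (subst sum.remove[of I z]) auto
    also have "(\<Sum>i\<in>I - {z}. (P i + T * (Y z i - delta z i))\<^sup>2) =
        (\<Sum>i\<in>I - {z}. (P i)\<^sup>2 + T\<^sup>2 * (Y z i * Y z i))"
    proof (rule sum.cong[OF refl])
      fix i assume "i \<in> I - {z}"
      moreover from this have "P i * Y z i = 0" using P0[of i] Y_support[of z i] by auto
      ultimately show "(P i + T * (Y z i - delta z i))\<^sup>2 = (P i)\<^sup>2 + T\<^sup>2 * (Y z i * Y z i)"
        by (auto simp: power2_eq_square algebra_simps)
    qed
    also have "\<dots> = (\<Sum>i\<in>I - {z}. (P i)\<^sup>2) + T\<^sup>2 * (\<Sum>i\<in>I - {z}. Y z i * Y z i)"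
      by (simp add: sum.distrib sum_distrib_left)
    also have "(\<Sum>i\<in>I - {z}. Y z i * Y z i) = (\<Sum>i\<in>I. Y z i * Y z i) - Y z z * Y z z"
      using z finI by (simp add: sum_diff1)
    also have "(P z + T * (Y z z - 1))\<^sup>2 = (T * Y z z - w z)\<^sup>2"
      unfolding T_def by (simp add: algebra_simps)
    finally show ?thesis by (simp add: power2_eq_square algebra_simps)
  qed
  also have "(\<Sum>u\<in>H. (?x u)\<^sup>2) = (\<Sum>u\<in>H. (x u)\<^sup>2) + T\<^sup>2 * (\<Sum>u\<in>H. X z u * X z u)"
  proof -
    have "(\<Sum>u\<in>H. (?x u)\<^sup>2) = (\<Sum>u\<in>H. (x u)\<^sup>2 + T\<^sup>2 * (X z u * X z u))"
    proof (rule sum.cong[OF refl])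
      fix u assume "u \<in> H"
      then have "x u * X z u = 0" using disj[of u] by auto
      then show "(?x u)\<^sup>2 = (x u)\<^sup>2 + T\<^sup>2 * (X z u * X z u)"
        by (auto simp: power2_eq_square algebra_simps)
    qed
    then show ?thesis by (simp add: sum.distrib sum_distrib_left)
  qed
  finally show ?thesis unfolding M_def \<epsilon>_def by (simp add: algebra_simps)
qed

lemma sum_bilinear:
  fixes F :: "'a \<Rightarrow> 'b \<Rightarrow> real"
  shows "(\<Sum>u\<in>A. (\<Sum>i\<in>S. c i * F i u) * (\<Sum>j\<in>S. c j * F j u)) =
    (\<Sum>i\<in>S. \<Sum>j\<in>S. c i * c j * (\<Sum>u\<in>A. F i u * F j u))"
proof -
  have "(\<Sum>u\<in>A. (\<Sum>i\<in>S. c i * F i u) * (\<Sum>j\<in>S. c j * F j u)) =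
      (\<Sum>u\<in>A. \<Sum>i\<in>S. \<Sum>j\<in>S. c i * c j * (F i u * F j u))"
    unfolding sum_product by (simp add: mult_ac)
  also have "\<dots> = (\<Sum>i\<in>S. \<Sum>u\<in>A. \<Sum>j\<in>S. c i * c j * (F i u * F j u))" by (rule sum.swap)
  also have "\<dots> = (\<Sum>i\<in>S. \<Sum>j\<in>S. \<Sum>u\<in>A. c i * c j * (F i u * F j u))"
    by (rule sum.cong[OF refl], rule sum.swap)
  finally show ?thesis by (simp add: sum_distrib_left)
qed

text \<open>Completing the square. Every \<open>i\<close> in \<open>S\<close> sends off the charge
  \<open>\<kappa> i\<close> that the potential and \<open>y\<close> copies of \<open>e\<close>
  create there, so the marks in \<open>S\<close> contribute minus their squares and the routing
  cost. \<open>closed\<close> keeps the routes away from marks outside \<open>S\<close>. The last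
  term is the gain available if \<open>f e\<close> disagrees with the potential.\<close>

lemma charge_energy:
  assumes S: "finite S" "S \<subseteq> I" and deep: "0 < dep j0"
    and e: "e \<in> H" "y \<noteq> 0 \<Longrightarrow> (\<forall>j. 0 < dep j \<longrightarrow> e \<noteq> pe j) \<and> (\<forall>i\<in>I. r e i \<noteq> 0 \<longrightarrow> i \<in> S)"
    and \<kappa>: "\<And>i. i \<in> S \<Longrightarrow> \<kappa> i = w i + y * r e i"
    and closed: "\<And>i m. i \<in> S \<Longrightarrow> m \<notin> S \<Longrightarrow> w m \<noteq> 0 \<Longrightarrow> dep i \<le> dep m"
  shows "0 \<le> l - (\<Sum>i\<in>S. (w i)\<^sup>2) + (\<Sum>i\<in>S. \<Sum>j\<in>S. \<kappa> i * \<kappa> j * M i j) + \<epsilon> * y\<^sup>2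
    + 2 * y * (f e - (\<Sum>i\<in>I. w i * r e i))"
proof -
  let ?x = "\<lambda>u. (\<Sum>i\<in>S. \<kappa> i * X i u) + y * delta e u"
  define Z where "Z = (\<lambda>m. \<Sum>i\<in>S. \<kappa> i * Y i m)"
  define W where "W = (\<lambda>m. if m \<in> S then w m else 0)"
  obtain j where j: "dep j = 1" using exists_depth_one[OF deep] by blast
  have "y = 0 \<or> e \<noteq> pe j"
  proof (cases "y = 0")
    case False
    have "0 < dep j" using j by simp
    then show ?thesis using e(2)[OF False] by blast
  qed simp
  then have "?x (pe j) = 0" "pe j \<in> H"
    using X_depth_one[OF j] tree[of j] j by (auto simp: delta_def)
  then have "0 \<le> l + 2 * (\<Sum>u\<in>H. ?x u * f u) + (\<Sum>i\<in>I. (\<Sum>u\<in>H. ?x u * r u i)\<^sup>2)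
      + (l - 2) * (\<Sum>u\<in>H. (?x u)\<^sup>2)" by (intro energy) blast
  also have "(\<Sum>u\<in>H. ?x u * f u) = (\<Sum>m\<in>I. W m * Z m) - (\<Sum>i\<in>S. (w i)\<^sup>2) + y * (f e - (\<Sum>i\<in>I. w i * r e i))"
  proof -
    have "(\<Sum>u\<in>H. ?x u * f u) = (\<Sum>u\<in>H. (\<Sum>i\<in>S. \<kappa> i * (X i u * f u)) + y * (delta e u * f u))"
      by (intro sum.cong) (simp_all add: distrib_right sum_distrib_right mult.assoc)
    also have "\<dots> = (\<Sum>u\<in>H. \<Sum>i\<in>S. \<kappa> i * (X i u * f u)) + y * (\<Sum>u\<in>H. delta e u * f u)"
      by (simp only: sum.distrib sum_distrib_left)
    also have "(\<Sum>u\<in>H. delta e u * f u) = f e" using e(1) finH by (simp add: sum_delta)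
    also have "(\<Sum>u\<in>H. \<Sum>i\<in>S. \<kappa> i * (X i u * f u)) = (\<Sum>i\<in>S. \<kappa> i * (\<Sum>u\<in>H. X i u * f u))"
      by (subst sum.swap) (simp add: sum_distrib_left)
    also have "\<dots> = (\<Sum>i\<in>S. \<kappa> i * ((\<Sum>m\<in>I. w m * Y i m) - w i))"
      using S(2) sum_X_f by (intro sum.cong) auto
    also have "\<dots> = (\<Sum>i\<in>S. \<kappa> i * (\<Sum>m\<in>I. w m * Y i m)) - (\<Sum>i\<in>S. \<kappa> i * w i)"
      by (simp add: right_diff_distrib sum_subtractf)
    also have "(\<Sum>i\<in>S. \<kappa> i * (\<Sum>m\<in>I. w m * Y i m)) = (\<Sum>m\<in>I. w m * Z m)"
      unfolding Z_def sum_distrib_left by (subst sum.swap) (simp add: mult_ac)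
    also have "\<dots> = (\<Sum>m\<in>I. W m * Z m)"
    proof (rule sum.cong[OF refl])
      fix m assume "m \<in> I"
      have "Z m = 0" if "m \<notin> S" "w m \<noteq> 0"
        unfolding Z_def
      proof (intro sum.neutral ballI)
        fix i assume "i \<in> S"
        then have "dep i \<le> dep m" "m \<noteq> i" using closed[of i m] that by auto
        then show "\<kappa> i * Y i m = 0" using Y_support[of i m] by auto
      qed
      then show "w m * Z m = W m * Z m" by (auto simp: W_def)
    qed
    also have "(\<Sum>i\<in>S. \<kappa> i * w i) = (\<Sum>i\<in>S. (w i)\<^sup>2) + y * (\<Sum>i\<in>S. w i * r e i)"
    proof -
      have "(\<Sum>i\<in>S. \<kappa> i * w i) = (\<Sum>i\<in>S. (w i)\<^sup>2 + y * (w i * r e i))"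
        using \<kappa> by (intro sum.cong) (simp_all add: power2_eq_square algebra_simps)
      then show ?thesis by (simp add: sum.distrib sum_distrib_left)
    qed
    also have "y * (\<Sum>i\<in>S. w i * r e i) = y * (\<Sum>i\<in>I. w i * r e i)"
    proof (cases "y = 0")
      case False
      have "(\<Sum>i\<in>S. w i * r e i) = (\<Sum>i\<in>I. w i * r e i)"
        using e(2)[OF False] S finI by (intro sum.mono_neutral_left) auto
      then show ?thesis by simp
    qed simp
    finally show ?thesis by (simp add: algebra_simps)
  qed
  also have "(\<Sum>m\<in>I. (\<Sum>u\<in>H. ?x u * r u m)\<^sup>2) =
      (\<Sum>m\<in>I. Z m * Z m) - 2 * (\<Sum>m\<in>I. W m * Z m) + (\<Sum>i\<in>S. (w i)\<^sup>2)"
  proof -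
    have B: "(\<Sum>u\<in>H. ?x u * r u m) = Z m - W m" if "m \<in> I" for m
    proof -
      have "(\<Sum>u\<in>H. ?x u * r u m) = (\<Sum>u\<in>H. (\<Sum>i\<in>S. \<kappa> i * (X i u * r u m)) + y * (delta e u * r u m))"
      by (intro sum.cong) (simp_all add: distrib_right sum_distrib_right mult.assoc)
    also have "\<dots> = (\<Sum>u\<in>H. \<Sum>i\<in>S. \<kappa> i * (X i u * r u m)) + y * (\<Sum>u\<in>H. delta e u * r u m)"
      by (simp only: sum.distrib sum_distrib_left)
      also have "(\<Sum>u\<in>H. delta e u * r u m) = r e m" using e(1) finH by (simp add: sum_delta)
      also have "(\<Sum>u\<in>H. \<Sum>i\<in>S. \<kappa> i * (X i u * r u m)) = (\<Sum>i\<in>S. \<kappa> i * (\<Sum>u\<in>H. X i u * r u m))"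
        by (subst sum.swap) (simp add: sum_distrib_left)
      also have "\<dots> = (\<Sum>i\<in>S. \<kappa> i * Y i m - \<kappa> i * delta i m)"
        using S(2) boundary_X by (intro sum.cong) (auto simp: right_diff_distrib)
      also have "\<dots> = Z m - (\<Sum>i\<in>S. \<kappa> i * delta i m)" by (simp add: sum_subtractf Z_def)
      also have "(\<Sum>i\<in>S. \<kappa> i * delta i m) = (if m \<in> S then \<kappa> m else 0)"
      proof -
        have "(\<Sum>i\<in>S. \<kappa> i * delta i m) = (\<Sum>i\<in>S. if i = m then \<kappa> i else 0)"
          by (intro sum.cong) (auto simp: delta_def)
        then show ?thesis using S(1) by simp
      qed
      also have "Z m - (if m \<in> S then \<kappa> m else 0) + y * r e m = Z m - W m"
        using \<kappa>[of m] e(2) that by (auto simp: W_def)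
      finally show ?thesis .
    qed
    have "(\<Sum>m\<in>I. (\<Sum>u\<in>H. ?x u * r u m)\<^sup>2) = (\<Sum>m\<in>I. (Z m - W m)\<^sup>2)"
      by (rule sum.cong[OF refl]) (simp only: B)
    also have "\<dots> = (\<Sum>m\<in>I. Z m * Z m - 2 * (W m * Z m) + (W m)\<^sup>2)"
      by (intro sum.cong) (simp_all add: power2_eq_square algebra_simps)
    also have "\<dots> = (\<Sum>m\<in>I. Z m * Z m) - 2 * (\<Sum>m\<in>I. W m * Z m) + (\<Sum>m\<in>I. (W m)\<^sup>2)"
      by (simp add: sum.distrib sum_subtractf sum_distrib_left)
    also have "(\<Sum>m\<in>I. (W m)\<^sup>2) = (\<Sum>i\<in>S. (w i)\<^sup>2)"
      using S finI unfolding W_def by (intro sum.mono_neutral_cong_right) auto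
    finally show ?thesis .
  qed
  also have "(\<Sum>u\<in>H. (?x u)\<^sup>2) = (\<Sum>u\<in>H. (\<Sum>i\<in>S. \<kappa> i * X i u) * (\<Sum>j\<in>S. \<kappa> j * X j u)) + y\<^sup>2"
  proof -
    have X0: "y * (\<Sum>i\<in>S. \<kappa> i * X i e) = 0"
    proof (cases "y = 0")
      case False
      have "X i e = 0" for i
      proof (rule ccontr)
        assume "X i e \<noteq> 0"
        then obtain m where "e = pe m" "2 \<le> dep m" using X_support by blast
        moreover from this have "0 < dep m" by simp
        ultimately show False using e(2)[OF False] by blast
      qed
      then show ?thesis by simp
    qed simp
    have "(\<Sum>u\<in>H. (?x u)\<^sup>2) = (\<Sum>u\<in>H. (\<Sum>i\<in>S. \<kappa> i * X i u) * (\<Sum>j\<in>S. \<kappa> j * X j u)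
        + delta e u * (2 * (y * (\<Sum>i\<in>S. \<kappa> i * X i u)) + y\<^sup>2))"
      by (intro sum.cong) (auto simp: delta_def power2_eq_square algebra_simps)
    also have "\<dots> = (\<Sum>u\<in>H. (\<Sum>i\<in>S. \<kappa> i * X i u) * (\<Sum>j\<in>S. \<kappa> j * X j u))
        + (2 * (y * (\<Sum>i\<in>S. \<kappa> i * X i e)) + y\<^sup>2)"
      using e(1) finH by (simp only: sum.distrib sum_delta)
    finally show ?thesis unfolding X0 by simp
  qed
  also have "(\<Sum>u\<in>H. (\<Sum>i\<in>S. \<kappa> i * X i u) * (\<Sum>j\<in>S. \<kappa> j * X j u)) =
      (\<Sum>i\<in>S. \<Sum>j\<in>S. \<kappa> i * \<kappa> j * (\<Sum>u\<in>H. X i u * X j u))"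
    by (rule sum_bilinear)
  also have "(\<Sum>m\<in>I. Z m * Z m) = (\<Sum>i\<in>S. \<Sum>j\<in>S. \<kappa> i * \<kappa> j * (\<Sum>m\<in>I. Y i m * Y j m))"
    unfolding Z_def by (rule sum_bilinear)
  finally have "0 \<le> l + 2 * ((\<Sum>m\<in>I. W m * Z m) - (\<Sum>i\<in>S. (w i)\<^sup>2) + y * (f e - (\<Sum>i\<in>I. w i * r e i)))
    + ((\<Sum>i\<in>S. \<Sum>j\<in>S. \<kappa> i * \<kappa> j * (\<Sum>m\<in>I. Y i m * Y j m)) - 2 * (\<Sum>m\<in>I. W m * Z m) + (\<Sum>i\<in>S. (w i)\<^sup>2))
    + (l - 2) * ((\<Sum>i\<in>S. \<Sum>j\<in>S. \<kappa> i * \<kappa> j * (\<Sum>u\<in>H. X i u * X j u)) + y\<^sup>2)" .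
  moreover have "(\<Sum>i\<in>S. \<Sum>j\<in>S. \<kappa> i * \<kappa> j * M i j) =
     (\<Sum>i\<in>S. \<Sum>j\<in>S. \<kappa> i * \<kappa> j * (\<Sum>m\<in>I. Y i m * Y j m))
     + \<epsilon> * (\<Sum>i\<in>S. \<Sum>j\<in>S. \<kappa> i * \<kappa> j * (\<Sum>u\<in>H. X i u * X j u))"
    unfolding M_def by (simp add: algebra_simps sum.distrib sum_distrib_left)
  ultimately show ?thesis unfolding \<epsilon>_def by (simp add: algebra_simps)
qed

lemma M_diag_bound: "N \<le> dep z \<Longrightarrow> M z z \<le> k + \<eta>"
  using M_bound_deep[of z z] by (simp add: td.simps[of z z])

lemma k_bounds: "0 < k" "k < 0.1312"
  using q_bounds by (simp_all add: k_def)

lemma q_relations: "\<epsilon> * q = (1 - q)\<^sup>2" "l * q = q\<^sup>2 + 1" "k = 1 - q"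
proof -
  show "\<epsilon> * q = (1 - q)\<^sup>2" using q_pos by (simp add: eps)
  show "l * q = q\<^sup>2 + 1" using q_pos by (simp add: l_def field_simps power2_eq_square)
  show "k = 1 - q" by (rule k_def)
qed

lemma eps_bound: "\<epsilon> < 0.01982"
proof -
  have "(1 - q)\<^sup>2 \<le> 0.1312\<^sup>2" using q_bounds by (intro power_mono) auto
  then have "(1 - q)\<^sup>2 < 0.01982 * q" using q_bounds by (simp add: power2_eq_square)
  then show ?thesis unfolding eps using q_pos by (simp add: divide_less_eq)
qed

lemma l_eps: "l = 2 + \<epsilon>" by (simp add: \<epsilon>_def)

lemma eta_bounds: "0 \<le> \<eta>" "\<eta> < 0.0001" "100 * \<eta> < q ^ 4 + q ^ 6 - 1"
  using N_large q_pos by (simp_all add: \<eta>_def)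

text \<open>Near the marks the flow \<open>g\<close> from each \<open>j\<close> in \<open>L\<close>
  to its parent can be chosen freely, and only the total charge at the lowest coordinate
  \<open>z\<close> follows the standard route. The borderline configurations need this joint
  optimization, since routing every mark separately is too expensive.\<close>

lemma flow_energy:
  assumes L: "finite L" "z \<notin> L" and z: "N \<le> dep z"
    and L_dep: "\<And>j. j \<in> L \<Longrightarrow> dep z \<le> dep j \<and> 2 \<le> dep j \<and> par j \<in> insert z L"
    and w0: "\<And>i. dep i < dep z \<Longrightarrow> w i = 0"
    and P_def: "P = (\<lambda>i. \<Sum>j\<in>L. \<sigma> j * g j * delta (par j) i - g j * delta j i)"
    and T_def: "T = P z + w z"
  shows "0 \<le> l - 2 * (\<Sum>j\<in>L. g j * (w j - \<sigma> j * w (par j))) + (w z)\<^sup>2 - 2 * T * w z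
    + (\<Sum>i\<in>L. (P i)\<^sup>2) + T\<^sup>2 * (k + \<eta>) + \<epsilon> * (\<Sum>j\<in>L. (g j)\<^sup>2)"
proof -
  define x where "x = (\<lambda>u. \<Sum>j\<in>L. - s j * g j * delta (pe j) u)"
  have zI: "z \<in> I" "0 < dep z" using z N_pos tree[of z] by auto
  have pos: "0 < dep j" if "j \<in> L" for j using L_dep[OF that] by simp
  have sumx: "(\<Sum>u\<in>H. x u * h u) = (\<Sum>j\<in>L. - s j * g j * h (pe j))" for h
  proof -
    have "(\<Sum>u\<in>H. x u * h u) = (\<Sum>j\<in>L. \<Sum>u\<in>H. - s j * g j * (delta (pe j) u * h u))"
      unfolding x_def sum_distrib_right by (subst sum.swap) (simp add: mult_ac)
    also have "\<dots> = (\<Sum>j\<in>L. - s j * g j * h (pe j))"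
    proof (rule sum.cong[OF refl])
      fix j assume "j \<in> L"
      have "(\<Sum>u\<in>H. delta (pe j) u * h u) = h (pe j)"
        using tree[OF pos[OF \<open>j \<in> L\<close>]] finH by (intro sum_delta) auto
      then show "(\<Sum>u\<in>H. - s j * g j * (delta (pe j) u * h u)) = - s j * g j * h (pe j)"
        by (simp only: sum_distrib_left[symmetric])
    qed
    finally show ?thesis .
  qed
  have P: "(\<Sum>u\<in>H. x u * r u i) = P i" for i
    unfolding sumx P_def
  proof (rule sum.cong[OF refl])
    fix j assume "j \<in> L"
    have "- s j * g j * r (pe j) i = \<sigma> j * g j * delta (par j) i - (s j * s j) * g j * delta j i"
      unfolding tree_edge[OF pos[OF \<open>j \<in> L\<close>]] \<sigma>_def by (simp add: algebra_simps)
    then show "- s j * g j * r (pe j) i = \<sigma> j * g j * delta (par j) i - g j * delta j i"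
      using s_sq[OF pos[OF \<open>j \<in> L\<close>]] by simp
  qed
  have P_zero: "P i = 0" if "i \<notin> insert z L" for i
    unfolding P_def
  proof (intro sum.neutral ballI)
    fix j assume "j \<in> L"
    then have "par j \<noteq> i" "j \<noteq> i" using L_dep[OF \<open>j \<in> L\<close>] that by auto
    then show "\<sigma> j * g j * delta (par j) i - g j * delta j i = 0" by simp
  qed
  have xpe: "x (pe j) = - s j * g j" if "j \<in> L" for j
  proof -
    have "delta (pe m) (pe j) = (if m = j then 1 else 0)" if "m \<in> L" for m
      using pe_inj[OF pos[OF that] pos[OF \<open>j \<in> L\<close>]] by (auto simp: delta_def)
    then have "x (pe j) = (\<Sum>m\<in>L. if m = j then - s m * g m else 0)"
      unfolding x_def by (intro sum.cong) auto
    then show ?thesis using L that by simp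
  qed
  have x_support: "\<exists>j\<in>L. u = pe j" if "x u \<noteq> 0" for u
  proof (rule ccontr)
    assume "\<not> ?thesis"
    then have "x u = 0" unfolding x_def by (intro sum.neutral) (auto simp: delta_def)
    with that show False by simp
  qed
  have "0 \<le> l + 2 * (\<Sum>u\<in>H. x u * f u) + (w z)\<^sup>2 - 2 * T * w z + (\<Sum>i\<in>I - {z}. (P i)\<^sup>2)
    + T\<^sup>2 * M z z + \<epsilon> * (\<Sum>u\<in>H. (x u)\<^sup>2)"
  proof (rule local_energy[OF zI])
    fix u assume "u \<in> H" "x u \<noteq> 0"
    then obtain j where j: "j \<in> L" "u = pe j" using x_support by blast
    then have "j \<noteq> z" using L(2) by blast
    then show "X z u = 0" using X_pe_zero[OF pos[OF j(1)], of z] L_dep[OF j(1)] j(2) by simp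
  next
    fix j assume "dep j = 1"
    show "x (pe j) = 0"
    proof (rule ccontr)
      assume "x (pe j) \<noteq> 0"
      then obtain m where m: "m \<in> L" "pe j = pe m" using x_support by blast
      then have "j = m" using pe_inj[of j m] \<open>dep j = 1\<close> pos[OF m(1)] by simp
      then show False using L_dep[OF m(1)] \<open>dep j = 1\<close> by simp
    qed
  next
    show "P = (\<lambda>i. \<Sum>u\<in>H. x u * r u i)" using P by auto
  next
    fix i assume "dep i < dep z"
    then have "i \<notin> insert z L" using L_dep by fastforce
    then show "P i = 0" by (rule P_zero)
  qed (use w0 T_def in auto)
  also have "(\<Sum>u\<in>H. x u * f u) = - (\<Sum>j\<in>L. g j * (w j - \<sigma> j * w (par j)))"
    unfolding sumx using w_step[OF pos] by (simp add: mult_ac flip: sum_negf)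
  also have "(\<Sum>i\<in>I - {z}. (P i)\<^sup>2) = (\<Sum>i\<in>L. (P i)\<^sup>2)"
    using P_zero finI L(2) tree[OF pos] by (intro sum.mono_neutral_right) auto
  also have "(\<Sum>u\<in>H. (x u)\<^sup>2) = (\<Sum>j\<in>L. (g j)\<^sup>2)"
  proof -
    have "(\<Sum>u\<in>H. (x u)\<^sup>2) = (\<Sum>j\<in>L. - s j * g j * x (pe j))"
      unfolding power2_eq_square by (rule sumx)
    also have "\<dots> = (\<Sum>j\<in>L. (g j)\<^sup>2)"
    proof (rule sum.cong[OF refl])
      fix j assume "j \<in> L"
      have "- s j * g j * (- s j * g j) = (s j * s j) * (g j)\<^sup>2" by (simp add: power2_eq_square)
      then show "- s j * g j * x (pe j) = (g j)\<^sup>2"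
        using xpe[OF \<open>j \<in> L\<close>] s_sq[OF pos[OF \<open>j \<in> L\<close>]] by simp
    qed
    finally show ?thesis .
  qed
  also have "T\<^sup>2 * M z z \<le> T\<^sup>2 * (k + \<eta>)"
    using M_diag_bound[OF z] by (intro mult_left_mono) auto
  finally show ?thesis by simp
qed

text \<open>For two signs the integer \<open>w i - \<sigma> i * w (par i)\<close> is even, and
  \<open>w_adjacent\<close> bounds it by 1 in absolute value, so it is 0.\<close>

lemma sign_transport:
  assumes "0 < dep i" "w i \<in> {-1, 1}" "w (par i) \<in> {-1, 1}"
  shows "\<sigma> i * w (par i) = w i" "\<sigma> i * w i = w (par i)"
proof -
  have "\<sigma> i \<in> {-1, 1}" using signs[OF assms(1)] by (auto simp: \<sigma>_def)
  then show "\<sigma> i * w (par i) = w i" "\<sigma> i * w i = w (par i)"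
    using assms(2,3) w_adjacent[OF assms(1)] by auto
qed

section \<open>Excluded configurations of three marks\<close>

lemma square_le_2_1: "\<bar>T\<bar> \<le> 2.1 \<Longrightarrow> T\<^sup>2 * (k + \<eta>) \<le> 0.5791"
proof -
  assume "\<bar>T\<bar> \<le> 2.1"
  then have "T\<^sup>2 \<le> 2.1\<^sup>2" by (metis abs_le_square_iff abs_numeral abs_of_nonneg abs_ge_zero order_trans power2_abs power_mono)
  then have "T\<^sup>2 * (k + \<eta>) \<le> 2.1\<^sup>2 * 0.1313"
    using k_bounds eta_bounds by (intro mult_mono) auto
  then show ?thesis by (simp add: power2_eq_square)
qed

lemma sign_sq: "x \<in> {-1, 1::real} \<Longrightarrow> x\<^sup>2 = 1" by auto

lemma shift_sq: "x \<in> {-1, 1::real} \<Longrightarrow> (a * x + x)\<^sup>2 = (1 + a)\<^sup>2"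
  by (auto simp: power2_eq_square algebra_simps)

text \<open>The borderline case: with the optimal flow the energy times \<open>q\<close> is
  \<open>1 - q ^ 4 - q ^ 6\<close> plus a small multiple of \<open>\<eta>\<close>, which is negative
  by the choice of \<open>q\<close> and \<open>N\<close>.\<close>

lemma no_chain:
  assumes d: "N \<le> dep z" "dep b = Suc (dep z)" "dep c = Suc (dep b)" "par b = z" "par c = b"
    and w: "w z \<in> {-1, 1}" "w b \<in> {-1, 1}" "w c \<in> {-1, 1}"
    and w0: "\<And>i. dep i < dep z \<Longrightarrow> w i = 0"
  shows False
proof -
  have ne: "b \<noteq> z" "c \<noteq> z" "c \<noteq> b" "z \<noteq> b" "z \<noteq> c" "b \<noteq> c" using d(2,3) by auto
  have b: "\<sigma> b * w z = w b" "\<sigma> b * w b = w z" using sign_transport[of b] d(2) w unfolding d(4) by simp_all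
  have b': "\<sigma> b * (y * w b) = y * w z" for y unfolding b(2)[symmetric] by simp
  have c: "\<sigma> c * w b = w c" "\<sigma> c * w c = w b" using sign_transport[of c] d(3) w unfolding d(5) by simp_all
  have c': "\<sigma> c * (y * w c) = y * w b" for y unfolding c(2)[symmetric] by simp
  \<comment> \<open>The exact minimizer up to \<open>\<eta>\<close>. If the flows from
    \<open>c\<close> and \<open>b\<close> are \<alpha> and \<beta>, stationarity reads \<beta> = l
    \<alpha> and \<beta> = q^2 + q \<alpha>, hence \<alpha> = q^3.\<close>
  define g where "g = (\<lambda>j. if j = c then q ^ 3 * w c else (q\<^sup>2 + q ^ 4) * w b)"
  define P where "P = (\<lambda>i. \<Sum>j\<in>{b, c}. \<sigma> j * g j * delta (par j) i - g j * delta j i)"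
  have T: "P z = (q\<^sup>2 + q ^ 4) * w z" "P b = (q ^ 3 - q\<^sup>2 - q ^ 4) * w b" "P c = - (q ^ 3) * w c"
    unfolding P_def using ne by (simp_all add: g_def d(4,5) b' c' mult.assoc algebra_simps)
  have "0 \<le> l - 2 * (\<Sum>j\<in>{b, c}. g j * (w j - \<sigma> j * w (par j))) + (w z)\<^sup>2 - 2 * (P z + w z) * w z
    + (\<Sum>i\<in>{b, c}. (P i)\<^sup>2) + (P z + w z)\<^sup>2 * (k + \<eta>) + \<epsilon> * (\<Sum>j\<in>{b, c}. (g j)\<^sup>2)"
  proof (rule flow_energy[OF _ _ d(1) _ w0 P_def refl])
    fix j assume "j \<in> {b, c}"
    then show "dep z \<le> dep j \<and> 2 \<le> dep j \<and> par j \<in> insert z {b, c}"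
      using d N_pos by (elim insertE) simp_all
  qed (use ne in auto)
  also have "(\<Sum>j\<in>{b, c}. g j * (w j - \<sigma> j * w (par j))) = 0" using ne b c by (simp add: d(4,5))
  also have "(\<Sum>i\<in>{b, c}. (P i)\<^sup>2) = (q ^ 3 - q\<^sup>2 - q ^ 4)\<^sup>2 + q ^ 6"
    using ne T sign_sq[OF w(2)] sign_sq[OF w(3)] by (simp add: power_mult_distrib flip: power_mult)
  also have "(\<Sum>j\<in>{b, c}. (g j)\<^sup>2) = (q\<^sup>2 + q ^ 4)\<^sup>2 + q ^ 6"
    using ne sign_sq[OF w(2)] sign_sq[OF w(3)] by (simp add: g_def power_mult_distrib flip: power_mult)
  also have "(P z + w z)\<^sup>2 = (1 + q\<^sup>2 + q ^ 4)\<^sup>2"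
    unfolding T shift_sq[OF w(1)] by (simp add: add.assoc)
  also have "2 * (P z + w z) * w z = 2 * (1 + q\<^sup>2 + q ^ 4)"
    using sign_sq[OF w(1)] unfolding T by (simp add: algebra_simps power2_eq_square)
  finally have E: "0 \<le> l + 1 - 2 * (1 + q\<^sup>2 + q ^ 4) + (q ^ 3 - q\<^sup>2 - q ^ 4)\<^sup>2 + q ^ 6
      + (1 + q\<^sup>2 + q ^ 4)\<^sup>2 * (k + \<eta>) + \<epsilon> * ((q\<^sup>2 + q ^ 4)\<^sup>2 + q ^ 6)"
    using sign_sq[OF w(1)] by simp
  have "q * (l + 1 - 2 * (1 + q\<^sup>2 + q ^ 4) + (q ^ 3 - q\<^sup>2 - q ^ 4)\<^sup>2 + q ^ 6
      + (1 + q\<^sup>2 + q ^ 4)\<^sup>2 * (k + \<eta>) + \<epsilon> * ((q\<^sup>2 + q ^ 4)\<^sup>2 + q ^ 6)) =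
      l * q + q * (1 - 2 * (1 + q\<^sup>2 + q ^ 4) + (q ^ 3 - q\<^sup>2 - q ^ 4)\<^sup>2 + q ^ 6
      + (1 + q\<^sup>2 + q ^ 4)\<^sup>2 * k) + (\<epsilon> * q) * ((q\<^sup>2 + q ^ 4)\<^sup>2 + q ^ 6)
      + q * (1 + q\<^sup>2 + q ^ 4)\<^sup>2 * \<eta>" by (simp add: algebra_simps)
  also have "\<dots> = 1 - q ^ 4 - q ^ 6 + q * (1 + q\<^sup>2 + q ^ 4)\<^sup>2 * \<eta>"
    unfolding q_relations by (simp add: algebra_simps eval_nat_numeral)
  finally have "q * (l + 1 - 2 * (1 + q\<^sup>2 + q ^ 4) + (q ^ 3 - q\<^sup>2 - q ^ 4)\<^sup>2 + q ^ 6
      + (1 + q\<^sup>2 + q ^ 4)\<^sup>2 * (k + \<eta>) + \<epsilon> * ((q\<^sup>2 + q ^ 4)\<^sup>2 + q ^ 6)) =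
      1 - q ^ 4 - q ^ 6 + q * (1 + q\<^sup>2 + q ^ 4)\<^sup>2 * \<eta>" .
  moreover have "q * (1 + q\<^sup>2 + q ^ 4)\<^sup>2 * \<eta> \<le> 9 * \<eta>"
  proof (rule mult_right_mono)
    have "q\<^sup>2 \<le> 1" "q ^ 4 \<le> 1" using q_pos by (simp_all add: power_le_one)
    then have "(1 + q\<^sup>2 + q ^ 4)\<^sup>2 \<le> 3\<^sup>2" using q_pos by (intro power_mono) auto
    then have "q * (1 + q\<^sup>2 + q ^ 4)\<^sup>2 \<le> 1 * 3\<^sup>2" using q_pos by (intro mult_mono) auto
    then show "q * (1 + q\<^sup>2 + q ^ 4)\<^sup>2 \<le> 9" by simp
  qed (rule eta_bounds)
  ultimately show False
    using mult_nonneg_nonneg[OF less_imp_le[OF q_pos(1)] E] eta_bounds by linarith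
qed

text \<open>A second borderline case, again governed by \<open>1 - q ^ 4 - q ^ 6\<close>. The mark
  \<open>c\<close> is separated from the adjacent marks by the unmarked \<open>v\<close>, and its
  charge is only shared with \<open>v\<close>.\<close>

lemma no_edge_and_mark:
  assumes d: "N \<le> dep z" "dep b = Suc (dep z)" "par b = z" "dep c = Suc (dep v)" "par c = v"
      "0 < dep v" "par v \<in> {z, b}" "v \<noteq> b" "c \<noteq> b"
    and w: "w z \<in> {-1, 1}" "w b \<in> {-1, 1}" "w c \<in> {-1, 1}" "w v = 0"
    and w0: "\<And>i. dep i < dep z \<Longrightarrow> w i = 0"
  shows False
proof -
  have dv: "dep z < dep v" using tree[OF d(6)] d(2,7) by auto
  have ne: "b \<noteq> z" "c \<noteq> z" "v \<noteq> z" "c \<noteq> v" "v \<noteq> b" "c \<noteq> b"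
    "z \<noteq> b" "z \<noteq> c" "z \<noteq> v" "v \<noteq> c" "b \<noteq> v" "b \<noteq> c" using d(2,4,8,9) dv by auto
  have b: "\<sigma> b * w z = w b" "\<sigma> b * w b = w z"
    using sign_transport[of b] d(2) w unfolding d(3) by simp_all
  have b': "\<sigma> b * (y * w b) = y * w z" for y unfolding b(2)[symmetric] by simp
  have lp: "l > 0" using l_eps eps_nonneg by simp
  \<comment> \<open>A flow y from \<open>c\<close> to \<open>v\<close> alone contributes - 2 y + l
    y^2, least at y = 1 / l; the flow from \<open>b\<close> is stationary at
    \<open>q\<^sup>2\<close>.\<close>
  define g where "g = (\<lambda>j. if j = c then w c / l else if j = b then q\<^sup>2 * w b else 0)"
  define P where "P = (\<lambda>i. \<Sum>j\<in>{b, c, v}. \<sigma> j * g j * delta (par j) i - g j * delta j i)"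
  have P: "P z = q\<^sup>2 * w z" "P b = - (q\<^sup>2) * w b" "P c = - w c / l" "P v = \<sigma> c * w c / l"
    unfolding P_def using ne by (simp_all add: g_def d(3,5) b')
  have "0 \<le> l - 2 * (\<Sum>j\<in>{b, c, v}. g j * (w j - \<sigma> j * w (par j))) + (w z)\<^sup>2 - 2 * (P z + w z) * w z
    + (\<Sum>i\<in>{b, c, v}. (P i)\<^sup>2) + (P z + w z)\<^sup>2 * (k + \<eta>) + \<epsilon> * (\<Sum>j\<in>{b, c, v}. (g j)\<^sup>2)"
  proof (rule flow_energy[OF _ _ d(1) _ w0 P_def refl])
    fix j assume "j \<in> {b, c, v}"
    then show "dep z \<le> dep j \<and> 2 \<le> dep j \<and> par j \<in> insert z {b, c, v}"
      using d dv N_pos by (elim insertE) auto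
  qed (use ne in auto)
  also have "(\<Sum>j\<in>{b, c, v}. g j * (w j - \<sigma> j * w (par j))) = 1 / l"
    using ne b w(4) sign_sq[OF w(3)] by (simp add: d(3,5) g_def power2_eq_square)
  also have "(\<Sum>i\<in>{b, c, v}. (P i)\<^sup>2) = q ^ 4 + 2 / l\<^sup>2"
    using ne P sign_sq[OF w(2)] sign_sq[OF w(3)] sigma_sq[of c] d(4)
    by (simp add: power_mult_distrib power_divide flip: power_mult)
  also have "(\<Sum>j\<in>{b, c, v}. (g j)\<^sup>2) = q ^ 4 + 1 / l\<^sup>2"
    using ne sign_sq[OF w(2)] sign_sq[OF w(3)]
    by (simp add: g_def power_mult_distrib power_divide flip: power_mult)
  also have "(P z + w z)\<^sup>2 = (1 + q\<^sup>2)\<^sup>2"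
    unfolding P shift_sq[OF w(1)] by (rule refl)
  also have "2 * (P z + w z) * w z = 2 * (1 + q\<^sup>2)"
    using sign_sq[OF w(1)] unfolding P by (simp add: algebra_simps power2_eq_square)
  finally have E: "0 \<le> l - 2 * (1 / l) + 1 - 2 * (1 + q\<^sup>2) + (q ^ 4 + 2 / l\<^sup>2)
      + (1 + q\<^sup>2)\<^sup>2 * (k + \<eta>) + \<epsilon> * (q ^ 4 + 1 / l\<^sup>2)"
    using sign_sq[OF w(1)] by simp
  define m where "m = 1 / l"
  have eq: "\<epsilon> * q = (1 - q)\<^sup>2" "l * q = q\<^sup>2 + 1" "k = 1 - q" "m * (q\<^sup>2 + 1) = q" "l * m = 1" "l = 2 + \<epsilon>"
  proof -
    show "\<epsilon> * q = (1 - q)\<^sup>2" "l * q = q\<^sup>2 + 1" "k = 1 - q" by (rule q_relations)+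
    show "l = 2 + \<epsilon>" by (rule l_eps)
    show 1: "l * m = 1" using lp by (simp add: m_def)
    have "m * (q\<^sup>2 + 1) = (l * m) * q" unfolding q_relations(2)[symmetric] by (simp add: mult_ac)
    then show "m * (q\<^sup>2 + 1) = q" unfolding 1 by simp
  qed
  have "0 \<le> l - 2 * m + 1 - 2 * (1 + q\<^sup>2) + (q ^ 4 + 2 * m\<^sup>2)
      + (1 + q\<^sup>2)\<^sup>2 * (k + \<eta>) + \<epsilon> * (q ^ 4 + m\<^sup>2)"
    using E by (simp add: m_def power_divide)
  also have "\<dots> = l - 2 * m + 1 - 2 * (1 + q\<^sup>2) + q ^ 4 + m
      + (1 + q\<^sup>2)\<^sup>2 * (k + \<eta>) + \<epsilon> * q ^ 4"
  proof -
    have "2 * m\<^sup>2 + \<epsilon> * m\<^sup>2 = (2 + \<epsilon>) * m\<^sup>2" by (simp only: distrib_right)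
    also have "\<dots> = m * (l * m)" unfolding eq(6)[symmetric] by (simp add: power2_eq_square)
    finally have "2 * m\<^sup>2 + \<epsilon> * m\<^sup>2 = m * (l * m)" .
    then show ?thesis unfolding eq(5) by (simp add: algebra_simps)
  qed
  finally have E': "0 \<le> l - m + 1 - 2 * (1 + q\<^sup>2) + q ^ 4
      + (1 + q\<^sup>2)\<^sup>2 * (k + \<eta>) + \<epsilon> * q ^ 4" by simp
  have "(q * (1 + q\<^sup>2)) * (l - m + 1 - 2 * (1 + q\<^sup>2) + q ^ 4
      + (1 + q\<^sup>2)\<^sup>2 * (k + \<eta>) + \<epsilon> * q ^ 4) =
      (1 + q\<^sup>2) * (l * q) - q * (m * (q\<^sup>2 + 1)) + (q * (1 + q\<^sup>2)) * (1 - 2 * (1 + q\<^sup>2) + q ^ 4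
      + (1 + q\<^sup>2)\<^sup>2 * k) + (1 + q\<^sup>2) * ((\<epsilon> * q) * q ^ 4) + q * (1 + q\<^sup>2) ^ 3 * \<eta>"
    by (simp add: algebra_simps power2_eq_square power3_eq_cube)
  also have "\<dots> = 1 - q ^ 4 - q ^ 6 + q * (1 + q\<^sup>2) ^ 3 * \<eta>"
    unfolding eq(1-4) by (simp add: algebra_simps eval_nat_numeral)
  finally have "(q * (1 + q\<^sup>2)) * (l - m + 1 - 2 * (1 + q\<^sup>2) + q ^ 4
      + (1 + q\<^sup>2)\<^sup>2 * (k + \<eta>) + \<epsilon> * q ^ 4) = 1 - q ^ 4 - q ^ 6 + q * (1 + q\<^sup>2) ^ 3 * \<eta>" .
  moreover have "q * (1 + q\<^sup>2) ^ 3 * \<eta> \<le> 8 * \<eta>"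
  proof (rule mult_right_mono)
    have "q\<^sup>2 \<le> 1" using q_pos by (simp add: power_le_one)
    then have "(1 + q\<^sup>2) ^ 3 \<le> 2 ^ 3" using q_pos by (intro power_mono) auto
    then have "q * (1 + q\<^sup>2) ^ 3 \<le> 1 * 2 ^ 3" using q_pos by (intro mult_mono) auto
    then show "q * (1 + q\<^sup>2) ^ 3 \<le> 8" by simp
  qed (rule eta_bounds)
  moreover have "0 \<le> q * (1 + q\<^sup>2)" using q_pos by simp
  ultimately show False
    using mult_nonneg_nonneg[OF _ E', of "q * (1 + q\<^sup>2)"] eta_bounds by linarith
qed

lemma l_ub: "l < 201982 / 100000"
  using eps_bound l_eps by simp

lemma numeric_bounds: "k < 1312 / 10000" "\<eta> < 1 / 10000" "\<epsilon> < 1982 / 100000"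
  using k_bounds eta_bounds eps_bound by simp_all

lemma sigma_cases: "0 < dep i \<Longrightarrow> \<sigma> i = 1 \<or> \<sigma> i = -1"
  using signs[of i] by (auto simp: \<sigma>_def)

lemma transport_scaled:
  assumes "0 < dep i" "w i \<in> {-1, 1}" "w (par i) \<in> {-1, 1}"
  shows "\<sigma> i * (y * w i) = y * w (par i)"
  unfolding sign_transport(2)[OF assms, symmetric] by simp

lemma sign_mult: "x \<in> {-1, 1::real} \<Longrightarrow> x * (x * y) = y" "x \<in> {-1, 1::real} \<Longrightarrow> x * x = 1"
  by auto

lemma tail_bound:
  assumes "\<bar>T\<bar> \<le> 21 / 10"
  shows "T\<^sup>2 * (k + \<eta>) \<le> 5791 / 10000"
  using square_le_2_1[of T] assms by simp

text \<open>Away from the borderline rounded flows suffice: the tenths here and in the next four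
  lemmas are close to the stationary values for q about 0.869. The signs with which charges meet at
  \<open>z\<close> are unknown, so only their absolute sum, 21 / 10, is used.\<close>

lemma no_fork_tree:
  assumes d: "N \<le> dep z" "dep b = Suc (dep z)" "par b = z" "dep a = Suc (dep b)" "par a = b"
      "dep c = Suc (dep z)" "par c = z" "b \<noteq> c"
    and w: "w z = 0" "w a \<in> {-1, 1}" "w b \<in> {-1, 1}" "w c \<in> {-1, 1}"
    and w0: "\<And>i. dep i < dep z \<Longrightarrow> w i = 0"
  shows False
proof -
  have ne: "a \<noteq> b" "a \<noteq> c" "b \<noteq> c" "a \<noteq> z" "b \<noteq> z" "c \<noteq> z" "b \<noteq> a" "c \<noteq> a" "c \<noteq> b" "z \<noteq> a" "z \<noteq> b" "z \<noteq> c"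
    using d(2,4,6,8) by auto
  have pos: "0 < dep a" "0 < dep b" "0 < dep c" using d(2,4,6) by auto
  have a: "\<sigma> a * (y * w a) = y * w b" "\<sigma> a * w b = w a" for y
    using transport_scaled[of a y] sign_transport[of a] pos w(2,3) unfolding d(5) by simp_all
  note SQ = sign_sq[OF w(2)] sign_sq[OF w(3)] sign_sq[OF w(4)]
  define g where "g = (\<lambda>j. if j = b then 14 / 10 * w b else 7 / 10 * w j)"
  define P where "P = (\<lambda>i. \<Sum>j\<in>{a, b, c}. \<sigma> j * g j * delta (par j) i - g j * delta j i)"
  have P: "P a = - (7 / 10) * w a" "P b = - (7 / 10) * w b" "P c = - (7 / 10) * w c"
    "P z = \<sigma> b * (14 / 10 * w b) + \<sigma> c * (7 / 10 * w c)"
    unfolding P_def using ne by (simp_all add: g_def d(3,5,7) a)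
  have "0 \<le> l - 2 * (\<Sum>j\<in>{a, b, c}. g j * (w j - \<sigma> j * w (par j))) + (w z)\<^sup>2 - 2 * (P z + w z) * w z
    + (\<Sum>i\<in>{a, b, c}. (P i)\<^sup>2) + (P z + w z)\<^sup>2 * (k + \<eta>) + \<epsilon> * (\<Sum>j\<in>{a, b, c}. (g j)\<^sup>2)"
  proof (rule flow_energy[OF _ _ d(1) _ w0 P_def refl])
    fix j assume "j \<in> {a, b, c}"
    then show "dep z \<le> dep j \<and> 2 \<le> dep j \<and> par j \<in> insert z {a, b, c}"
      using d N_pos by (elim insertE) simp_all
  qed (use ne in auto)
  also have "(\<Sum>j\<in>{a, b, c}. g j * (w j - \<sigma> j * w (par j))) = 21 / 10"
    using ne by (simp add: d(3,5,7) w(1) g_def a sign_mult[OF w(3)] sign_mult[OF w(4)] algebra_simps)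
  also have "(\<Sum>i\<in>{a, b, c}. (P i)\<^sup>2) = 147 / 100"
    using ne SQ by (simp add: P power_mult_distrib power_divide)
  also have "(\<Sum>j\<in>{a, b, c}. (g j)\<^sup>2) = 294 / 100"
    using ne SQ by (simp add: g_def power_mult_distrib power_divide)
  finally have "0 \<le> l - 42 / 10 + 147 / 100 + (P z)\<^sup>2 * (k + \<eta>) + \<epsilon> * (294 / 100)" using w(1) by simp
  moreover have "(P z)\<^sup>2 * (k + \<eta>) \<le> 5791 / 10000"
    by (rule tail_bound) (use w sigma_cases[OF pos(2)] sigma_cases[OF pos(3)] in \<open>auto simp: P\<close>)
  ultimately show False using l_ub eps_bound by simp
qed

lemma no_chain_gap:
  assumes d: "N \<le> dep z" "dep v = Suc (dep z)" "par v = z" "dep b = Suc (dep v)" "par b = v"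
      "dep a = Suc (dep b)" "par a = b"
    and w: "w z \<in> {-1, 1}" "w v = 0" "w b \<in> {-1, 1}" "w a \<in> {-1, 1}"
    and w0: "\<And>i. dep i < dep z \<Longrightarrow> w i = 0"
  shows False
proof -
  have ne: "a \<noteq> b" "a \<noteq> v" "b \<noteq> v" "a \<noteq> z" "b \<noteq> z" "v \<noteq> z" "b \<noteq> a" "v \<noteq> a" "v \<noteq> b" "z \<noteq> a" "z \<noteq> b" "z \<noteq> v"
    using d(2,4,6) by auto
  have pos: "0 < dep a" "0 < dep b" "0 < dep v" using d(2,4,6) by auto
  have a: "\<sigma> a * (y * w a) = y * w b" "\<sigma> a * w b = w a" for y
    using transport_scaled[of a y] sign_transport[of a] pos w(3,4) unfolding d(7) by simp_all
  have vb: "\<sigma> b * w b \<in> {-1, 1}" using sigma_cases[OF pos(2)] w(3) by auto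
  note SQ = sign_sq[OF w(3)] sign_sq[OF w(4)] sign_sq[OF vb, unfolded power_mult_distrib]
  define g where "g = (\<lambda>j. if j = a then 7 / 10 * w a else if j = b then 14 / 10 * w b else 11 / 10 * (\<sigma> b * w b))"
  define P where "P = (\<lambda>i. \<Sum>j\<in>{a, b, v}. \<sigma> j * g j * delta (par j) i - g j * delta j i)"
  have P: "P a = - (7 / 10) * w a" "P b = - (7 / 10) * w b" "P v = 3 / 10 * (\<sigma> b * w b)"
    "P z = 11 / 10 * (\<sigma> v * (\<sigma> b * w b))"
    unfolding P_def using ne by (simp_all add: g_def d(3,5,7) a)
  have "0 \<le> l - 2 * (\<Sum>j\<in>{a, b, v}. g j * (w j - \<sigma> j * w (par j))) + (w z)\<^sup>2 - 2 * (P z + w z) * w z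
    + (\<Sum>i\<in>{a, b, v}. (P i)\<^sup>2) + (P z + w z)\<^sup>2 * (k + \<eta>) + \<epsilon> * (\<Sum>j\<in>{a, b, v}. (g j)\<^sup>2)"
  proof (rule flow_energy[OF _ _ d(1) _ w0 P_def refl])
    fix j assume "j \<in> {a, b, v}"
    then show "dep z \<le> dep j \<and> 2 \<le> dep j \<and> par j \<in> insert z {a, b, v}"
      using d N_pos by (elim insertE) simp_all
  qed (use ne in auto)
  also have "(\<Sum>j\<in>{a, b, v}. g j * (w j - \<sigma> j * w (par j))) = 14 / 10 - 11 / 10 * (\<sigma> v * (\<sigma> b * w b)) * w z"
    using ne by (simp add: d(3,5,7) w(2) g_def a sign_mult[OF w(3)] algebra_simps)
  also have "(\<Sum>i\<in>{a, b, v}. (P i)\<^sup>2) = 107 / 100"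
    using ne SQ by (simp add: P power_mult_distrib power_divide)
  also have "(\<Sum>j\<in>{a, b, v}. (g j)\<^sup>2) = 366 / 100"
    using ne SQ by (simp add: g_def power_mult_distrib power_divide)
  finally have "0 \<le> l - 2 * (14 / 10 - 11 / 10 * (\<sigma> v * (\<sigma> b * w b)) * w z) + (w z)\<^sup>2
      - 2 * (P z + w z) * w z + 107 / 100 + (P z + w z)\<^sup>2 * (k + \<eta>) + \<epsilon> * (366 / 100)" .
  moreover have "(w z)\<^sup>2 - 2 * (P z + w z) * w z = - 1 - 2 * (11 / 10 * (\<sigma> v * (\<sigma> b * w b)) * w z)"
    using sign_sq[OF w(1)] unfolding P by (simp add: algebra_simps power2_eq_square)
  ultimately have "0 \<le> l - 38 / 10 + 107 / 100 + (P z + w z)\<^sup>2 * (k + \<eta>) + \<epsilon> * (366 / 100)" by simp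
  moreover have "(P z + w z)\<^sup>2 * (k + \<eta>) \<le> 5791 / 10000"
    by (rule tail_bound) (use w vb sigma_cases[OF pos(3)] in \<open>auto simp: P\<close>)
  ultimately show False using l_ub eps_bound by simp
qed

lemma no_triple_fork:
  assumes d: "N \<le> dep z" "dep a = Suc (dep z)" "par a = z" "dep b = Suc (dep z)" "par b = z"
      "dep c = Suc (dep z)" "par c = z" "a \<noteq> b" "a \<noteq> c" "b \<noteq> c"
    and w: "w z = 0" "w a \<in> {-1, 1}" "w b \<in> {-1, 1}" "w c \<in> {-1, 1}"
    and w0: "\<And>i. dep i < dep z \<Longrightarrow> w i = 0"
  shows False
proof -
  have ne: "a \<noteq> b" "a \<noteq> c" "b \<noteq> c" "a \<noteq> z" "b \<noteq> z" "c \<noteq> z" "b \<noteq> a" "c \<noteq> a" "c \<noteq> b" "z \<noteq> a" "z \<noteq> b" "z \<noteq> c"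
    using d(2,4,6,8-10) by auto
  have pos: "0 < dep a" "0 < dep b" "0 < dep c" using d(2,4,6) by auto
  note SQ = sign_sq[OF w(2)] sign_sq[OF w(3)] sign_sq[OF w(4)]
  define g where "g = (\<lambda>j. 7 / 10 * w j)"
  define P where "P = (\<lambda>i. \<Sum>j\<in>{a, b, c}. \<sigma> j * g j * delta (par j) i - g j * delta j i)"
  have P: "P a = - (7 / 10) * w a" "P b = - (7 / 10) * w b" "P c = - (7 / 10) * w c"
    "P z = 7 / 10 * (\<sigma> a * w a + \<sigma> b * w b + \<sigma> c * w c)"
    unfolding P_def using ne by (simp_all add: g_def d(3,5,7))
  have "0 \<le> l - 2 * (\<Sum>j\<in>{a, b, c}. g j * (w j - \<sigma> j * w (par j))) + (w z)\<^sup>2 - 2 * (P z + w z) * w z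
    + (\<Sum>i\<in>{a, b, c}. (P i)\<^sup>2) + (P z + w z)\<^sup>2 * (k + \<eta>) + \<epsilon> * (\<Sum>j\<in>{a, b, c}. (g j)\<^sup>2)"
  proof (rule flow_energy[OF _ _ d(1) _ w0 P_def refl])
    fix j assume "j \<in> {a, b, c}"
    then show "dep z \<le> dep j \<and> 2 \<le> dep j \<and> par j \<in> insert z {a, b, c}"
      using d N_pos by (elim insertE) simp_all
  qed (use ne in auto)
  also have "(\<Sum>j\<in>{a, b, c}. g j * (w j - \<sigma> j * w (par j))) = 21 / 10"
    using ne by (simp add: d(3,5,7) w(1) g_def sign_mult[OF w(2)] sign_mult[OF w(3)] sign_mult[OF w(4)] algebra_simps)
  also have "(\<Sum>i\<in>{a, b, c}. (P i)\<^sup>2) = 147 / 100"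
    using ne SQ by (simp add: P power_mult_distrib power_divide)
  also have "(\<Sum>j\<in>{a, b, c}. (g j)\<^sup>2) = 147 / 100"
    using ne SQ by (simp add: g_def power_mult_distrib power_divide)
  finally have "0 \<le> l - 42 / 10 + 147 / 100 + (P z)\<^sup>2 * (k + \<eta>) + \<epsilon> * (147 / 100)" using w(1) by simp
  moreover have "(P z)\<^sup>2 * (k + \<eta>) \<le> 5791 / 10000"
    by (rule tail_bound) (use w sigma_cases[OF pos(1)] sigma_cases[OF pos(2)] sigma_cases[OF pos(3)] in \<open>auto simp: P\<close>)
  ultimately show False using l_ub eps_bound by simp
qed

lemma no_fork_above:
  assumes d: "N \<le> dep z" "dep v = Suc (dep z)" "par v = z" "dep a = Suc (dep v)" "par a = v"
      "dep b = Suc (dep v)" "par b = v" "a \<noteq> b"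
    and w: "w z \<in> {-1, 1}" "w v = 0" "w a \<in> {-1, 1}" "w b \<in> {-1, 1}"
    and w0: "\<And>i. dep i < dep z \<Longrightarrow> w i = 0"
  shows False
proof -
  have ne: "a \<noteq> b" "a \<noteq> v" "b \<noteq> v" "a \<noteq> z" "b \<noteq> z" "v \<noteq> z" "b \<noteq> a" "v \<noteq> a" "v \<noteq> b" "z \<noteq> a" "z \<noteq> b" "z \<noteq> v"
    using d(2,4,6,8) by auto
  have pos: "0 < dep a" "0 < dep b" "0 < dep v" using d(2,4,6) by auto
  \<comment> \<open>The charges of \<open>a\<close> and \<open>b\<close> cancel at \<open>v\<close>
    or reinforce each other; \<open>S\<close> is 0 or a sign, and the flow from \<open>v\<close> is
    scaled by it.\<close>
  define S where "S = (\<sigma> a * w a + \<sigma> b * w b) / 2"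
  have S: "S = 0 \<or> S = 1 \<or> S = -1"
    using sigma_cases[OF pos(1)] sigma_cases[OF pos(2)] w by (auto simp: S_def)
  note SQ = sign_sq[OF w(3)] sign_sq[OF w(4)]
  define g where "g = (\<lambda>j. if j = v then 11 / 10 * S else 7 / 10 * w j)"
  define P where "P = (\<lambda>i. \<Sum>j\<in>{a, b, v}. \<sigma> j * g j * delta (par j) i - g j * delta j i)"
  have P: "P a = - (7 / 10) * w a" "P b = - (7 / 10) * w b" "P v = 3 / 10 * S"
    "P z = 11 / 10 * (\<sigma> v * S)"
    unfolding P_def using ne by (simp_all add: g_def d(3,5,7) S_def field_simps)
  have "0 \<le> l - 2 * (\<Sum>j\<in>{a, b, v}. g j * (w j - \<sigma> j * w (par j))) + (w z)\<^sup>2 - 2 * (P z + w z) * w z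
    + (\<Sum>i\<in>{a, b, v}. (P i)\<^sup>2) + (P z + w z)\<^sup>2 * (k + \<eta>) + \<epsilon> * (\<Sum>j\<in>{a, b, v}. (g j)\<^sup>2)"
  proof (rule flow_energy[OF _ _ d(1) _ w0 P_def refl])
    fix j assume "j \<in> {a, b, v}"
    then show "dep z \<le> dep j \<and> 2 \<le> dep j \<and> par j \<in> insert z {a, b, v}"
      using d N_pos by (elim insertE) simp_all
  qed (use ne in auto)
  also have "(\<Sum>j\<in>{a, b, v}. g j * (w j - \<sigma> j * w (par j))) = 14 / 10 - 11 / 10 * (\<sigma> v * S) * w z"
    using ne by (simp add: d(3,5,7) w(2) g_def sign_mult[OF w(3)] sign_mult[OF w(4)] algebra_simps)
  also have "(\<Sum>i\<in>{a, b, v}. (P i)\<^sup>2) = 98 / 100 + 9 / 100 * S\<^sup>2"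
    using ne SQ by (simp add: P power_mult_distrib power_divide)
  also have "(\<Sum>j\<in>{a, b, v}. (g j)\<^sup>2) = 98 / 100 + 121 / 100 * S\<^sup>2"
    using ne SQ by (simp add: g_def power_mult_distrib power_divide)
  finally have "0 \<le> l - 2 * (14 / 10 - 11 / 10 * (\<sigma> v * S) * w z) + (w z)\<^sup>2
      - 2 * (P z + w z) * w z + (98 / 100 + 9 / 100 * S\<^sup>2) + (P z + w z)\<^sup>2 * (k + \<eta>)
      + \<epsilon> * (98 / 100 + 121 / 100 * S\<^sup>2)" .
  moreover have "(w z)\<^sup>2 - 2 * (P z + w z) * w z = - 1 - 2 * (11 / 10 * (\<sigma> v * S) * w z)"
    using sign_sq[OF w(1)] unfolding P by (simp add: algebra_simps power2_eq_square)
  moreover have "S\<^sup>2 \<le> 1" using S by auto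
  moreover from this have "\<epsilon> * (98 / 100 + 121 / 100 * S\<^sup>2) \<le> \<epsilon> * (219 / 100)"
    using eps_nonneg by (intro mult_left_mono) auto
  ultimately have "0 \<le> l - 38 / 10 + 107 / 100 + (P z + w z)\<^sup>2 * (k + \<eta>) + \<epsilon> * (219 / 100)" by simp
  moreover have "(P z + w z)\<^sup>2 * (k + \<eta>) \<le> 5791 / 10000"
    by (rule tail_bound) (use w S sigma_cases[OF pos(3)] in \<open>auto simp: P\<close>)
  ultimately show False using l_ub eps_bound by simp
qed

lemma no_fork_of_marks:
  assumes d: "N \<le> dep z" "dep a = Suc (dep z)" "par a = z" "dep c = Suc (dep z)" "par c = z" "a \<noteq> c"
    and w: "w z \<in> {-1, 1}" "w a \<in> {-1, 1}" "w c \<in> {-1, 1}"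
    and w0: "\<And>i. dep i < dep z \<Longrightarrow> w i = 0"
  shows False
proof -
  have ne: "a \<noteq> c" "a \<noteq> z" "c \<noteq> z" "c \<noteq> a" "z \<noteq> a" "z \<noteq> c" using d(2,4,6) by auto
  have pos: "0 < dep a" "0 < dep c" using d(2,4) by auto
  have a: "\<sigma> a * (y * w a) = y * w z" "\<sigma> a * w z = w a" for y
    using transport_scaled[of a y] sign_transport[of a] pos w unfolding d(3) by simp_all
  have c: "\<sigma> c * (y * w c) = y * w z" "\<sigma> c * w z = w c" for y
    using transport_scaled[of c y] sign_transport[of c] pos w unfolding d(5) by simp_all
  note SQ = sign_sq[OF w(2)] sign_sq[OF w(3)]
  define g where "g = (\<lambda>j. 7 / 10 * w j)"
  define P where "P = (\<lambda>i. \<Sum>j\<in>{a, c}. \<sigma> j * g j * delta (par j) i - g j * delta j i)"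
  have P: "P a = - (7 / 10) * w a" "P c = - (7 / 10) * w c" "P z = 14 / 10 * w z"
    unfolding P_def using ne by (simp_all add: g_def d(3,5) a c)
  have "0 \<le> l - 2 * (\<Sum>j\<in>{a, c}. g j * (w j - \<sigma> j * w (par j))) + (w z)\<^sup>2 - 2 * (P z + w z) * w z
    + (\<Sum>i\<in>{a, c}. (P i)\<^sup>2) + (P z + w z)\<^sup>2 * (k + \<eta>) + \<epsilon> * (\<Sum>j\<in>{a, c}. (g j)\<^sup>2)"
  proof (rule flow_energy[OF _ _ d(1) _ w0 P_def refl])
    fix j assume "j \<in> {a, c}"
    then show "dep z \<le> dep j \<and> 2 \<le> dep j \<and> par j \<in> insert z {a, c}"
      using d N_pos by (elim insertE) simp_all
  qed (use ne in auto)
  also have "(\<Sum>j\<in>{a, c}. g j * (w j - \<sigma> j * w (par j))) = 0"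
    using ne a c by (simp add: d(3,5))
  also have "(\<Sum>i\<in>{a, c}. (P i)\<^sup>2) = 98 / 100"
    using ne SQ by (simp add: P power_mult_distrib power_divide)
  also have "(\<Sum>j\<in>{a, c}. (g j)\<^sup>2) = 98 / 100"
    using ne SQ by (simp add: g_def power_mult_distrib power_divide)
  also have "(P z + w z)\<^sup>2 = 576 / 100"
    unfolding P shift_sq[OF w(1)] by (simp add: power_divide)
  finally have "0 \<le> l - 2 * 0 + (w z)\<^sup>2 - 2 * (P z + w z) * w z + 98 / 100
      + 576 / 100 * (k + \<eta>) + \<epsilon> * (98 / 100)" .
  moreover have "(w z)\<^sup>2 - 2 * (P z + w z) * w z = - 38 / 10"
    using sign_sq[OF w(1)] unfolding P by (simp add: algebra_simps power2_eq_square)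
  ultimately have "0 \<le> l - 38 / 10 + 98 / 100 + 576 / 100 * (k + \<eta>) + \<epsilon> * (98 / 100)" by linarith
  moreover have "576 / 100 * (k + \<eta>) < 7563 / 10000" using numeric_bounds by simp
  ultimately show False using l_ub numeric_bounds(3) by argo
qed

text \<open>The inner product of the two vectors is -2, 0 or 2 and also lies in {-1, 0, 1}, so they
  are orthogonal. After a change of sign the values \<open>u\<close> and \<open>v\<close> act by
  their sum at \<open>z\<close> and by their difference at \<open>j\<close>.\<close>

lemma twin_energy:
  assumes z: "N \<le> dep z" and j: "dep j = Suc (dep z)" "par j = z"
    and e: "e \<in> H" "\<And>i. 0 < dep i \<Longrightarrow> e \<noteq> pe i" "r e = (\<lambda>x. a * delta j x + b * delta z x)"
      "a \<in> {-1, 1}" "b \<in> {-1, 1}"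
    and w0: "\<And>i. dep i < dep z \<Longrightarrow> w i = 0"
    and T_def: "T = t j * (u + v) + w z"
  shows "0 \<le> l + 2 * (u * f (pe j) + v * (- a * s j * f e)) + (w z)\<^sup>2 - 2 * T * w z + (u - v)\<^sup>2
    + T\<^sup>2 * (k + \<eta>) + \<epsilon> * (u\<^sup>2 + v\<^sup>2)"
proof -
  have dj: "0 < dep j" using j by simp
  have zI: "z \<in> I" "0 < dep z" using z N_pos tree[of z] by auto
  have jI: "j \<in> I" "pe j \<in> H" using tree[OF dj] by auto
  have ne: "j \<noteq> z" "z \<noteq> j" using j(1) by auto
  have epe: "e \<noteq> pe j" "pe j \<noteq> e" using e(2)[OF dj] by auto
  have rj: "r (pe j) = (\<lambda>x. s j * delta j x + t j * delta z x)" using tree_edge[OF dj] j(2) by simp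
  have "(\<Sum>i\<in>I. r (pe j) i * r e i) = s j * a + t j * b"
  proof -
    have "(\<Sum>i\<in>I. r (pe j) i * r e i) = (\<Sum>i\<in>I. delta j i * (s j * a) + delta z i * (t j * b))"
      unfolding rj e(3) using ne by (intro sum.cong) (auto simp: delta_def)
    then show ?thesis using jI zI finI by (simp add: sum.distrib sum_delta)
  qed
  then have "s j * a + t j * b \<in> {-1, 0, 1}" using inner_values[OF jI(2) e(1) epe(2)] by simp
  then have orth: "b = - a * s j * t j" "a * b * s j = - t j"
    using signs[OF dj] e(4,5) by auto
  define x where "x = (\<lambda>m. u * delta (pe j) m + (- a * s j * v) * delta e m)"
  define P where "P = (\<lambda>i. \<Sum>m\<in>H. x m * r m i)"
  have sumx: "(\<Sum>m\<in>H. x m * h m) = u * h (pe j) + (- a * s j * v) * h e" for h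
  proof -
    have "(\<Sum>m\<in>H. x m * h m) = (\<Sum>m\<in>H. u * (delta (pe j) m * h m) + (- a * s j * v) * (delta e m * h m))"
      unfolding x_def by (intro sum.cong) (simp_all add: algebra_simps)
    also have "\<dots> = u * (\<Sum>m\<in>H. delta (pe j) m * h m) + (- a * s j * v) * (\<Sum>m\<in>H. delta e m * h m)"
      by (simp only: sum.distrib sum_distrib_left)
    finally show ?thesis using finH e(1) jI by (simp add: sum_delta)
  qed
  have P: "P i = s j * (u - v) * delta j i + t j * (u + v) * delta z i" for i
  proof -
    have "P i = (s j * u - a * a * s j * v) * delta j i + (t j * u - (a * b * s j) * v) * delta z i"
      unfolding P_def sumx rj e(3) by (simp add: algebra_simps)
    also have "a * a = 1" using e(4) by auto
    finally show ?thesis unfolding orth(2) by (simp add: algebra_simps)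
  qed
  have T: "T = P z + w z" unfolding P T_def using ne by simp
  have "0 \<le> l + 2 * (\<Sum>m\<in>H. x m * f m) + (w z)\<^sup>2 - 2 * T * w z + (\<Sum>i\<in>I - {z}. (P i)\<^sup>2)
    + T\<^sup>2 * M z z + \<epsilon> * (\<Sum>m\<in>H. (x m)\<^sup>2)"
  proof (rule local_energy[OF zI _ _ P_def _ w0 T])
    fix m assume "m \<in> H" "x m \<noteq> 0"
    then have "m = pe j \<or> m = e" by (auto simp: x_def delta_def split: if_splits)
    then show "X z m = 0"
    proof
      assume "m = pe j" then show ?thesis using X_pe_zero[OF dj ne(1)] j(1) by simp
    next
      assume m: "m = e"
      show ?thesis
      proof (rule ccontr)
        assume "X z m \<noteq> 0"
        then obtain i where "m = pe i" "2 \<le> dep i" using X_support by blast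
        moreover from this have "0 < dep i" by simp
        ultimately show False using e(2)[of i] m by simp
      qed
    qed
  next
    fix i assume i: "dep i = 1"
    have "i \<noteq> j" using i j(1) zI(2) by auto
    then have "pe i \<noteq> pe j" using pe_inj[of i j] i dj by auto
    moreover have "e \<noteq> pe i" using e(2)[of i] i by simp
    ultimately show "x (pe i) = 0" by (simp add: x_def delta_def)
  next
    fix i assume "dep i < dep z"
    then have "i \<noteq> j" "i \<noteq> z" using j(1) by auto
    then show "P i = 0" unfolding P by simp
  qed
  also have "(\<Sum>m\<in>H. x m * f m) = u * f (pe j) + v * (- a * s j * f e)"
    unfolding sumx by simp
  also have "(\<Sum>i\<in>I - {z}. (P i)\<^sup>2) = (P j)\<^sup>2"
    using finI jI ne by (intro sum_single) (auto simp: P)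
  also have "(P j)\<^sup>2 = (s j * s j) * (u - v)\<^sup>2" unfolding P using ne by (simp add: power2_eq_square)
  also have "s j * s j = 1" by (rule s_sq[OF dj])
  also have "(\<Sum>m\<in>H. (x m)\<^sup>2) = u\<^sup>2 + v\<^sup>2"
  proof -
    have "(\<Sum>m\<in>H. (x m)\<^sup>2) = u * x (pe j) + (- a * s j * v) * x e"
      unfolding power2_eq_square by (rule sumx)
    also have "\<dots> = u\<^sup>2 + (a * a) * (s j * s j) * v\<^sup>2"
      using epe by (simp add: x_def delta_def power2_eq_square)
    also have "a * a = 1" using e(4) by auto
    finally show ?thesis using s_sq[OF dj] by simp
  qed
  also have "T\<^sup>2 * M z z \<le> T\<^sup>2 * (k + \<eta>)"
    using M_diag_bound[OF z] by (intro mult_left_mono) auto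
  finally show ?thesis by simp
qed

text \<open>\<open>P\<close> and \<open>Q\<close> are the optimal sum and difference of the two
  values: the energy decouples, with minima at \<open>1 / (2 * k + \<epsilon>)\<close> and
  \<open>1 / l\<close>. The result \<open>l - (P + Q) / 2\<close> is
  \<open>1 - q ^ 4 - q ^ 6\<close> over a positive denominator, the third borderline case.\<close>

lemma twin_minimum:
  assumes "P = q / (1 - q\<^sup>2)" "Q = q / (1 + q\<^sup>2)"
  shows "l - (P + Q) + Q\<^sup>2 + P\<^sup>2 * (k + \<eta>) + \<epsilon> * ((P\<^sup>2 + Q\<^sup>2) / 2) < 0"
proof -
  have "q\<^sup>2 < 1" using q_pos by (simp add: power_less_one_iff)
  then have P: "P * (1 - q\<^sup>2) = q" and Q: "Q * (1 + q\<^sup>2) = q"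
    using assms add_pos_nonneg[of 1 "q\<^sup>2"] by auto
  have "(q * P\<^sup>2) * (2 * k + \<epsilon>) = P\<^sup>2 * (2 * (k * q) + \<epsilon> * q)" by (simp add: algebra_simps)
  also have "\<dots> = P * (P * (1 - q\<^sup>2))" unfolding q_relations(1,3) by (simp add: algebra_simps power2_eq_square)
  also have "\<dots> = q * P" unfolding P by simp
  finally have 1: "P\<^sup>2 * (2 * k + \<epsilon>) = P" using q_pos by simp
  have "(q * Q\<^sup>2) * (2 + \<epsilon>) = Q\<^sup>2 * (2 * q + \<epsilon> * q)" by (simp add: algebra_simps)
  also have "\<dots> = Q * (Q * (1 + q\<^sup>2))" unfolding q_relations(1) by (simp add: algebra_simps power2_eq_square)
  also have "\<dots> = q * Q" unfolding Q by simp
  finally have 2: "Q\<^sup>2 * (2 + \<epsilon>) = Q" using q_pos by simp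
  have "l - (P + Q) + Q\<^sup>2 + P\<^sup>2 * (k + \<eta>) + \<epsilon> * ((P\<^sup>2 + Q\<^sup>2) / 2) =
      l - (P + Q) + (P\<^sup>2 * (2 * k + \<epsilon>) + Q\<^sup>2 * (2 + \<epsilon>)) / 2 + P\<^sup>2 * \<eta>"
    by (simp add: field_simps)
  also have "\<dots> = l - (P + Q) / 2 + P\<^sup>2 * \<eta>" unfolding 1 2 by (simp add: field_simps)
  finally have E: "l - (P + Q) + Q\<^sup>2 + P\<^sup>2 * (k + \<eta>) + \<epsilon> * ((P\<^sup>2 + Q\<^sup>2) / 2) = l - (P + Q) / 2 + P\<^sup>2 * \<eta>" .
  define c where "c = q * (1 - q\<^sup>2) * (1 + q\<^sup>2)"
  have c: "0 < c" "c \<le> 1"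
  proof -
    show "0 < c" unfolding c_def using q_pos \<open>q\<^sup>2 < 1\<close> by (intro mult_pos_pos add_pos_nonneg) auto
    have "(1 - q\<^sup>2) * (1 + q\<^sup>2) = 1 - (q\<^sup>2)\<^sup>2" by (simp add: algebra_simps power2_eq_square)
    then have "(1 - q\<^sup>2) * (1 + q\<^sup>2) \<le> 1" by simp
    moreover have "0 \<le> (1 - q\<^sup>2) * (1 + q\<^sup>2)"
      using \<open>q\<^sup>2 < 1\<close> by (intro mult_nonneg_nonneg) auto
    ultimately have "q * ((1 - q\<^sup>2) * (1 + q\<^sup>2)) \<le> 1 * 1"
      using q_pos by (intro mult_mono) auto
    then show "c \<le> 1" by (simp add: c_def mult.assoc)
  qed
  have "P \<le> 4"
  proof -
    have "q * q \<le> 0.8692 * 0.8692" using q_bounds q_pos by (intro mult_mono) auto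
    then have "q \<le> 4 * (1 - q\<^sup>2)" using q_bounds by (simp add: power2_eq_square)
    then show ?thesis unfolding assms(1) using \<open>q\<^sup>2 < 1\<close> by (simp add: divide_le_eq)
  qed
  moreover have "0 \<le> P" unfolding assms(1) using q_pos \<open>q\<^sup>2 < 1\<close> by simp
  ultimately have "P\<^sup>2 \<le> 4\<^sup>2" by (intro power_mono)
  then have "c * P\<^sup>2 \<le> 1 * 4\<^sup>2" using c by (intro mult_mono) auto
  then have "c * P\<^sup>2 * \<eta> \<le> 16 * \<eta>" using eta_bounds by (intro mult_right_mono) auto
  moreover have "c * (l - (P + Q) / 2 + P\<^sup>2 * \<eta>) = 1 - q ^ 4 - q ^ 6 + c * P\<^sup>2 * \<eta>"
  proof -
    have "c * (l - (P + Q) / 2 + P\<^sup>2 * \<eta>) = (l * q) * ((1 - q\<^sup>2) * (1 + q\<^sup>2))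
        - (q * (1 + q\<^sup>2) * (P * (1 - q\<^sup>2)) + q * (1 - q\<^sup>2) * (Q * (1 + q\<^sup>2))) / 2 + c * P\<^sup>2 * \<eta>"
      unfolding c_def by (simp add: field_simps)
    also have "\<dots> = 1 - q ^ 4 - q ^ 6 + c * P\<^sup>2 * \<eta>"
      unfolding P Q q_relations(2) by (simp add: algebra_simps eval_nat_numeral)
    finally show ?thesis .
  qed
  ultimately have "c * (l - (P + Q) / 2 + P\<^sup>2 * \<eta>) < 0" using eta_bounds by linarith
  then show ?thesis unfolding E using c by (simp add: mult_less_0_iff)
qed

text \<open>Twins are two vertices whose vectors have the same pair of coordinates as support.\<close>

lemma no_twins:
  assumes z: "N \<le> dep z" and j: "dep j = Suc (dep z)" "par j = z"
    and e: "e \<in> H" "\<And>i. 0 < dep i \<Longrightarrow> e \<noteq> pe i" "r e = (\<lambda>x. a * delta j x + b * delta z x)"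
      "a \<in> {-1, 1}" "b \<in> {-1, 1}"
    and one: "f (pe j) \<in> {-1, 1} \<and> f e = 0 \<or> f (pe j) = 0 \<and> f e \<in> {-1, 1}"
    and wz: "w z \<in> {-1, 0, 1}"
    and w0: "\<And>i. dep i < dep z \<Longrightarrow> w i = 0"
  shows False
proof -
  have dj: "0 < dep j" using j by simp
  define F where "F = f (pe j)"
  define G where "G = - a * s j * f e"
  have FG: "F \<in> {-1, 1} \<and> G = 0 \<or> F = 0 \<and> G \<in> {-1, 1}"
    using one signs[OF dj] e(4) by (auto simp: F_def G_def)
  have E: "0 \<le> l + 2 * (u * F + v * G) + (w z)\<^sup>2 - 2 * T * w z + (u - v)\<^sup>2
    + T\<^sup>2 * (k + \<eta>) + \<epsilon> * (u\<^sup>2 + v\<^sup>2)" if "T = t j * (u + v) + w z" for T u v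
    unfolding F_def G_def by (rule twin_energy[OF z j e w0 that])
  have tt: "t j \<in> {-1, 1}" using signs[OF dj] by simp
  show False
  proof (cases "w z = 0")
    case True
    define P where "P = q / (1 - q\<^sup>2)"
    define Q where "Q = q / (1 + q\<^sup>2)"
    define u where "u = - F * ((P + Q) / 2) - G * ((P - Q) / 2)"
    define v where "v = - F * ((P - Q) / 2) - G * ((P + Q) / 2)"
    have uv: "(t j * (u + v) + w z)\<^sup>2 = P\<^sup>2" "(u - v)\<^sup>2 = Q\<^sup>2" "2 * (u * F + v * G) = - (P + Q)"
      "u\<^sup>2 + v\<^sup>2 = (P\<^sup>2 + Q\<^sup>2) / 2"
      using FG tt True by (auto simp: u_def v_def field_simps power2_eq_square)
    have "0 \<le> l - (P + Q) + Q\<^sup>2 + P\<^sup>2 * (k + \<eta>) + \<epsilon> * ((P\<^sup>2 + Q\<^sup>2) / 2)"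
      using E[OF refl, of u v] unfolding uv by (simp add: True)
    then show False using twin_minimum[OF P_def Q_def] by simp
  next
    case False
    then have w: "w z \<in> {-1, 1}" using wz by auto
    \<comment> \<open>Rounded values. The larger one is placed on the twin that is not adjacent to
      the new vertex, where it causes no linear term.\<close>
    define u where "u = t j * w z * (if F = 0 then 16 / 10 else 1)"
    define v where "v = t j * w z * (if F = 0 then 1 else 16 / 10)"
    have uv: "t j * (u + v) + w z = 36 / 10 * w z" "(u - v)\<^sup>2 = 36 / 100" "u * F + v * G \<le> 1"
      "u\<^sup>2 + v\<^sup>2 = 356 / 100"
      using FG tt w by (auto simp: u_def v_def field_simps power2_eq_square)
    have sq: "(36 / 10 * w z)\<^sup>2 = 1296 / 100" "2 * (36 / 10 * w z) * w z = 72 / 10" "(w z)\<^sup>2 = 1"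
      using w by (auto simp: power2_eq_square)
    have "0 \<le> l + 2 * (u * F + v * G) + 1 - 72 / 10 + 36 / 100 + 1296 / 100 * (k + \<eta>) + \<epsilon> * (356 / 100)"
      using E[OF uv(1)[symmetric]] unfolding sq uv(2,4) .
    then show False using uv(3) l_ub numeric_bounds by argo
  qed
qed

section \<open>At most two marks\<close>

lemma M_le:
  assumes "N \<le> dep i" "N \<le> dep j"
  shows "\<bar>M i j\<bar> \<le> 1313 / 10000"
    "1 \<le> td i j \<Longrightarrow> \<bar>M i j\<bar> \<le> 1142 / 10000"
    "2 \<le> td i j \<Longrightarrow> \<bar>M i j\<bar> \<le> 993 / 10000"
    "3 \<le> td i j \<Longrightarrow> \<bar>M i j\<bar> \<le> 863 / 10000"
    "4 \<le> td i j \<Longrightarrow> \<bar>M i j\<bar> \<le> 750 / 10000"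
proof -
  have *: "\<bar>M i j\<bar> \<le> 1312 / 10000 * (8692 / 10000) ^ n + 1 / 10000" if "n \<le> td i j" for n
  proof -
    have "q ^ td i j \<le> q ^ n" using that q_pos by (intro power_decreasing) auto
    also have "\<dots> \<le> (8692 / 10000) ^ n" using q_bounds by (intro power_mono) auto
    finally have "k * q ^ td i j \<le> 1312 / 10000 * (8692 / 10000) ^ n"
      using numeric_bounds k_bounds q_pos by (intro mult_mono) auto
    then show ?thesis using M_bound_deep[OF assms] numeric_bounds by linarith
  qed
  show "\<bar>M i j\<bar> \<le> 1313 / 10000" using *[of 0] by simp
  show "1 \<le> td i j \<Longrightarrow> \<bar>M i j\<bar> \<le> 1142 / 10000"
    using *[of 1] by (simp add: power2_eq_square)
  show "2 \<le> td i j \<Longrightarrow> \<bar>M i j\<bar> \<le> 993 / 10000"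
    using *[of 2] by (simp add: power2_eq_square)
  show "3 \<le> td i j \<Longrightarrow> \<bar>M i j\<bar> \<le> 863 / 10000"
    using *[of 3] by (simp add: power3_eq_cube)
  show "4 \<le> td i j \<Longrightarrow> \<bar>M i j\<bar> \<le> 750 / 10000"
    using *[of 4] by (simp add: power4_eq_xxxx)
qed

lemma marks_energy:
  assumes S: "finite S" "S \<subseteq> I" and deep: "0 < dep j0"
    and closed: "\<And>i m. i \<in> S \<Longrightarrow> m \<notin> S \<Longrightarrow> w m \<noteq> 0 \<Longrightarrow> dep i \<le> dep m"
  shows "0 \<le> l - (\<Sum>i\<in>S. (w i)\<^sup>2) + (\<Sum>i\<in>S. \<Sum>j\<in>S. w i * w j * M i j)"
  using charge_energy[OF S deep, of "pe j0" 0 w] closed tree[OF deep] by simp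

text \<open>Cauchy-Schwarz for at most three marks bounds the routing cost by 0.394 times the sum of
  squares. The remaining 0.606 times this sum exceeds \<open>l\<close> as soon as the sum is
  4.\<close>

lemma no_heavy_marks:
  assumes S: "finite S" "S \<subseteq> {i. w i \<noteq> 0}" "card S \<le> 3" and heavy: "4 \<le> (\<Sum>i\<in>S. (w i)\<^sup>2)"
    and closed: "\<And>i m. i \<in> S \<Longrightarrow> m \<notin> S \<Longrightarrow> w m \<noteq> 0 \<Longrightarrow> dep i \<le> dep m"
  shows False
proof -
  have "S \<noteq> {}" using heavy by auto
  then obtain j0 where j0: "j0 \<in> S" by blast
  then have deep: "0 < dep j0" using w_far[of j0] S by auto
  have SI: "S \<subseteq> I" using S(2) w_I by auto
  have dS: "N \<le> dep i" if "i \<in> S" for i using w_far[of i] S(2) that by auto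
  have "(\<Sum>i\<in>S. \<Sum>j\<in>S. w i * w j * M i j) \<le> (\<Sum>i\<in>S. \<Sum>j\<in>S. \<bar>w i\<bar> * \<bar>w j\<bar> * (1313 / 10000))"
  proof (intro sum_mono)
    fix i j assume ij: "i \<in> S" "j \<in> S"
    have "w i * w j * M i j \<le> \<bar>w i\<bar> * \<bar>w j\<bar> * \<bar>M i j\<bar>" by (metis abs_ge_self abs_mult)
    also have "\<dots> \<le> \<bar>w i\<bar> * \<bar>w j\<bar> * (1313 / 10000)"
      using M_le(1)[OF dS[OF ij(1)] dS[OF ij(2)]] by (intro mult_left_mono) auto
    finally show "w i * w j * M i j \<le> \<bar>w i\<bar> * \<bar>w j\<bar> * (1313 / 10000)" .
  qed
  also have "\<dots> = (1313 / 10000) * (\<Sum>i\<in>S. \<bar>w i\<bar>)\<^sup>2"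
    by (simp add: power2_eq_square sum_product sum_distrib_left mult_ac)
  also have "(\<Sum>i\<in>S. \<bar>w i\<bar>)\<^sup>2 \<le> (\<Sum>i\<in>S. \<bar>w i\<bar>\<^sup>2) * real (card S)"
    by (rule sum_squared_le_sum_of_squares)
  also have "\<dots> \<le> (\<Sum>i\<in>S. \<bar>w i\<bar>\<^sup>2) * 3"
    using S(3) by (intro mult_left_mono sum_nonneg) auto
  finally have "(\<Sum>i\<in>S. \<Sum>j\<in>S. w i * w j * M i j) \<le> 1313 / 10000 * ((\<Sum>i\<in>S. (w i)\<^sup>2) * 3)"
    by simp
  moreover have "0 \<le> l - (\<Sum>i\<in>S. (w i)\<^sup>2) + (\<Sum>i\<in>S. \<Sum>j\<in>S. w i * w j * M i j)"
    by (rule marks_energy[OF S(1) SI deep closed])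
  ultimately show False using heavy l_ub by argo
qed

lemma td_par: "0 < dep i \<Longrightarrow> td i (par i) = 1"
  using par_neq[of i] dep_par[of i] by (simp add: td.simps[of i] td_eq_0)

text \<open>\<open>c\<close> is the lowest mark, and by \<open>low\<close> every further mark is at
  least as deep as \<open>a\<close>, so these three can be treated alone. Unless the tree distances
  are small, routing the marks separately is cheap enough; the small distances that parity permits
  are the configurations excluded above.\<close>

lemma no_three_marks:
  assumes w: "w a \<in> {-1, 1}" "w b \<in> {-1, 1}" "w c \<in> {-1, 1}"
    and ne: "a \<noteq> b" "a \<noteq> c" "b \<noteq> c"
    and ord: "dep b \<le> dep a" "dep c \<le> dep b"
    and low: "\<And>m. w m \<noteq> 0 \<Longrightarrow> m \<noteq> b \<Longrightarrow> m \<noteq> c \<Longrightarrow> dep a \<le> dep m"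
  shows False
proof -
  have nz: "w a \<noteq> 0" "w b \<noteq> 0" "w c \<noteq> 0" using w by auto
  have far3: "N < dep a" "N < dep b" "N < dep c" using nz by (auto intro: w_far)
  then have pos: "0 < dep a" "0 < dep b" "0 < dep c" by auto
  have inI: "a \<in> I" "b \<in> I" "c \<in> I" using nz by (auto intro: w_I)
  have un: "w v = 0" if "dep v < dep a" "v \<noteq> b" "v \<noteq> c" for v
    using low[of v] that by (cases "w v = 0") auto
  have un': "w v = 0" if "dep v < dep a" "dep v \<noteq> dep b" "dep v \<noteq> dep c" for v
    using un[of v] that by blast
  have w0: "w i = 0" if "dep i < dep c" for i
    using that ord by (intro un) auto
  have pa: "dep a = Suc (dep (par a))" "dep b = Suc (dep (par b))" "dep c = Suc (dep (par c))"
    using tree pos by auto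
  have parity: "even (td a b + td b c + td a c)"
    using td_even[OF inI(1,2)] td_even[OF inI(2,3)] td_even[OF inI(1,3)] by presburger
  \<comment> \<open>The bound belongs to the distances 1, 3, 4, the most expensive triple left to
    this estimate: 0.1142 + 0.0863 + 0.0750.\<close>
  have generic: False if "\<bar>M a b\<bar> + \<bar>M b c\<bar> + \<bar>M a c\<bar> \<le> 2755 / 10000"
  proof -
    have "0 \<le> l - (\<Sum>i\<in>{a, b, c}. (w i)\<^sup>2) + (\<Sum>i\<in>{a, b, c}. \<Sum>j\<in>{a, b, c}. w i * w j * M i j)"
    proof (rule marks_energy[OF _ _ pos(1)])
      fix i m assume "i \<in> {a, b, c}" "m \<notin> {a, b, c}" "w m \<noteq> 0"
      then show "dep i \<le> dep m" using low[of m] ord by auto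
    qed (use inI in auto)
    also have "(\<Sum>i\<in>{a, b, c}. (w i)\<^sup>2) = 3"
      using ne sign_sq[OF w(1)] sign_sq[OF w(2)] sign_sq[OF w(3)] by simp
    also have "(\<Sum>i\<in>{a, b, c}. \<Sum>j\<in>{a, b, c}. w i * w j * M i j) =
        M a a + M b b + M c c + 2 * (w a * w b * M a b + w b * w c * M b c + w a * w c * M a c)"
      using ne by (simp add: sign_mult[OF w(1)] sign_mult[OF w(2)] sign_mult[OF w(3)] M_commute[of b a] M_commute[of c a] M_commute[of c b] algebra_simps)
    finally have "0 \<le> l - 3 + (M a a + M b b + M c c + 2 * (w a * w b * M a b + w b * w c * M b c + w a * w c * M a c))" .
    moreover have "w a * w b * M a b \<le> \<bar>M a b\<bar>" "w b * w c * M b c \<le> \<bar>M b c\<bar>" "w a * w c * M a c \<le> \<bar>M a c\<bar>"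
      using w by auto
    moreover have "M a a \<le> 1313 / 10000" "M b b \<le> 1313 / 10000" "M c c \<le> 1313 / 10000"
      using M_le(1)[of a a] M_le(1)[of b b] M_le(1)[of c c] far3 by auto
    ultimately show False using that l_ub by argo
  qed
  have le: "N \<le> dep a" "N \<le> dep b" "N \<le> dep c" using far3 by auto
  note ab = M_le[OF le(1,2)] and bc = M_le[OF le(2,3)] and ac = M_le[OF le(1,3)]
  have tdpos: "1 \<le> td a b" "1 \<le> td b c" "1 \<le> td a c"
    using td_eq_0[of a b] td_eq_0[of b c] td_eq_0[of a c] ne by linarith+
  have ab1: "par a = b" if "td a b = 1" using td_1[OF ord(1) pos(1) that] .
  have bc1: "par b = c" if "td b c = 1" using td_1[OF ord(2) pos(2) that] .
  have ac1: "par a = c" if "td a c = 1" using td_1[OF _ pos(1) that] ord by simp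
  have ab2: "dep b < dep a \<and> par (par a) = b \<or> dep b = dep a \<and> par a = par b" if "td a b = 2"
    using td_2[OF ord(1) pos(1,2) that] .
  have bc2: "dep c < dep b \<and> par (par b) = c \<or> dep c = dep b \<and> par b = par c" if "td b c = 2"
    using td_2[OF ord(2) pos(2,3) that] .
  have ac2: "dep c < dep a \<and> par (par a) = c \<or> dep c = dep a \<and> par a = par c" if "td a c = 2"
    using td_2[OF _ pos(1,3) that] ord by simp
  have ppa: "dep (par a) = Suc (dep (par (par a)))" "dep (par b) = Suc (dep (par (par b)))"
    using tree[of "par a"] tree[of "par b"] far3 pa N_pos by auto
  have tpa: "td a (par a) = 1" "td b (par b) = 1" using td_par pos by auto
  show False
  proof (cases "td a b = 1")
    case True
    note par_a = ab1[OF True]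
    consider "td b c = 1" | "td b c = 2" "dep c < dep b" "par (par b) = c"
      | "td b c = 2" "dep c = dep b" "par b = par c" | "3 \<le> td b c"
      using bc2 tdpos by linarith
    then show False
    proof cases
      case 1
      show False
      proof (rule no_chain[OF le(3) _ _ bc1[OF 1] par_a w(3,2,1)])
        show "dep b = Suc (dep c)" using pa(2) unfolding bc1[OF 1] .
        show "dep a = Suc (dep b)" using pa(1) unfolding par_a .
      qed (rule w0)
    next
      case 2
      have z0: "w (par b) = 0"
        by (rule un') (use 2(2) pa(1)[unfolded par_a] pa(2) ppa(2)[unfolded 2(3)] in linarith)+
      show False
      proof (rule no_chain_gap[OF le(3) _ 2(3) pa(2) refl _ par_a w(3) z0 w(2,1)])
        show "dep (par b) = Suc (dep c)" using ppa(2) unfolding 2(3) .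
        show "dep a = Suc (dep b)" using pa(1) unfolding par_a .
      qed (rule w0)
    next
      case 3
      have z0: "w (par b) = 0"
        by (rule un') (use 3(2) pa(2) ord in linarith)+
      show False
      proof (rule no_fork_tree[OF _ pa(2) refl _ par_a _ _ ne(3) z0 w(1,2,3)])
        show "N \<le> dep (par b)" using pa(2) far3(2) by linarith
        show "w i = 0" if "dep i < dep (par b)" for i by (rule un') (use that 3(2) pa(2) ord in linarith)+
      qed (use 3 par_a pa in \<open>metis\<close>)+
    next
      case 4
      have "td a c \<noteq> 1" using ac1 par_a ne by auto
      moreover have "td a c \<noteq> 2"
      proof
        assume "td a c = 2"
        then have "par b = c" using ac2 par_a ord pa by auto
        then show False using tpa(2) 4 by simp
      qed
      ultimately have "3 \<le> td a c" using tdpos by linarith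
      have "4 \<le> td a c \<or> 4 \<le> td b c"
      proof (rule ccontr)
        assume "\<not> ?thesis"
        then have "td a c = 3" "td b c = 3" using 4 \<open>3 \<le> td a c\<close> by auto
        then show False using parity True by simp
      qed
      then have "\<bar>M b c\<bar> + \<bar>M a c\<bar> \<le> 863 / 10000 + 750 / 10000"
        using bc(4,5) ac(4,5) 4 \<open>3 \<le> td a c\<close> by linarith
      then show False using ab(2) tdpos by (intro generic) argo
    qed
  next
    case ab_ge: False
    show False
    proof (cases "td a c = 1")
      case True
      note par_a = ac1[OF True]
      consider "td b c = 1" | "td b c = 2" "dep c < dep b" "par (par b) = c"
        | "td b c = 2" "dep c = dep b" "par b = par c" | "3 \<le> td b c"
        using bc2 tdpos by linarith
      then show False
      proof cases
        case 1
        show False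
          by (rule no_fork_of_marks[OF le(3) _ par_a _ bc1[OF 1] ne(1) w(3,1,2)])
            (use pa(1) par_a pa(2) bc1[OF 1] w0 in simp_all)
      next
        case 2
        then show False using pa ppa par_a ord by auto
      next
        case 3
        have z0: "w (par c) = 0"
          by (rule un') (use 3(2) pa(3) ord in linarith)+
        show False
        proof (rule no_fork_tree[OF _ pa(3) refl _ par_a _ _ ne(3)[symmetric] z0 w(1,3,2)])
          show "N \<le> dep (par c)" using pa(3) far3(3) by linarith
          show "w i = 0" if "dep i < dep (par c)" for i by (rule un') (use that 3(2) pa(3) ord in linarith)+
        qed (use 3 par_a pa in \<open>metis\<close>)+
      next
        case 4
        have "td a b \<noteq> 2"
        proof
          assume "td a b = 2"
          from ab2[OF this] have "par b = c"
          proof (elim disjE conjE)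
            assume "par (par a) = b"
            then have "dep c = Suc (dep b)" using ppa(1) unfolding par_a by simp
            then show ?thesis using ord by simp
          qed (use par_a in simp)
          then show False using tpa(2) 4 by simp
        qed
        then have "3 \<le> td a b" using tdpos ab_ge by linarith
        have "4 \<le> td a b \<or> 4 \<le> td b c"
        proof (rule ccontr)
          assume "\<not> ?thesis"
          then have "td a b = 3" "td b c = 3" using 4 \<open>3 \<le> td a b\<close> by auto
          then show False using parity True by simp
        qed
        then have "\<bar>M b c\<bar> + \<bar>M a b\<bar> \<le> 863 / 10000 + 750 / 10000"
          using bc(4,5) ab(4,5) 4 \<open>3 \<le> td a b\<close> by linarith
        then show False using ac(2) tdpos by (intro generic) argo
      qed
    next
      case ac_ge: False
      show False
      proof (cases "td b c = 1")
        case True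
        note par_b = bc1[OF True]
        have dbc: "dep b = Suc (dep c)" using pa par_b by simp
        show False
        proof (cases "td a b = 2")
          case True
          have "par a \<noteq> par b"
          proof
            assume "par a = par b"
            then have "td a c = 1" using tpa(1) par_b by simp
            then show False using ac_ge by simp
          qed
          then have g: "dep b < dep a" "par (par a) = b" using ab2[OF True] by auto
          have dv: "dep (par a) = Suc (dep b)" using ppa(1) g by simp
          have "w (par a) = 0" by (rule un') (use dv dbc pa(1) in linarith)+
          show False
          proof (rule no_edge_and_mark[OF le(3) dbc par_b pa(1) refl _ _ _ ne(1) w(3,2,1) \<open>w (par a) = 0\<close>])
            show "par a \<noteq> b" using dv by (metis n_not_Suc_n)
          qed (use g(2) dv w0 in simp_all)
        next
          case ab3: False
          show False
          proof (cases "td a c = 2")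
            case True
            have g: "par (par a) = c" "dep c < dep a" using ac2[OF True] ord dbc by auto
            have "par a \<noteq> b" using tpa(1) ab_ge by auto
            have dv: "dep (par a) = Suc (dep c)" using ppa(1) g by simp
            have "par a \<noteq> c" using dv by auto
            have "w (par a) = 0" by (rule un) (use dv \<open>par a \<noteq> b\<close> \<open>par a \<noteq> c\<close> pa(1) in simp_all)
            show False
              by (rule no_edge_and_mark[OF le(3) dbc par_b pa(1) refl _ _ \<open>par a \<noteq> b\<close> ne(1) w(3,2,1) \<open>w (par a) = 0\<close>])
                (use g(1) dv w0 in simp_all)
          next
            case False
            then have g: "3 \<le> td a b" "3 \<le> td a c" using ab3 ab_ge ac_ge tdpos by linarith+
            have "4 \<le> td a b \<or> 4 \<le> td a c"
            proof (rule ccontr)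
              assume "\<not> ?thesis"
              then have "td a b = 3" "td a c = 3" using g by auto
              then show False using parity True by simp
            qed
            then have "\<bar>M a c\<bar> + \<bar>M a b\<bar> \<le> 863 / 10000 + 750 / 10000"
              using ac(4,5) ab(4,5) g by linarith
            then show False using bc(2) tdpos by (intro generic) argo
          qed
        qed
      next
        case bc_ge: False
        have ge2: "2 \<le> td a b" "2 \<le> td b c" "2 \<le> td a c" using ab_ge ac_ge bc_ge tdpos by linarith+
        show False
        proof (cases "td a b = 2 \<and> td b c = 2 \<and> td a c = 2")
          case True
          have "False" if g: "dep b < dep a" "par (par a) = b"
          proof -
            have "par (par a) = c" using ac2 True g ord by auto
            then show False using g ne by simp
          qed
          then have s: "dep b = dep a" "par a = par b" using ab2 True by auto
          show False
          proof (cases "dep c = dep b \<and> par b = par c")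
            case True
            have z0: "w (par a) = 0" by (rule un') (use s(1) True pa(1) in linarith)+
            show False
            proof (rule no_triple_fork[OF _ pa(1) refl _ s(2)[symmetric] _ _ ne z0 w])
              show "N \<le> dep (par a)" using pa(1) far3(1) by linarith
              show "w i = 0" if "dep i < dep (par a)" for i by (rule un') (use that s(1) True pa(1) in linarith)+
            qed (use s True pa in \<open>metis\<close>)+
          next
            case False
            then have g: "dep c < dep b" "par (par b) = c" using bc2 \<open>td a b = 2 \<and> td b c = 2 \<and> td a c = 2\<close> by auto
            have z0: "w (par b) = 0"
              by (rule un') (use s(1) g(1) pa(2) ppa(2)[unfolded g(2)] in linarith)+
            show False
            proof (rule no_fork_above[OF le(3) _ g(2) _ s(2) pa(2) refl ne(1) w(3) z0 w(1,2)])
              show "dep (par b) = Suc (dep c)" using ppa(2) unfolding g(2) .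
              show "dep a = Suc (dep (par b))" using pa(1) unfolding s(2) .
            qed (rule w0)
          qed
        next
          case False
          have "(3 \<le> td a b \<and> 3 \<le> td b c) \<or> (3 \<le> td a b \<and> 3 \<le> td a c) \<or> (3 \<le> td b c \<and> 3 \<le> td a c)
            \<or> 4 \<le> td a b \<or> 4 \<le> td b c \<or> 4 \<le> td a c"
          proof (rule ccontr)
            assume "\<not> ?thesis"
            then have "td a b \<in> {2, 3}" "td b c \<in> {2, 3}" "td a c \<in> {2, 3}"
              "\<not> (td a b = 3 \<and> td b c = 3)" "\<not> (td a b = 3 \<and> td a c = 3)" "\<not> (td b c = 3 \<and> td a c = 3)"
              using ge2 by auto
            then show False using False parity by auto
          qed
          then show False
            using ab(3-5) bc(3-5) ac(3-5) ge2 by (intro generic) argo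
        qed
      qed
    qed
  qed
qed

end

lemma mult_le_of_abs: "\<bar>y\<bar> * \<bar>z\<bar> \<le> B \<Longrightarrow> y * z \<le> (B :: real)"
  by (metis abs_ge_self abs_mult order_trans)

text \<open>Signs are invisible modulo 2 and \<open>d\<close> is odd, so the two sums have different
  parity; within {-1, 0, 1} exactly one of them is nonzero.\<close>

lemma twin_parity:
  fixes x y :: real
  assumes "x \<in> {-1, 0, 1}" "y \<in> {-1, 0, 1}" "X = x \<or> X = - x" "Y = y \<or> Y = - y" "d \<in> {-1, 1}"
    and "x + y \<in> {-1, 0, 1}" "d + X + Y \<in> {-1, 0, 1}"
  shows "x + y \<in> {-1, 1} \<and> d + X + Y = 0 \<or> x + y = 0 \<and> d + X + Y \<in> {-1, 1}"
  using assms by auto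

section \<open>Consistency of the potential with every represented vertex\<close>

context rooted_frame
begin

lemma w_cases: "w i \<in> {-1, 0, 1} \<or> 4 \<le> (w i)\<^sup>2"
proof -
  obtain n :: int where n: "w i = of_int n" using w_Ints[of i] by (auto elim: Ints_cases)
  show ?thesis
  proof (cases "\<bar>n\<bar> \<le> 1")
    case True
    then have "n = -1 \<or> n = 0 \<or> n = 1" by linarith
    then show ?thesis unfolding n by auto
  next
    case False
    then have "2\<^sup>2 \<le> \<bar>n\<bar>\<^sup>2" by (intro power_mono) auto
    then have "4 \<le> n\<^sup>2" by simp
    then have "(4 :: real) \<le> (of_int n)\<^sup>2" by (metis of_int_le_iff of_int_numeral of_int_power)
    then show ?thesis unfolding n by simp
  qed
qed

lemma lowest_exists: "finite A \<Longrightarrow> A \<noteq> {} \<Longrightarrow> \<exists>c\<in>A. \<forall>m\<in>A. dep c \<le> dep m"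
  using arg_min_if_finite[of A dep] by (metis not_le)

lemma finite_marks: "finite {i. w i \<noteq> 0}"
  by (rule finite_subset[OF _ finI]) (auto intro: w_I)

text \<open>Choosing the three lowest marks one by one guarantees that every other mark is at least
  as deep, as the energy estimates require.\<close>

lemma few_marks:
  shows "card {i. w i \<noteq> 0} \<le> 2" "w i \<in> {-1, 0, 1}"
proof -
  let ?S = "{i. w i \<noteq> 0}"
  have fin: "finite ?S" by (rule finite_marks)
  have sq: "0 \<le> (w i)\<^sup>2" for i by simp
  show card2: "card ?S \<le> 2"
  proof (rule ccontr)
    assume "\<not> card ?S \<le> 2"
    then have c3: "3 \<le> card ?S" by simp
    have "?S \<noteq> {}" using c3 by (metis card.empty not_numeral_le_zero)
    then obtain c where c: "c \<in> ?S" "\<And>m. m \<in> ?S \<Longrightarrow> dep c \<le> dep m" using lowest_exists[OF fin] by blast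
    have "card (?S - {c}) \<ge> 2" using c3 c fin by simp
    then have "?S - {c} \<noteq> {}" by (metis card.empty not_numeral_le_zero)
    then obtain b where b: "b \<in> ?S - {c}" "\<And>m. m \<in> ?S - {c} \<Longrightarrow> dep b \<le> dep m"
      using lowest_exists[of "?S - {c}"] fin by blast
    have "card (?S - {c} - {b}) \<ge> 1" using \<open>card (?S - {c}) \<ge> 2\<close> b fin by simp
    then have "?S - {c} - {b} \<noteq> {}" by (metis card.empty not_one_le_zero)
    then obtain a where a: "a \<in> ?S - {c} - {b}" "\<And>m. m \<in> ?S - {c} - {b} \<Longrightarrow> dep a \<le> dep m"
      using lowest_exists[of "?S - {c} - {b}"] fin by blast
    have ne: "a \<noteq> b" "a \<noteq> c" "b \<noteq> c" using a(1) b(1) by auto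
    have ord: "dep b \<le> dep a" "dep c \<le> dep b" using a(1) b c by auto
    have low: "dep a \<le> dep m" if "w m \<noteq> 0" "m \<noteq> b" "m \<noteq> c" for m using a(2)[of m] that by auto
    show False
    proof (cases "4 \<le> (w a)\<^sup>2 \<or> 4 \<le> (w b)\<^sup>2 \<or> 4 \<le> (w c)\<^sup>2")
      case True
      show False
      proof (rule no_heavy_marks[of "{a, b, c}"])
        show "4 \<le> (\<Sum>i\<in>{a, b, c}. (w i)\<^sup>2)" 
        proof -
          have "(\<Sum>i\<in>{a, b, c}. (w i)\<^sup>2) = (w a)\<^sup>2 + ((w b)\<^sup>2 + (w c)\<^sup>2)" using ne by simp
          then show ?thesis using True sq[of a] sq[of b] sq[of c] by linarith
        qed
        show "card {a, b, c} \<le> 3" using ne by simp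
        fix i m assume "i \<in> {a, b, c}" "m \<notin> {a, b, c}" "w m \<noteq> 0"
        then show "dep i \<le> dep m" using low[of m] ord by auto
      qed (use a(1) b(1) c(1) in auto)
    next
      case False
      then have "w a \<in> {-1, 1}" "w b \<in> {-1, 1}" "w c \<in> {-1, 1}"
        using w_cases[of a] w_cases[of b] w_cases[of c] a(1) b(1) c(1) by auto
      then show False using no_three_marks[OF _ _ _ ne ord low] by blast
    qed
  qed
  show "w i \<in> {-1, 0, 1}"
  proof (rule ccontr)
    assume *: "w i \<notin> {-1, 0, 1}"
    then have i: "i \<in> ?S" "4 \<le> (w i)\<^sup>2" using w_cases[of i] by auto
    show False
    proof (rule no_heavy_marks[OF fin])
      have "(w i)\<^sup>2 \<le> (\<Sum>i\<in>?S. (w i)\<^sup>2)" using i fin by (intro member_le_sum) auto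
      then show "4 \<le> (\<Sum>i\<in>?S. (w i)\<^sup>2)" using i by linarith
    qed (use card2 in auto)
  qed
qed

text \<open>A value of size \<open>\<tau>\<close> on \<open>e\<close>, with sign against the defect
  \<open>d\<close>, gains \<open>2 * \<tau> * \<bar>d\<bar>\<close>. Its charges at \<open>i\<close>
  and \<open>j\<close> are routed together with the marks, and all signs are discarded.\<close>

lemma inconsistent_energy:
  assumes e: "e \<in> H" "\<And>m. 0 < dep m \<Longrightarrow> e \<noteq> pe m" "r e = (\<lambda>x. a * delta i x + b * delta j x)"
      "a \<in> {-1, 1}" "b \<in> {-1, 1}"
    and ij: "i \<in> I" "j \<in> I" "i \<noteq> j" "0 < dep i"
    and K: "K = {m. w m \<noteq> 0}" and d: "d = f e - (\<Sum>m\<in>I. w m * r e m)" and \<tau>: "0 \<le> \<tau>"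
  shows "0 \<le> l - real (card K) + (\<Sum>x\<in>K. \<Sum>y\<in>K. \<bar>M x y\<bar>) + 2 * \<tau> * (\<Sum>x\<in>K. \<bar>M x i\<bar> + \<bar>M x j\<bar>)
    + \<tau>\<^sup>2 * (\<bar>M i i\<bar> + \<bar>M j j\<bar> + 2 * \<bar>M i j\<bar>) + \<epsilon> * \<tau>\<^sup>2 - 2 * \<tau> * \<bar>d\<bar>"
proof -
  define y where "y = - sgn d * \<tau>"
  define S where "S = K \<union> {i, j}"
  define \<kappa> where "\<kappa> = (\<lambda>m. w m + y * r e m)"
  have finK: "finite K" unfolding K by (rule finite_marks)
  have KI: "K \<subseteq> I" unfolding K by (auto intro: w_I)
  have w1: "\<bar>w x\<bar> = 1" "(w x)\<^sup>2 = 1" if "x \<in> K" for x using few_marks(2)[of x] that K by auto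
  have y: "\<bar>y\<bar> \<le> \<tau>" "y\<^sup>2 \<le> \<tau>\<^sup>2" "y * d = - (\<tau> * \<bar>d\<bar>)"
    using \<tau> by (auto simp: y_def sgn_if abs_mult power_mult_distrib)
  have E: "0 \<le> l - (\<Sum>i\<in>S. (w i)\<^sup>2) + (\<Sum>i\<in>S. \<Sum>j\<in>S. \<kappa> i * \<kappa> j * M i j) + \<epsilon> * y\<^sup>2
    + 2 * y * (f e - (\<Sum>i\<in>I. w i * r e i))"
  proof (rule charge_energy[OF _ _ ij(4) e(1)])
    show "(\<forall>m. 0 < dep m \<longrightarrow> e \<noteq> pe m) \<and> (\<forall>m\<in>I. r e m \<noteq> 0 \<longrightarrow> m \<in> S)"
      using e(2) by (auto simp: e(3) S_def delta_def split: if_splits)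
    show "\<kappa> m = w m + y * r e m" for m by (simp add: \<kappa>_def)
    show "dep x \<le> dep m" if "x \<in> S" "m \<notin> S" "w m \<noteq> 0" for x m using that by (simp add: S_def K)
  qed (use finK KI ij in \<open>auto simp: S_def\<close>)
  have split: "(\<Sum>m\<in>S. \<kappa> m * g m) = (\<Sum>m\<in>K. w m * g m) + y * (a * g i + b * g j)" for g
  proof -
    have "(\<Sum>m\<in>S. \<kappa> m * g m) = (\<Sum>m\<in>S. w m * g m) + y * (\<Sum>m\<in>S. r e m * g m)"
      by (simp add: \<kappa>_def sum.distrib sum_distrib_left algebra_simps)
    also have "(\<Sum>m\<in>S. w m * g m) = (\<Sum>m\<in>K. w m * g m)"
      using finK by (intro sum.mono_neutral_right) (auto simp: S_def K)
    also have "(\<Sum>m\<in>S. r e m * g m) = (\<Sum>m\<in>S. a * (delta i m * g m) + b * (delta j m * g m))"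
      unfolding e(3) by (intro sum.cong) (simp_all add: algebra_simps)
    also have "\<dots> = a * g i + b * g j"
      using finK by (simp add: sum.distrib sum_delta S_def flip: sum_distrib_left)
    finally show ?thesis .
  qed
  have "(\<Sum>m\<in>S. (w m)\<^sup>2) = (\<Sum>m\<in>K. (w m)\<^sup>2)"
    using finK by (intro sum.mono_neutral_right) (auto simp: S_def K)
  also have "\<dots> = real (card K)" using w1 by simp
  finally have n: "(\<Sum>m\<in>S. (w m)\<^sup>2) = real (card K)" .
  have A: "\<bar>\<Sum>x\<in>K. w x * M m x\<bar> \<le> (\<Sum>x\<in>K. \<bar>M x m\<bar>)" for m
  proof -
    have "\<bar>\<Sum>x\<in>K. w x * M m x\<bar> \<le> (\<Sum>x\<in>K. \<bar>w x * M m x\<bar>)" by (rule sum_abs)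
    also have "\<dots> = (\<Sum>x\<in>K. \<bar>M x m\<bar>)" using w1 by (intro sum.cong) (auto simp: abs_mult M_commute)
    finally show ?thesis .
  qed
  have aa: "a * a = 1" "b * b = 1" "\<bar>a\<bar> = 1" "\<bar>b\<bar> = 1" using e(4,5) by auto
  have "(\<Sum>x\<in>S. \<Sum>z\<in>S. \<kappa> x * \<kappa> z * M x z) = (\<Sum>x\<in>S. \<kappa> x * (\<Sum>z\<in>S. \<kappa> z * M x z))"
    by (simp add: sum_distrib_left mult.assoc)
  also have "\<dots> = (\<Sum>x\<in>K. w x * (\<Sum>z\<in>K. w z * M x z)) + y * (\<Sum>x\<in>K. w x * (a * M x i + b * M x j))
     + y * (a * (\<Sum>x\<in>K. w x * M i x) + b * (\<Sum>x\<in>K. w x * M j x))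
     + y\<^sup>2 * (a * (a * M i i + b * M i j) + b * (a * M j i + b * M j j))"
    unfolding split by (simp add: distrib_left sum.distrib sum_distrib_left power2_eq_square mult_ac)
  finally have T0: "(\<Sum>x\<in>S. \<Sum>z\<in>S. \<kappa> x * \<kappa> z * M x z) = (\<Sum>x\<in>K. w x * (\<Sum>z\<in>K. w z * M x z)) + y * (\<Sum>x\<in>K. w x * (a * M x i + b * M x j))
     + y * (a * (\<Sum>x\<in>K. w x * M i x) + b * (\<Sum>x\<in>K. w x * M j x))
     + y\<^sup>2 * (a * (a * M i i + b * M i j) + b * (a * M j i + b * M j j))" .
  have T4: "(\<Sum>x\<in>K. w x * (\<Sum>z\<in>K. w z * M x z)) \<le> (\<Sum>x\<in>K. \<Sum>z\<in>K. \<bar>M x z\<bar>)"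
  proof (rule sum_mono)
    fix x assume "x \<in> K"
    have "w x * (\<Sum>z\<in>K. w z * M x z) \<le> \<bar>w x\<bar> * \<bar>\<Sum>z\<in>K. w z * M x z\<bar>" by (metis abs_ge_self abs_mult)
    also have "\<dots> \<le> 1 * (\<Sum>z\<in>K. \<bar>M z x\<bar>)" using w1[OF \<open>x \<in> K\<close>] A[of x] by simp
    finally show "w x * (\<Sum>z\<in>K. w z * M x z) \<le> (\<Sum>z\<in>K. \<bar>M x z\<bar>)" by (simp add: M_commute[of x])
  qed
  have T1: "y * (\<Sum>x\<in>K. w x * (a * M x i + b * M x j)) \<le> \<tau> * (\<Sum>x\<in>K. \<bar>M x i\<bar> + \<bar>M x j\<bar>)"
  proof -
    have "\<bar>\<Sum>x\<in>K. w x * (a * M x i + b * M x j)\<bar> \<le> (\<Sum>x\<in>K. \<bar>w x * (a * M x i + b * M x j)\<bar>)" by (rule sum_abs)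
    also have "\<dots> \<le> (\<Sum>x\<in>K. \<bar>M x i\<bar> + \<bar>M x j\<bar>)"
    proof (rule sum_mono)
      fix x assume "x \<in> K"
      have "\<bar>a * M x i + b * M x j\<bar> \<le> \<bar>a * M x i\<bar> + \<bar>b * M x j\<bar>" by (rule abs_triangle_ineq)
      then show "\<bar>w x * (a * M x i + b * M x j)\<bar> \<le> \<bar>M x i\<bar> + \<bar>M x j\<bar>"
        using w1[OF \<open>x \<in> K\<close>] aa by (simp add: abs_mult)
    qed
    finally have "\<bar>y\<bar> * \<bar>\<Sum>x\<in>K. w x * (a * M x i + b * M x j)\<bar> \<le> \<tau> * (\<Sum>x\<in>K. \<bar>M x i\<bar> + \<bar>M x j\<bar>)"
      using y \<tau> by (intro mult_mono) auto
    then show ?thesis by (rule mult_le_of_abs)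
  qed
  have T2: "y * (a * (\<Sum>x\<in>K. w x * M i x) + b * (\<Sum>x\<in>K. w x * M j x)) \<le> \<tau> * (\<Sum>x\<in>K. \<bar>M x i\<bar> + \<bar>M x j\<bar>)"
  proof -
    have "\<bar>a * (\<Sum>x\<in>K. w x * M i x) + b * (\<Sum>x\<in>K. w x * M j x)\<bar> \<le>
        \<bar>a * (\<Sum>x\<in>K. w x * M i x)\<bar> + \<bar>b * (\<Sum>x\<in>K. w x * M j x)\<bar>" by (rule abs_triangle_ineq)
    also have "\<dots> \<le> (\<Sum>x\<in>K. \<bar>M x i\<bar> + \<bar>M x j\<bar>)"
      using A[of i] A[of j] aa by (simp add: abs_mult sum.distrib)
    finally have "\<bar>y\<bar> * \<bar>a * (\<Sum>x\<in>K. w x * M i x) + b * (\<Sum>x\<in>K. w x * M j x)\<bar> \<le> \<tau> * (\<Sum>x\<in>K. \<bar>M x i\<bar> + \<bar>M x j\<bar>)"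
      using y \<tau> by (intro mult_mono) auto
    then show ?thesis by (rule mult_le_of_abs)
  qed
  have T3: "y\<^sup>2 * (a * (a * M i i + b * M i j) + b * (a * M j i + b * M j j))
      \<le> \<tau>\<^sup>2 * (\<bar>M i i\<bar> + \<bar>M j j\<bar> + 2 * \<bar>M i j\<bar>)"
  proof -
    let ?B = "\<bar>M i i\<bar> + \<bar>M j j\<bar> + 2 * \<bar>M i j\<bar>"
    have "a * (a * M i i + b * M i j) + b * (a * M j i + b * M j j) = M i i + M j j + 2 * (a * b * M i j)"
      using e(4,5) by (auto simp: M_commute[of j i])
    also have "\<dots> \<le> ?B"
    proof -
      have "a * b * M i j \<le> \<bar>M i j\<bar>" using e(4,5) by auto
      then show ?thesis by linarith
    qed
    finally have "y\<^sup>2 * (a * (a * M i i + b * M i j) + b * (a * M j i + b * M j j)) \<le> y\<^sup>2 * ?B"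
      by (intro mult_left_mono) auto
    also have "\<dots> \<le> \<tau>\<^sup>2 * ?B" using y(2) by (intro mult_right_mono) auto
    finally show ?thesis .
  qed
  have B: "(\<Sum>x\<in>S. \<Sum>z\<in>S. \<kappa> x * \<kappa> z * M x z) \<le> (\<Sum>x\<in>K. \<Sum>y\<in>K. \<bar>M x y\<bar>)
     + \<tau> * (\<Sum>x\<in>K. \<bar>M x i\<bar> + \<bar>M x j\<bar>) + \<tau> * (\<Sum>x\<in>K. \<bar>M x i\<bar> + \<bar>M x j\<bar>)
     + \<tau>\<^sup>2 * (\<bar>M i i\<bar> + \<bar>M j j\<bar> + 2 * \<bar>M i j\<bar>)"
    using T0 T1 T2 T3 T4 by linarith
  have "\<epsilon> * y\<^sup>2 \<le> \<epsilon> * \<tau>\<^sup>2" using y eps_nonneg by (intro mult_left_mono) auto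
  moreover have "2 * y * (f e - (\<Sum>i\<in>I. w i * r e i)) = - 2 * \<tau> * \<bar>d\<bar>" using y(3) unfolding d by simp
  ultimately show ?thesis using E B unfolding n by simp
qed

text \<open>Tree edges satisfy the equation by the definition of \<open>w\<close>. For any other
  \<open>e\<close> the energy is negative, unless the defect has absolute value 1 and the ends of
  \<open>e\<close> are adjacent in the tree and carry all marks. Then \<open>e\<close> is a twin of
  a tree edge, and \<open>no_twins\<close> applies.\<close>

lemma consistent:
  assumes e: "e \<in> H"
  shows "f e = (\<Sum>m\<in>I. w m * r e m)"
proof (rule ccontr)
  assume neq: "f e \<noteq> (\<Sum>m\<in>I. w m * r e m)"
  define d where "d = f e - (\<Sum>m\<in>I. w m * r e m)"
  have d0: "d \<noteq> 0" using neq by (simp add: d_def)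
  have e_pe: "e \<noteq> pe m" if "0 < dep m" for m using inner_tree_edge[OF that] neq by metis
  obtain i0 j0 a0 b0 where ij0: "i0 \<in> I" "j0 \<in> I" "i0 \<noteq> j0" "a0 \<in> {-1, 1}" "b0 \<in> {-1, 1}"
      "r e = (\<lambda>x. a0 * delta i0 x + b0 * delta j0 x)"
    using edge[OF e] by blast
  obtain i j a b where ij: "i \<in> I" "j \<in> I" "i \<noteq> j" "a \<in> {-1, 1}" "b \<in> {-1, 1}" "dep j \<le> dep i"
      and re: "r e = (\<lambda>x. a * delta i x + b * delta j x)"
  proof (cases "dep j0 \<le> dep i0")
    case True then show thesis using ij0 by (intro that[of i0 j0 a0 b0]) auto
  next
    case False then show thesis using ij0 by (intro that[of j0 i0 b0 a0]) (auto simp: add.commute)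
  qed
  have "(\<Sum>m\<in>I. w m * r e m) = (\<Sum>m\<in>I. delta i m * (a * w m) + delta j m * (b * w m))"
    unfolding re by (intro sum.cong) (simp_all add: algebra_simps)
  also have "\<dots> = a * w i + b * w j" using finI ij by (simp add: sum.distrib sum_delta)
  finally have dd: "d = f e - (a * w i + b * w j)" by (simp add: d_def)
  have rnz: "r e i \<noteq> 0" "r e j \<noteq> 0" using ij by (auto simp: re)
  have Nj: "N \<le> dep j"
  proof -
    have "f e \<noteq> 0 \<or> w i \<noteq> 0 \<or> w j \<noteq> 0" using d0 dd by auto
    then show ?thesis using far[OF e _ rnz(2)] w_far[of i] w_far[of j] bfs[OF e rnz] by linarith
  qed
  then have Ni: "N \<le> dep i" using ij by simp
  have pos: "0 < dep i" "0 < dep j" using Ni Nj N_pos by auto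
  have wv: "w m \<in> {-1, 0, 1}" for m by (rule few_marks(2))
  have "d \<in> \<int>" unfolding dd using f_values[OF e] ij(4,5) w_Ints[of i] w_Ints[of j]
    by (intro Ints_diff Ints_add Ints_mult) auto
  then obtain n where n: "d = of_int n" by (auto elim: Ints_cases)
  have d1: "1 \<le> \<bar>d\<bar>" using d0 unfolding n by simp
  have d12: "d \<in> {-1, 1} \<or> 2 \<le> \<bar>d\<bar>"
  proof (cases "\<bar>n\<bar> = 1")
    case True then show ?thesis unfolding n by auto
  next
    case False
    then have "2 \<le> \<bar>n\<bar>" using d0 unfolding n of_int_eq_0_iff by linarith
    then show ?thesis unfolding n by linarith
  qed
  define K where "K = {m. w m \<noteq> 0}"
  have finK: "finite K" unfolding K_def by (rule finite_marks)
  have KN: "N \<le> dep x" "x \<in> I" if "x \<in> K" for x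
    using w_far[of x] w_I[of x] that by (auto simp: K_def)
  note energy = inconsistent_energy[OF e e_pe re ij(4,5) ij(1,2,3) pos(1) K_def d_def]
  have Mij: "\<bar>M i i\<bar> \<le> 1313 / 10000" "\<bar>M j j\<bar> \<le> 1313 / 10000" "\<bar>M i j\<bar> \<le> 1142 / 10000"
      "2 \<le> td i j \<Longrightarrow> \<bar>M i j\<bar> \<le> 993 / 10000"
    using M_le(1)[OF Ni Ni] M_le(1)[OF Nj Nj] M_le(2,3)[OF Ni Nj] td_eq_0[of i j] ij(3) by auto
  have td1: "1 \<le> td x y" if "x \<noteq> y" for x y using td_eq_0[of x y] that by linarith
  define B where "B = (\<lambda>x. \<bar>M x i\<bar> + \<bar>M x j\<bar>)"
  have B1: "B x \<le> 2455 / 10000" if "x \<in> K" for x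
    using M_le(1,2)[OF KN(1)[OF that] Ni] M_le(1,2)[OF KN(1)[OF that] Nj] td1[of x i] td1[of x j] ij(3)
    unfolding B_def by (cases "x = i") auto
  have B2: "B x \<le> 2306 / 10000" if "x \<in> K" "2 \<le> td i j" for x
  proof -
    consider "x = i" | "x = j" | "x \<noteq> i" "x \<noteq> j" by blast
    then show ?thesis
    proof cases
      case 3
      then show ?thesis using M_le(2)[OF KN(1)[OF that(1)] Ni] M_le(2)[OF KN(1)[OF that(1)] Nj] td1[of x i] td1[of x j]
        unfolding B_def by linarith
    qed (use Mij that(2) in \<open>simp_all add: B_def M_commute[of j i]\<close>)
  qed
  \<comment> \<open>By parity, a mark off an adjacent pair cannot be at distance 1 from both of its
    ends.\<close>
  have B3: "B x \<le> 2135 / 10000" if x: "x \<in> K" "x \<noteq> i" "x \<noteq> j" "td i j = 1" for x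
  proof -
    have "even (td i j + dep i + dep j)" "even (td x i + dep x + dep i)" "even (td x j + dep x + dep j)"
      using td_even ij KN(2)[OF x(1)] by auto
    then have "odd (td x i + td x j)" using x(4) by (auto simp: even_add)
    then have "\<not> (td x i = 1 \<and> td x j = 1)" by auto
    then have "2 \<le> td x i \<or> 2 \<le> td x j" using td1[OF x(2)] td1[OF x(3)] by linarith
    then show ?thesis
      using M_le(2,3)[OF KN(1)[OF x(1)] Ni] M_le(2,3)[OF KN(1)[OF x(1)] Nj] td1[OF x(2)] td1[OF x(3)]
      unfolding B_def by linarith
  qed
  \<comment> \<open>The size of the value on \<open>e\<close> is 2, 3 / 2 or 1 for no, one or two
    marks: every mark adds mixed terms and makes a large value more expensive.\<close>
  have main: "2 \<le> \<bar>d\<bar> \<or> td i j \<noteq> 1 \<or> \<not> K \<subseteq> {i, j} \<Longrightarrow> False"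
  proof -
    assume cond: "2 \<le> \<bar>d\<bar> \<or> td i j \<noteq> 1 \<or> \<not> K \<subseteq> {i, j}"
    have td2: "2 \<le> td i j" if "td i j \<noteq> 1" using td1[OF ij(3)] that by linarith
    have "card K \<le> 2" using few_marks(1) by (simp add: K_def)
    then consider "card K = 0" | "card K = 1" | "card K = 2" by linarith
    then show False
    proof cases
      case 1
      then have K: "K = {}" using finK by simp
      then have "d \<in> {-1, 0, 1}" using dd f_values[OF e] by (auto simp: K_def)
      then have "td i j \<noteq> 1" using cond K by auto
      then have "\<bar>M i j\<bar> \<le> 993 / 10000" using Mij td2 by simp
      then show False using energy[of 2] d1 Mij(1,2) numeric_bounds l_ub unfolding K by (simp add: power2_eq_square)
    next
      case 2
      then obtain x where K: "K = {x}" by (auto simp: card_1_singleton_iff)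
      have E: "0 \<le> l - 1 + \<bar>M x x\<bar> + 3 * B x + 9 / 4 * (\<bar>M i i\<bar> + \<bar>M j j\<bar> + 2 * \<bar>M i j\<bar>) + \<epsilon> * (9 / 4) - 3 * \<bar>d\<bar>"
        using energy[of "3 / 2"] unfolding K B_def by (simp add: power2_eq_square)
      have xx: "\<bar>M x x\<bar> \<le> 1313 / 10000" using M_le(1) KN K by simp
      have xK: "x \<in> K" using K by simp
      have "2 \<le> \<bar>d\<bar> \<or> 2 \<le> td i j \<or> td i j = 1 \<and> x \<noteq> i \<and> x \<noteq> j" using cond K td2 by auto
      then show False
      proof (elim disjE conjE)
        assume "2 \<le> \<bar>d\<bar>"
        then show False using E xx B1[OF xK] Mij(1-3) numeric_bounds(3) l_ub by argo
      next
        assume g: "2 \<le> td i j"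
        then show False using E xx B2[OF xK g] Mij(1,2) Mij(4)[OF g] d1 numeric_bounds(3) l_ub by argo
      next
        assume g: "td i j = 1" "x \<noteq> i" "x \<noteq> j"
        then show False using E xx B3[OF xK g(2,3,1)] Mij(1-3) d1 numeric_bounds(3) l_ub by argo
      qed
    next
      case 3
      then obtain x y where K: "K = {x, y}" "x \<noteq> y" by (auto simp: card_2_iff)
      have E: "0 \<le> l - 2 + (\<bar>M x x\<bar> + \<bar>M y y\<bar> + 2 * \<bar>M x y\<bar>) + 2 * (B x + B y)
          + (\<bar>M i i\<bar> + \<bar>M j j\<bar> + 2 * \<bar>M i j\<bar>) + \<epsilon> - 2 * \<bar>d\<bar>"
        using energy[of 1] K(2) unfolding K(1) B_def by (simp add: M_commute[of y x])
      have xx: "\<bar>M x x\<bar> \<le> 1313 / 10000" "\<bar>M y y\<bar> \<le> 1313 / 10000" "\<bar>M x y\<bar> \<le> 1142 / 10000"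
        using M_le(1,2) KN td1 K by auto
      have xyK: "x \<in> K" "y \<in> K" using K by auto
      have Bxy: "B x \<le> 2455 / 10000" "B y \<le> 2455 / 10000" using B1 K by auto
      have "2 \<le> \<bar>d\<bar> \<or> 2 \<le> td i j \<or> td i j = 1 \<and> (x \<noteq> i \<and> x \<noteq> j \<or> y \<noteq> i \<and> y \<noteq> j)" using cond K td2 by auto
      then show False
      proof (elim disjE conjE)
        assume "2 \<le> \<bar>d\<bar>"
        then show False using E xx Bxy Mij(1-3) numeric_bounds l_ub by argo
      next
        assume g: "2 \<le> td i j"
        then show False using E xx B2[OF xyK(1) g] B2[OF xyK(2) g] Mij(1,2) Mij(4)[OF g] d1 numeric_bounds(3) l_ub by argo
      next
        assume "td i j = 1" "x \<noteq> i" "x \<noteq> j"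
        then have "B x \<le> 2135 / 10000" using B3 K by simp
        then show False using E xx Bxy Mij(1-3) d1 numeric_bounds l_ub by argo
      next
        assume "td i j = 1" "y \<noteq> i" "y \<noteq> j"
        then have "B y \<le> 2135 / 10000" using B3 K by simp
        then show False using E xx Bxy Mij(1-3) d1 numeric_bounds l_ub by argo
      qed
    qed
  qed
  then have t1: "td i j = 1" and Ksub: "K \<subseteq> {i, j}" and "\<not> 2 \<le> \<bar>d\<bar>" by auto
  then have d11: "d \<in> {-1, 1}" using d12 by auto
  have par: "par i = j" by (rule td_1[OF ij(6) pos(1) t1])
  have dep: "dep i = Suc (dep j)" using tree[OF pos(1)] par by simp
  show False
  proof (rule no_twins[OF Nj dep par e e_pe re ij(4,5)])
    show "w j \<in> {-1, 0, 1}" by (rule wv)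
    show "w m = 0" if "dep m < dep j" for m using that Ksub dep by (auto simp: K_def)
    have F: "f (pe i) = s i * w i + t i * w j" using w_edge[OF pos(1)] par by simp
    have G: "f e = d + a * w i + b * w j" using dd by simp
    show "f (pe i) \<in> {-1, 1} \<and> f e = 0 \<or> f (pe i) = 0 \<and> f e \<in> {-1, 1}"
      unfolding F G
    proof (rule twin_parity)
      show "s i * w i \<in> {-1, 0, 1}" "t i * w j \<in> {-1, 0, 1}" using signs[OF pos(1)] wv[of i] wv[of j] by auto
      show "a * w i = s i * w i \<or> a * w i = - (s i * w i)" "b * w j = t i * w j \<or> b * w j = - (t i * w j)"
        using signs[OF pos(1)] ij(4,5) by auto
      show "s i * w i + t i * w j \<in> {-1, 0, 1}" using f_values[of "pe i"] tree[OF pos(1)] unfolding F by simp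
      show "d + a * w i + b * w j \<in> {-1, 0, 1}" using f_values[OF e] unfolding G .
    qed (rule d11)
  qed
qed

end

section \<open>Distances in a connected relation\<close>

definition rel_on :: "('a \<Rightarrow> 'a \<Rightarrow> bool) \<Rightarrow> 'a set \<Rightarrow> ('a \<times> 'a) set" where
  "rel_on R X = {(x, y). x \<in> X \<and> y \<in> X \<and> R x y}"

text \<open>Connectedness by cuts instead of paths. Minimality yields it in this form, because a cut
  splits the quadratic form, and inserting a coordinate preserves it easily.\<close>

definition no_cut :: "('a \<Rightarrow> 'a \<Rightarrow> bool) \<Rightarrow> 'a set \<Rightarrow> bool" where
  "no_cut R X \<longleftrightarrow> (\<forall>A. A \<subseteq> X \<and> A \<noteq> {} \<and> A \<noteq> X \<longrightarrow> (\<exists>x\<in>A. \<exists>y\<in>X - A. R x y))"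

definition gdist :: "('a \<Rightarrow> 'a \<Rightarrow> bool) \<Rightarrow> 'a set \<Rightarrow> 'a \<Rightarrow> 'a \<Rightarrow> nat" where
  "gdist R X x y = (LEAST n. (x, y) \<in> rel_on R X ^^ n)"

locale connected_relation =
  fixes R :: "'a \<Rightarrow> 'a \<Rightarrow> bool" and X :: "'a set"
  assumes sym: "R x y \<Longrightarrow> R y x" and no_cut: "no_cut R X"
begin

lemma reachable:
  assumes "x \<in> X" "y \<in> X"
  shows "\<exists>n. (x, y) \<in> rel_on R X ^^ n"
proof -
  define A where "A = {y \<in> X. \<exists>n. (x, y) \<in> rel_on R X ^^ n}"
  have "(x, x) \<in> rel_on R X ^^ 0" by simp
  then have "x \<in> A" using assms unfolding A_def by blast
  have "A = X"
  proof (rule ccontr)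
    assume "A \<noteq> X"
    then obtain u v where uv: "u \<in> A" "v \<in> X - A" "R u v"
      using no_cut \<open>x \<in> A\<close> unfolding no_cut_def A_def by (metis (no_types, lifting) empty_iff mem_Collect_eq subsetI)
    then obtain n where "(x, u) \<in> rel_on R X ^^ n" by (auto simp: A_def)
    moreover have "(u, v) \<in> rel_on R X" using uv by (auto simp: A_def rel_on_def)
    ultimately have "(x, v) \<in> rel_on R X ^^ Suc n" by (rule relpow_Suc_I)
    then show False using uv unfolding A_def by blast
  qed
  then show ?thesis using assms unfolding A_def by blast
qed

lemma gdist_path: "x \<in> X \<Longrightarrow> y \<in> X \<Longrightarrow> (x, y) \<in> rel_on R X ^^ gdist R X x y"
  unfolding gdist_def using reachable by (rule LeastI_ex)

lemma gdist_le: "(x, y) \<in> rel_on R X ^^ n \<Longrightarrow> gdist R X x y \<le> n"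
  unfolding gdist_def by (rule Least_le)

lemma rel_on_sym: "sym (rel_on R X)"
  by (auto intro!: symI simp: rel_on_def sym)

lemma relpow_sym: "(x, y) \<in> rel_on R X ^^ n \<Longrightarrow> (y, x) \<in> rel_on R X ^^ n"
  by (induction n arbitrary: y)
    (auto intro: relpow_Suc_I2 symD[OF rel_on_sym] simp del: relpow.simps(2) elim!: relpow_Suc_E)

lemma gdist_commute: "gdist R X x y = gdist R X y x"
  unfolding gdist_def using relpow_sym by metis

lemma gdist_0: "x \<in> X \<Longrightarrow> y \<in> X \<Longrightarrow> gdist R X x y = 0 \<longleftrightarrow> x = y"
  using gdist_path[of x y] gdist_le[of x y 0] by auto

lemma gdist_step:
  assumes "x \<in> X" "y \<in> X" "y' \<in> X" "R y y'"
  shows "gdist R X x y' \<le> Suc (gdist R X x y)"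
proof (rule gdist_le)
  have "(y, y') \<in> rel_on R X" using assms by (simp add: rel_on_def)
  then show "(x, y') \<in> rel_on R X ^^ Suc (gdist R X x y)"
    using gdist_path[OF assms(1,2)] by (intro relpow_Suc_I)
qed

lemma gdist_pred:
  assumes "x \<in> X" "y \<in> X" "0 < gdist R X x y"
  shows "\<exists>z\<in>X. R y z \<and> gdist R X x y = Suc (gdist R X x z)"
proof -
  obtain n where n: "gdist R X x y = Suc n" using assms(3) by (metis gr0_implies_Suc)
  then have "(x, y) \<in> rel_on R X ^^ Suc n" using gdist_path[OF assms(1,2)] by simp
  then obtain z where z: "(x, z) \<in> rel_on R X ^^ n" "(z, y) \<in> rel_on R X" by (rule relpow_Suc_E)
  then have zX: "z \<in> X" "R z y" by (auto simp: rel_on_def)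
  have "gdist R X x z \<le> n" using z(1) by (rule gdist_le)
  moreover have "gdist R X x y \<le> Suc (gdist R X x z)" using gdist_step[OF assms(1) zX(1) assms(2) zX(2)] .
  ultimately show ?thesis using zX sym n by (intro bexI[of _ z]) auto
qed

lemma ball_card:
  assumes fin: "finite X" and deg: "\<And>y. y \<in> X \<Longrightarrow> card {z \<in> X. R y z} \<le> D" and x: "x \<in> X"
  shows "card {y \<in> X. gdist R X x y \<le> n} \<le> (D + 1) ^ n"
proof (induction n)
  case 0
  have "{y \<in> X. gdist R X x y \<le> 0} = {x}" using gdist_0 x by auto
  then show ?case by simp
next
  case (Suc n)
  let ?B = "{y \<in> X. gdist R X x y \<le> n}"
  have "{y \<in> X. gdist R X x y \<le> Suc n} \<subseteq> (\<Union>y\<in>?B. insert y {z \<in> X. R y z})"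
  proof
    fix y assume y: "y \<in> {y \<in> X. gdist R X x y \<le> Suc n}"
    show "y \<in> (\<Union>y\<in>?B. insert y {z \<in> X. R y z})"
    proof (cases "gdist R X x y \<le> n")
      case True then show ?thesis using y by auto
    next
      case False
      then obtain z where "z \<in> X" "R y z" "gdist R X x y = Suc (gdist R X x z)"
        using gdist_pred[OF x, of y] y by auto
      then show ?thesis using y sym by auto
    qed
  qed
  then have "card {y \<in> X. gdist R X x y \<le> Suc n} \<le> card (\<Union>y\<in>?B. insert y {z \<in> X. R y z})"
    using fin by (intro card_mono) auto
  also have "\<dots> \<le> (\<Sum>y\<in>?B. card (insert y {z \<in> X. R y z}))" using fin by (intro card_UN_le) auto
  also have "\<dots> \<le> (\<Sum>y\<in>?B. D + 1)"
  proof (rule sum_mono)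
    fix y assume "y \<in> ?B"
    then have "card {z \<in> X. R y z} \<le> D" using deg by simp
    then show "card (insert y {z \<in> X. R y z}) \<le> D + 1" using fin by (simp add: card_insert_if)
  qed
  also have "\<dots> = card ?B * (D + 1)" by simp
  also have "\<dots> \<le> (D + 1) ^ n * (D + 1)" using Suc by (intro mult_right_mono) auto
  finally show ?case by (simp add: mult.commute)
qed

lemma far_point:
  assumes fin: "finite X" and deg: "\<And>y. y \<in> X \<Longrightarrow> card {z \<in> X. R y z} \<le> D"
    and T: "T \<subseteq> X" "card T \<le> m" and large: "m * (D + 1) ^ n < card X"
  shows "\<exists>z\<in>X. \<forall>t\<in>T. n < gdist R X z t"
proof (rule ccontr)
  assume *: "\<not> ?thesis"
  have finT: "finite T" using T fin finite_subset by blast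
  have "X \<subseteq> (\<Union>t\<in>T. {y \<in> X. gdist R X t y \<le> n})"
    using * by (fastforce simp: gdist_commute not_less)
  then have "card X \<le> card (\<Union>t\<in>T. {y \<in> X. gdist R X t y \<le> n})"
    using finT fin by (intro card_mono) auto
  also have "\<dots> \<le> (\<Sum>t\<in>T. card {y \<in> X. gdist R X t y \<le> n})" by (rule card_UN_le[OF finT])
  also have "\<dots> \<le> (\<Sum>t\<in>T. (D + 1) ^ n)" using T by (intro sum_mono ball_card fin deg) auto
  also have "\<dots> = card T * (D + 1) ^ n" by simp
  also have "\<dots> \<le> m * (D + 1) ^ n" using T(2) by (rule mult_right_mono) simp
  finally show False using large by simp
qed

lemma geodesic:
  assumes "x \<in> X" "y \<in> X" "gdist R X x y = n"
  shows "\<exists>u. u n = y \<and> (\<forall>k\<le>n. u k \<in> X \<and> gdist R X x (u k) = k) \<and> (\<forall>k<n. R (u k) (u (Suc k)))"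
  using assms(2,3)
proof (induction n arbitrary: y)
  case 0
  then show ?case by (intro exI[of _ "\<lambda>_. y"]) auto
next
  case (Suc n)
  then obtain z where z: "z \<in> X" "R y z" "gdist R X x z = n" using gdist_pred[OF assms(1), of y] by auto
  then obtain u where u: "u n = z" "\<forall>k\<le>n. u k \<in> X \<and> gdist R X x (u k) = k" "\<forall>k<n. R (u k) (u (Suc k))"
    using Suc.IH by blast
  show ?case
    using u z Suc.prems sym by (intro exI[of _ "u(Suc n := y)"]) (auto simp: le_Suc_eq less_Suc_eq)
qed

end

section \<open>Representations by root vectors\<close>

definition joined :: "nat set \<Rightarrow> (nat \<Rightarrow> nat \<Rightarrow> real) \<Rightarrow> nat \<Rightarrow> nat \<Rightarrow> bool" where
  "joined H r i j \<longleftrightarrow> i \<noteq> j \<and> (\<exists>u\<in>H. r u i \<noteq> 0 \<and> r u j \<noteq> 0)"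

text \<open>Inner products are prescribed only between different vertices; the squared length is
  always 2. Two vertices may share both coordinates, so the coordinate graph is a multigraph. Its
  connectedness lets a tree with any root span \<open>I\<close>.\<close>

definition represents ::
    "(nat \<Rightarrow> nat \<Rightarrow> real) \<Rightarrow> nat set \<Rightarrow> nat set \<Rightarrow> (nat \<Rightarrow> nat \<Rightarrow> real) \<Rightarrow> bool" where
  "represents a H I r \<longleftrightarrow> finite H \<and> finite I \<and>
     (\<forall>u\<in>H. \<exists>i\<in>I. \<exists>j\<in>I. i \<noteq> j \<and> (\<exists>c\<in>{-1, 1}. \<exists>d\<in>{-1, 1}. r u = (\<lambda>x. c * delta i x + d * delta j x))) \<and>
     (\<forall>u\<in>H. \<forall>v\<in>H. u \<noteq> v \<longrightarrow> (\<Sum>i\<in>I. r u i * r v i) = a u v) \<and>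
     no_cut (joined H r) I"

lemma joined_sym: "joined H r i j \<Longrightarrow> joined H r j i"
  by (auto simp: joined_def)

lemma pair_sum:
  assumes "finite I" "i \<in> I" "j \<in> I"
  shows "(\<Sum>m\<in>I. (c * delta i m + d * delta j m) * g m) = c * g i + d * g j"
proof -
  have *: "(\<Sum>m\<in>I. c * delta i m * g m) = c * g i" if "i \<in> I" for c i
  proof -
    have "(\<Sum>m\<in>I. c * delta i m * g m) = (\<Sum>m\<in>I. if m = i then c * g m else 0)"
      by (intro sum.cong) (auto simp: delta_def)
    then show ?thesis using assms(1) that by simp
  qed
  show ?thesis using *[OF assms(2), of c] *[OF assms(3), of d] by (simp add: distrib_right sum.distrib)
qed

lemma represents_row:
  assumes "represents a H I r" "u \<in> H" "r u i \<noteq> 0"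
  obtains j c d where "i \<in> I" "j \<in> I" "i \<noteq> j" "c \<in> {-1, 1}" "d \<in> {-1, 1}"
    "r u = (\<lambda>x. c * delta i x + d * delta j x)"
proof -
  obtain i' j' c d where *: "i' \<in> I" "j' \<in> I" "i' \<noteq> j'" "c \<in> {-1, 1}" "d \<in> {-1, 1}"
      "r u = (\<lambda>x. c * delta i' x + d * delta j' x)"
    using assms(1,2) unfolding represents_def by blast
  have "i = i' \<or> i = j'" using assms(3) *(6) by (auto simp: delta_def split: if_splits)
  then show thesis
  proof
    assume "i = i'" then show thesis using * by (intro that[of j' c d]) auto
  next
    assume "i = j'" then show thesis using * by (intro that[of i' d c]) (auto simp: add.commute)
  qed
qed

lemma represents_support:
  assumes "represents a H I r" "u \<in> H"
  shows "{i. r u i \<noteq> 0} \<subseteq> I" "card {i. r u i \<noteq> 0} \<le> 2"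
proof -
  obtain i j c d where *: "i \<in> I" "j \<in> I" "r u = (\<lambda>x. c * delta i x + d * delta j x)"
    using assms unfolding represents_def by blast
  then have sub: "{i. r u i \<noteq> 0} \<subseteq> {i, j}" by (auto simp: delta_def split: if_splits)
  then show "{i. r u i \<noteq> 0} \<subseteq> I" using * by blast
  have "card {i. r u i \<noteq> 0} \<le> card {i, j}" using sub by (intro card_mono) auto
  also have "\<dots> \<le> 2" by (simp add: card_insert_if)
  finally show "card {i. r u i \<noteq> 0} \<le> 2" .
qed

text \<open>The Gram matrix of the vectors is the adjacency matrix plus twice the identity.\<close>

lemma represents_qform:
  assumes rep: "represents a H I r" and diag: "\<And>u. a u u = 0"
  shows "qform a H l x = (\<Sum>i\<in>I. (\<Sum>u\<in>H. x u * r u i)\<^sup>2) + (l - 2) * (\<Sum>u\<in>H. (x u)\<^sup>2)"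
proof -
  have fin: "finite H" "finite I" using rep by (auto simp: represents_def)
  have g: "(\<Sum>i\<in>I. r u i * r v i) = a u v + (if u = v then 2 else 0)" if uv: "u \<in> H" "v \<in> H" for u v
  proof (cases "u = v")
    case True
    obtain i j c d where r: "i \<in> I" "j \<in> I" "i \<noteq> j" "c \<in> {-1, 1}" "d \<in> {-1, 1}"
        "r u = (\<lambda>x. c * delta i x + d * delta j x)"
      using rep uv(1) unfolding represents_def by blast
    have "(\<Sum>i\<in>I. r u i * r u i) = c * r u i + d * r u j"
      using pair_sum[OF fin(2) r(1,2), of c d "r u"] r(6) by simp
    also have "\<dots> = 2" using r(3-5) unfolding r(6) by auto
    finally show ?thesis using True diag by simp
  next
    case False
    then show ?thesis using rep uv by (simp add: represents_def)
  qed
  have "(\<Sum>i\<in>I. (\<Sum>u\<in>H. x u * r u i)\<^sup>2) = (\<Sum>i\<in>I. \<Sum>u\<in>H. \<Sum>v\<in>H. x u * r u i * (x v * r v i))"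
    by (simp add: power2_eq_square sum_product)
  also have "\<dots> = (\<Sum>u\<in>H. \<Sum>i\<in>I. \<Sum>v\<in>H. x u * r u i * (x v * r v i))" by (rule sum.swap)
  also have "\<dots> = (\<Sum>u\<in>H. \<Sum>v\<in>H. \<Sum>i\<in>I. x u * r u i * (x v * r v i))"
    by (intro sum.cong refl sum.swap)
  also have "\<dots> = (\<Sum>u\<in>H. \<Sum>v\<in>H. a u v * x u * x v + (if u = v then 2 * (x u)\<^sup>2 else 0))"
  proof (intro sum.cong refl)
    fix u v assume uv: "u \<in> H" "v \<in> H"
    have "(\<Sum>i\<in>I. x u * r u i * (x v * r v i)) = (x u * x v) * (\<Sum>i\<in>I. r u i * r v i)"
      by (simp add: sum_distrib_left mult_ac)
    then show "(\<Sum>i\<in>I. x u * r u i * (x v * r v i)) = a u v * x u * x v + (if u = v then 2 * (x u)\<^sup>2 else 0)"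
      unfolding g[OF uv] by (auto simp: algebra_simps power2_eq_square)
  qed
  also have "\<dots> = (\<Sum>u\<in>H. \<Sum>v\<in>H. a u v * x u * x v) + 2 * (\<Sum>u\<in>H. (x u)\<^sup>2)"
    using fin(1) by (simp add: sum.distrib sum_distrib_left)
  finally show ?thesis unfolding qform_def by (simp add: algebra_simps)
qed

text \<open>Fix a vertex \<open>u0\<close> whose vector uses \<open>i\<close>. A vector joining
  \<open>i\<close> to a coordinate off \<open>u0\<close> meets that of \<open>u0\<close> in
  \<open>i\<close> alone, so its vertex is a neighbor of \<open>u0\<close>, and different
  coordinates give different neighbors. The second coordinate of \<open>u0\<close> accounts for the
  additional 1.\<close>

lemma represents_degree:
  assumes rep: "represents a H I r" and deg: "\<And>u. u \<in> H \<Longrightarrow> card {v \<in> H. a u v \<noteq> 0} \<le> D"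
  shows "card {j \<in> I. joined H r i j} \<le> D + 1"
proof (cases "\<exists>j. joined H r i j")
  case False
  then show ?thesis by simp
next
  case True
  have fin: "finite H" "finite I" using rep by (auto simp: represents_def)
  obtain u0 where u0: "u0 \<in> H" "r u0 i \<noteq> 0" using True by (auto simp: joined_def)
  obtain j0 c d where r0: "i \<in> I" "j0 \<in> I" "i \<noteq> j0" "c \<in> {-1, 1}" "d \<in> {-1, 1}"
      "r u0 = (\<lambda>x. c * delta i x + d * delta j0 x)"
    by (rule represents_row[OF rep u0])
  let ?J = "{j \<in> I. joined H r i j} - {j0}"
  have "\<exists>u. u \<in> H \<and> a u0 u \<noteq> 0 \<and> r u j \<noteq> 0 \<and> (\<forall>m. r u m \<noteq> 0 \<longrightarrow> m = i \<or> m = j)" if j: "j \<in> ?J" for j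
  proof -
    obtain u where u: "u \<in> H" "r u i \<noteq> 0" "r u j \<noteq> 0" "i \<noteq> j" using j by (auto simp: joined_def)
    obtain j' c' d' where r: "j' \<in> I" "i \<noteq> j'" "c' \<in> {-1, 1}" "d' \<in> {-1, 1}"
        "r u = (\<lambda>x. c' * delta i x + d' * delta j' x)"
      by (rule represents_row[OF rep u(1,2)])
    have jj: "j' = j" using u(3,4) r(5) by (auto simp: delta_def split: if_splits)
    have j0: "r u j0 = 0" using r(5) jj j r0(3) by (simp add: delta_def)
    have "u \<noteq> u0" using j0 r0(3,5,6) by auto
    have "(\<Sum>m\<in>I. r u0 m * r u m) = c * r u i + d * r u j0"
      using pair_sum[OF fin(2) r0(1,2), of c d "r u"] r0(6) by simp
    also have "\<dots> \<noteq> 0" using j0 r0(4) u(2) by auto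
    finally have "a u0 u \<noteq> 0" using rep u0 u \<open>u \<noteq> u0\<close> unfolding represents_def by metis
    then show ?thesis using u r(5) jj by (intro exI[of _ u]) (auto simp: delta_def)
  qed
  then obtain h where h: "\<And>j. j \<in> ?J \<Longrightarrow> h j \<in> H \<and> a u0 (h j) \<noteq> 0 \<and> r (h j) j \<noteq> 0 \<and>
      (\<forall>m. r (h j) m \<noteq> 0 \<longrightarrow> m = i \<or> m = j)"
    by metis
  have ij: "j \<noteq> i" if "j \<in> ?J" for j using that by (auto simp: joined_def)
  have "inj_on h ?J"
  proof (rule inj_onI)
    fix j j' assume j: "j \<in> ?J" "j' \<in> ?J" "h j = h j'"
    then have "r (h j') j \<noteq> 0" using h[OF j(1)] by simp
    then show "j = j'" using h[OF j(2)] ij[OF j(1)] by blast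
  qed
  moreover have "h ` ?J \<subseteq> {v \<in> H. a u0 v \<noteq> 0}" using h by blast
  ultimately have "card ?J \<le> card {v \<in> H. a u0 v \<noteq> 0}" using fin(1) by (intro card_inj_on_le) auto
  then have "card ?J \<le> D" using deg[OF u0(1)] by simp
  moreover have "card {j \<in> I. joined H r i j} \<le> card ?J + 1"
    using fin(2) by (cases "j0 \<in> {j \<in> I. joined H r i j}") (auto simp: card_Diff_singleton)
  ultimately show ?thesis by simp
qed

text \<open>The coordinate \<open>j\<close> may be old or new; \<open>i\<close> is old, so the new
  vector keeps the coordinate graph connected.\<close>

lemma represents_insert:
  assumes rep: "represents a H I r" and sym: "\<And>u v. a u v = a v u" and v: "v \<notin> H"
    and ij: "i \<in> I" "i \<noteq> j" and cd: "c \<in> {-1, 1}" "d \<in> {-1, 1}" and rho: "\<rho> = (\<lambda>x. c * delta i x + d * delta j x)"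
    and a: "\<And>u. u \<in> H \<Longrightarrow> a u v = (\<Sum>m\<in>insert j I. r u m * \<rho> m)"
  shows "represents a (insert v H) (insert j I) (r(v := \<rho>))"
proof -
  have fin: "finite H" "finite I" using rep by (auto simp: represents_def)
  have supp: "r u m = 0" if "u \<in> H" "m \<notin> I" for u m
    using represents_row[OF rep that(1), of m] that(2) by blast
  have "\<exists>k\<in>insert j I. \<exists>m\<in>insert j I. k \<noteq> m \<and> (\<exists>c\<in>{-1, 1}. \<exists>d\<in>{-1, 1}.
      (r(v := \<rho>)) u = (\<lambda>x. c * delta k x + d * delta m x))" if "u \<in> insert v H" for u
  proof (cases "u = v")
    case True
    then show ?thesis using ij cd rho by (intro bexI[of _ i] bexI[of _ j] conjI bexI[of _ c] bexI[of _ d]) auto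
  next
    case False
    then have "u \<in> H" using that by simp
    then obtain k m where "k \<in> I" "m \<in> I" "k \<noteq> m"
        "\<exists>c\<in>{-1, 1}. \<exists>d\<in>{-1, 1}. r u = (\<lambda>x. c * delta k x + d * delta m x)"
      using rep unfolding represents_def by meson
    then show ?thesis using False by (intro bexI[of _ k] bexI[of _ m]) auto
  qed
  moreover have "(\<Sum>m\<in>insert j I. (r(v := \<rho>)) u m * (r(v := \<rho>)) u' m) = a u u'"
    if uu: "u \<in> insert v H" "u' \<in> insert v H" "u \<noteq> u'" for u u'
  proof -
    consider "u = v" "u' \<in> H" | "u' = v" "u \<in> H" | "u \<in> H" "u' \<in> H" "u \<noteq> v" "u' \<noteq> v" using uu v by blast
    then show ?thesis
    proof cases
      case 1
      then have "u' \<noteq> v" using v by blast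
      then show ?thesis using a[of u'] 1 sym[of v u'] by (simp only: fun_upd_same fun_upd_other not_False_eq_True mult.commute)
    next
      case 2
      then have "u \<noteq> v" using v by blast
      then show ?thesis using a[of u] 2 by (simp only: fun_upd_same fun_upd_other not_False_eq_True)
    next
      case 3
      have "(\<Sum>m\<in>insert j I. r u m * r u' m) = (\<Sum>m\<in>I. r u m * r u' m)"
        using fin(2) supp[OF 3(1)] by (intro sum.mono_neutral_right) auto
      then show ?thesis using 3 uu(3) rep by (simp only: fun_upd_other not_False_eq_True) (simp add: represents_def)
    qed
  qed
  moreover have "no_cut (joined (insert v H) (r(v := \<rho>))) (insert j I)"
    unfolding no_cut_def
  proof (intro allI impI, elim conjE)
    fix A assume A: "A \<subseteq> insert j I" "A \<noteq> {}" "A \<noteq> insert j I"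
    let ?J = "joined (insert v H) (r(v := \<rho>))"
    have vij: "?J i j" unfolding joined_def using ij cd rho by auto
    show "\<exists>x\<in>A. \<exists>y\<in>insert j I - A. ?J x y"
    proof (cases "A \<inter> I = {} \<or> A \<inter> I = I")
      case True
      then have "i \<in> A \<and> j \<notin> A \<or> j \<in> A \<and> i \<notin> A" using A ij by auto
      then show ?thesis using vij joined_sym[OF vij] ij by auto
    next
      case False
      moreover have "no_cut (joined H r) I" using rep by (simp add: represents_def)
      ultimately obtain x y where xy: "x \<in> A" "x \<in> I" "y \<in> I" "y \<notin> A" "joined H r x y"
        unfolding no_cut_def by (metis DiffE IntE IntI inf_le2)
      then have "?J x y" using v unfolding joined_def by (metis fun_upd_other insertCI)
      then show ?thesis using xy by blast
    qed
  qed
  ultimately show ?thesis unfolding represents_def using fin by simp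
qed

text \<open>Distances from \<open>z\<close> in the coordinate graph give the breadth-first tree for
  \<open>rooted_frame\<close>. Its energy condition is nonnegativity after deleting a represented
  vertex where the test vector is 0.\<close>

lemma extension_vector:
  assumes rep: "represents a H I r" and sym: "\<And>u v. a u v = a v u" and diag: "\<And>u. a u u = 0"
    and vals: "\<And>u v. a u v \<in> {-1, 0, 1}" and v: "v \<notin> H"
    and q: "0.8688 < q" "q < 0.8692" "1 < q ^ 4 + q ^ 6" "l = q + 1 / q"
    and N: "0 < N" "100 * q ^ (2 * N - 1) < q ^ 4 + q ^ 6 - 1" "10000 * q ^ (2 * N - 1) < 1"
    and psd: "\<And>u. u \<in> H \<Longrightarrow> psd a (insert v (H - {u})) l"
    and z: "z \<in> I" "\<And>u i. u \<in> H \<Longrightarrow> a u v \<noteq> 0 \<Longrightarrow> r u i \<noteq> 0 \<Longrightarrow> N < gdist (joined H r) I z i"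
  shows "\<exists>w :: nat \<Rightarrow> real. (\<forall>i. w i \<in> {-1, 0, 1}) \<and> (\<forall>i. w i \<noteq> 0 \<longrightarrow> i \<in> I) \<and> card {i. w i \<noteq> 0} \<le> 2 \<and>
    (\<forall>u\<in>H. a u v = (\<Sum>m\<in>I. w m * r u m))"
proof -
  have fin: "finite H" "finite I" using rep by (auto simp: represents_def)
  have supp: "i \<in> I" if "u \<in> H" "r u i \<noteq> 0" for u i
    using represents_row[OF rep that] by blast
  interpret C: connected_relation "joined H r" I
    by unfold_locales (use rep in \<open>auto intro: joined_sym simp: represents_def\<close>)
  define dep where "dep i = (if i \<in> I then gdist (joined H r) I z i else 0)" for i
  define P where "P i p e s t \<longleftrightarrow> (0 < dep i \<longrightarrow> i \<in> I \<and> p \<in> I \<and> dep i = Suc (dep p) \<and> e \<in> H \<and>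
      r e = (\<lambda>x. s * delta i x + t * delta p x) \<and> s \<in> {-1, 1} \<and> t \<in> {-1, 1})" for i p e s t
  have "\<exists>p e s t. P i p e s t" for i
  proof (cases "0 < dep i")
    case True
    then have i: "i \<in> I" by (auto simp: dep_def split: if_splits)
    obtain p where p: "p \<in> I" "joined H r i p" "gdist (joined H r) I z i = Suc (gdist (joined H r) I z p)"
      using C.gdist_pred[OF z(1) i] True i by (auto simp: dep_def)
    obtain e where e: "e \<in> H" "r e i \<noteq> 0" "r e p \<noteq> 0" "i \<noteq> p" using p(2) by (auto simp: joined_def)
    obtain p' s t where r: "i \<noteq> p'" "s \<in> {-1, 1}" "t \<in> {-1, 1}" "r e = (\<lambda>x. s * delta i x + t * delta p' x)"
      by (rule represents_row[OF rep e(1,2)])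
    have "p' = p" using e(3,4) r(4) by (auto simp: delta_def split: if_splits)
    then show ?thesis using i p e r by (intro exI[of _ p] exI[of _ e] exI[of _ s] exI[of _ t]) (auto simp: dep_def P_def)
  qed (simp add: P_def)
  then obtain par pe s t where "\<And>i. P i (par i) (pe i) (s i) (t i)" by metis
  then have T: "i \<in> I \<and> par i \<in> I \<and> dep i = Suc (dep (par i)) \<and> pe i \<in> H \<and>
      r (pe i) = (\<lambda>x. s i * delta i x + t i * delta (par i) x) \<and> s i \<in> {-1, 1} \<and> t i \<in> {-1, 1}"
    if "0 < dep i" for i using that unfolding P_def by blast
  interpret F: rooted_frame H I r "\<lambda>u. a u v" q l dep par pe s t N
  proof
    show "i = j" if "i \<in> I" "j \<in> I" "dep i = 0" "dep j = 0" for i j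
      using that C.gdist_0[OF z(1), of i] C.gdist_0[OF z(1), of j] by (simp add: dep_def)
    show "\<exists>i\<in>I. \<exists>j\<in>I. i \<noteq> j \<and> (\<exists>a\<in>{-1, 1}. \<exists>b\<in>{-1, 1}. r u = (\<lambda>x. a * delta i x + b * delta j x))"
      if "u \<in> H" for u using rep that unfolding represents_def by blast
    show "dep i \<le> Suc (dep j)" if u: "u \<in> H" "r u i \<noteq> 0" "r u j \<noteq> 0" for u i j
    proof (cases "i = j")
      case False
      then have "joined H r j i" using u by (auto simp: joined_def)
      then show ?thesis using C.gdist_step[OF z(1), of j i] supp u by (simp add: dep_def)
    qed simp
    show "N < dep i" if "u \<in> H" "a u v \<noteq> 0" "r u i \<noteq> 0" for u i
      using z(2)[OF that] supp that by (simp add: dep_def)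
    show "(\<Sum>i\<in>I. r u i * r u' i) \<in> {-1, 0, 1}" if "u \<in> H" "u' \<in> H" "u \<noteq> u'" for u u'
      using rep that vals by (simp add: represents_def)
    show "0 \<le> l + 2 * (\<Sum>u\<in>H. x u * a u v) + (\<Sum>i\<in>I. (\<Sum>u\<in>H. x u * r u i)\<^sup>2) + (l - 2) * (\<Sum>u\<in>H. (x u)\<^sup>2)"
      if "\<exists>u\<in>H. x u = 0" for x :: "nat \<Rightarrow> real"
    proof -
      obtain u0 where u0: "u0 \<in> H" "x u0 = 0" using \<open>\<exists>u\<in>H. x u = 0\<close> by blast
      let ?x = "x(v := 1)"
      have xH: "?x u = x u" if "u \<in> H" for u using that v by auto
      have "0 \<le> qform a (insert v (H - {u0})) l ?x" using psd[OF u0(1)] by (simp add: psd_def)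
      also have "\<dots> = qform a (insert v H) l ?x"
        using fin(1) u0 v by (intro qform_subset[symmetric]) auto
      also have "\<dots> = l + 2 * (\<Sum>u\<in>H. x u * a u v) + qform a H l x"
      proof -
        have 1: "(\<Sum>u'\<in>insert v H. a u u' * ?x u * ?x u') = a u v * ?x u + (\<Sum>u'\<in>H. a u u' * ?x u * x u')" for u
          using fin(1) v by (auto intro!: sum.cong)
        have 2: "(\<Sum>u\<in>insert v H. g u (?x u)) = g v 1 + (\<Sum>u\<in>H. g u (x u))" for g :: "nat \<Rightarrow> real \<Rightarrow> real"
          using fin(1) v by (auto intro!: sum.cong)
        have "(\<Sum>u\<in>insert v H. \<Sum>u'\<in>insert v H. a u u' * ?x u * ?x u') =
            (\<Sum>u'\<in>H. a v u' * x u') + (\<Sum>u\<in>H. a u v * x u + (\<Sum>u'\<in>H. a u u' * x u * x u'))"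
          unfolding 1 using 2[of "\<lambda>u y. a u v * y + (\<Sum>u'\<in>H. a u u' * y * x u')"] diag by simp
        also have "(\<Sum>u'\<in>H. a v u' * x u') = (\<Sum>u\<in>H. x u * a u v)" by (simp add: sym[of v] mult.commute)
        finally show ?thesis unfolding qform_def using 2[of "\<lambda>u y. y\<^sup>2"]
          by (simp add: sum.distrib distrib_left mult.commute)
      qed
      also have "qform a H l x = (\<Sum>i\<in>I. (\<Sum>u\<in>H. x u * r u i)\<^sup>2) + (l - 2) * (\<Sum>u\<in>H. (x u)\<^sup>2)"
        by (rule represents_qform[OF rep diag])
      finally show ?thesis by simp
    qed
  qed (use fin q N T vals in \<open>(blast | simp)+\<close>)
  show ?thesis
    using F.few_marks F.consistent F.w_I by (intro exI[of _ F.w]) blast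
qed

text \<open>\<open>v\<close> has a neighbor in \<open>H\<close>, so \<open>w\<close> is not 0. With
  two marks \<open>w\<close> is itself the vector of \<open>v\<close>; with one mark it is completed
  by a fresh coordinate, on which all old vectors vanish.\<close>

lemma represents_extend:
  assumes rep: "represents a H I r" and sym: "\<And>u v. a u v = a v u" and v: "v \<notin> H"
    and u: "u \<in> H" "a u v \<noteq> 0"
    and w: "\<And>i. w i \<in> {-1, 0, 1::real}" "\<And>i. w i \<noteq> 0 \<Longrightarrow> i \<in> I" "card {i. w i \<noteq> 0} \<le> 2"
      "\<And>u. u \<in> H \<Longrightarrow> a u v = (\<Sum>m\<in>I. w m * r u m)"
  shows "\<exists>I' r'. represents a (insert v H) I' r' \<and> card I \<le> card I'"
proof -
  have fin: "finite H" "finite I" using rep by (auto simp: represents_def)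
  have finS: "finite {i. w i \<noteq> 0}" by (rule finite_subset[OF _ fin(2)]) (use w(2) in auto)
  have "{i. w i \<noteq> 0} \<noteq> {}" using w(4)[OF u(1)] u(2) by force
  then have "card {i. w i \<noteq> 0} \<noteq> 0" using finS by (simp only: card_0_eq not_False_eq_True)
  then consider "card {i. w i \<noteq> 0} = 1" | "card {i. w i \<noteq> 0} = 2" using w(3) by linarith
  then show ?thesis
  proof cases
    case 1
    then obtain i where i: "{i. w i \<noteq> 0} = {i}" by (auto simp: card_1_singleton_iff)
    then have wi: "w i \<noteq> 0" "\<And>x. x \<noteq> i \<Longrightarrow> w x = 0" by blast+
    obtain j where j: "j \<notin> I" using ex_new_if_finite[OF infinite_UNIV_nat fin(2)] by blast
    have iI: "i \<in> I" "i \<noteq> j" using w(2) wi j by auto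
    have rj: "r u j = 0" if "u \<in> H" for u using represents_row[OF rep that, of j] j by blast
    have "represents a (insert v H) (insert j I) (r(v := (\<lambda>x. w i * delta i x + 1 * delta j x)))"
    proof (rule represents_insert[OF rep sym v iI, of "w i" 1])
      show "w i \<in> {-1, 1}" using w(1)[of i] wi by auto
      fix u assume "u \<in> H"
      have "(\<Sum>m\<in>insert j I. r u m * (w i * delta i m + 1 * delta j m)) =
          (\<Sum>m\<in>insert j I. (w i * delta i m + 1 * delta j m) * r u m)" by (simp add: mult.commute)
      also have "\<dots> = w i * r u i" using pair_sum[of "insert j I" i j "w i" 1 "r u"] fin(2) iI rj[OF \<open>u \<in> H\<close>] by simp
      also have "\<dots> = (\<Sum>m\<in>I. if m = i then w m * r u m else 0)" using fin(2) iI by simp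
      also have "\<dots> = a u v" unfolding w(4)[OF \<open>u \<in> H\<close>] using wi(2) by (intro sum.cong) auto
      finally show "a u v = (\<Sum>m\<in>insert j I. r u m * (w i * delta i m + 1 * delta j m))" by simp
    qed simp_all
    moreover have "card I \<le> card (insert j I)" using fin(2) by (intro card_mono) auto
    ultimately show ?thesis by blast
  next
    case 2
    then obtain i j where ij: "{i. w i \<noteq> 0} = {i, j}" "i \<noteq> j" by (auto simp: card_2_iff)
    then have wi: "w i \<noteq> 0" "w j \<noteq> 0" "\<And>x. x \<noteq> i \<Longrightarrow> x \<noteq> j \<Longrightarrow> w x = 0" by blast+
    have iI: "i \<in> I" "insert j I = I" using w(2) wi by auto
    have weq: "w x = w i * delta i x + w j * delta j x" for x
      using wi(3)[of x] ij(2) by (auto simp: delta_def)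
    have "represents a (insert v H) (insert j I) (r(v := w))"
    proof (rule represents_insert[OF rep sym v iI(1) ij(2)])
      show "w i \<in> {-1, 1}" "w j \<in> {-1, 1}" using w(1)[of i] w(1)[of j] wi by auto
      show "w = (\<lambda>x. w i * delta i x + w j * delta j x)" using weq by (rule ext)
      show "a u v = (\<Sum>m\<in>insert j I. r u m * w m)" if "u \<in> H" for u
        unfolding iI(2) w(4)[OF that] by (simp add: mult.commute)
    qed
    then show ?thesis unfolding iI(2) by blast
  qed
qed

text \<open>The k-th vertex receives the coordinates k and k + 1 with signs 1 and
  \<open>\<alpha> k\<close>, which reproduces the edge signs; the last sign has no edge to match and
  is set to 1. Suitable signs \<open>x\<close> make the sum of the vectors telescope to its two end
  coordinates: squared length 2 against n + 1 entries, which is why long paths violate the bound for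
  \<open>l < 2\<close>.\<close>

lemma represents_path:
  assumes sym: "\<And>u v. a u v = a v u" and vals: "\<And>u v. a u v \<in> {-1, 0, 1}"
    and \<kappa>: "\<And>k. k \<le> n \<Longrightarrow> \<kappa> (u k) = k"
    and path: "\<And>k. k < n \<Longrightarrow> a (u k) (u (Suc k)) \<noteq> 0"
    and induced: "\<And>k m. k \<le> n \<Longrightarrow> m \<le> n \<Longrightarrow> Suc k < m \<Longrightarrow> a (u k) (u m) = 0"
  shows "\<exists>r. represents a (u ` {..n}) {..Suc n} r \<and>
    (\<exists>x. (\<Sum>i\<le>Suc n. (\<Sum>v\<in>u ` {..n}. x v * r v i)\<^sup>2) = 2 \<and> (\<Sum>v\<in>u ` {..n}. (x v)\<^sup>2) = real (Suc n))"
proof -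
  define \<alpha> where "\<alpha> k = (if k < n then a (u k) (u (Suc k)) else 1)" for k
  have \<alpha>: "\<alpha> k \<in> {-1, 1}" for k using path[of k] vals[of "u k" "u (Suc k)"] by (auto simp: \<alpha>_def)
  define r where "r v = (\<lambda>x. 1 * delta (\<kappa> v) x + \<alpha> (\<kappa> v) * delta (Suc (\<kappa> v)) x)" for v
  have ru: "r (u k) = (\<lambda>x. 1 * delta k x + \<alpha> k * delta (Suc k) x)" if "k \<le> n" for k
    using \<kappa>[OF that] by (simp add: r_def)
  have inj: "inj_on u {..n}" using \<kappa> by (intro inj_on_inverseI[of _ \<kappa>]) auto
  have ip: "(\<Sum>i\<le>Suc n. r (u k) i * r (u m) i) = a (u k) (u m)" if km: "k \<le> n" "m \<le> n" "k \<noteq> m" for k m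
  proof -
    have *: "(\<Sum>i\<le>Suc n. r (u k) i * r (u m) i) = 1 * r (u m) k + \<alpha> k * r (u m) (Suc k)"
      unfolding ru[OF km(1)] using km by (intro pair_sum) auto
    consider "m = Suc k" | "k = Suc m" | "Suc k < m" | "Suc m < k" using km by linarith
    then show ?thesis
    proof cases
      case 1
      then show ?thesis unfolding * unfolding ru[OF km(2)] using km by (simp add: delta_def \<alpha>_def)
    next
      case 2
      then show ?thesis unfolding * unfolding ru[OF km(2)] using km sym[of "u k" "u m"] by (simp add: delta_def \<alpha>_def)
    next
      case 3
      then show ?thesis unfolding * unfolding ru[OF km(2)] using induced[OF km(1,2)] by (simp add: delta_def)
    next
      case 4
      then show ?thesis unfolding * unfolding ru[OF km(2)] using induced[OF km(2,1)] sym[of "u k" "u m"] by (simp add: delta_def)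
    qed
  qed
  have "no_cut (joined (u ` {..n}) r) {..Suc n}"
    unfolding no_cut_def
  proof (intro allI impI, elim conjE, rule ccontr)
    fix A assume A: "A \<subseteq> {..Suc n}" "A \<noteq> {}" "A \<noteq> {..Suc n}"
    assume no: "\<not> (\<exists>x\<in>A. \<exists>y\<in>{..Suc n} - A. joined (u ` {..n}) r x y)"
    have J: "joined (u ` {..n}) r k (Suc k)" if "k \<le> n" for k
      unfolding joined_def using that ru[OF that] \<alpha>[of k] by (intro conjI bexI[of _ "u k"]) (auto simp: delta_def)
    have step: "k \<in> A \<longleftrightarrow> Suc k \<in> A" if "k \<le> n" for k
    proof -
      have "k \<in> {..Suc n}" "Suc k \<in> {..Suc n}" using that by auto
      then show ?thesis using no J[OF that] joined_sym[OF J[OF that]] by blast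
    qed
    have "k \<le> Suc n \<Longrightarrow> k \<in> A \<longleftrightarrow> 0 \<in> A" for k
      by (induction k) (use step in auto)
    then show False using A by blast
  qed
  moreover have "\<exists>i\<in>{..Suc n}. \<exists>j\<in>{..Suc n}. i \<noteq> j \<and> (\<exists>c\<in>{-1, 1}. \<exists>d\<in>{-1, 1}.
      r v = (\<lambda>x. c * delta i x + d * delta j x))" if v: "v \<in> u ` {..n}" for v
  proof -
    obtain k where k: "k \<le> n" "v = u k" using v by auto
    show ?thesis unfolding k(2) ru[OF k(1)]
      using k(1) \<alpha>[of k] by (intro bexI[of _ k] bexI[of _ "Suc k"] conjI bexI[of _ 1] bexI[of _ "\<alpha> k"]) auto
  qed
  moreover have "(\<Sum>i\<le>Suc n. r v i * r v' i) = a v v'" if "v \<in> u ` {..n}" "v' \<in> u ` {..n}" "v \<noteq> v'" for v v'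
    using that ip by auto
  ultimately have rep: "represents a (u ` {..n}) {..Suc n} r" unfolding represents_def by simp
  define \<xi> :: "nat \<Rightarrow> real" where "\<xi> k = (\<Prod>m<k. - \<alpha> m)" for k
  have \<xi>Suc: "\<xi> (Suc k) = - \<alpha> k * \<xi> k" for k by (simp add: \<xi>_def)
  have \<xi>: "\<xi> k \<in> {-1, 1}" for k
  proof (induction k)
    case (Suc k) then show ?case using \<alpha>[of k] by (auto simp: \<xi>Suc)
  qed (simp add: \<xi>_def)
  define x where "x v = \<xi> (\<kappa> v)" for v
  have su: "(\<Sum>v\<in>u ` {..n}. g v) = (\<Sum>k\<le>n. g (u k))" for g :: "nat \<Rightarrow> real"
    using inj by (simp add: sum.reindex)
  have tele: "(\<Sum>v\<in>u ` {..n}. x v * r v i) = \<xi> 0 * delta 0 i + - \<xi> (Suc n) * delta (Suc n) i" for i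
  proof -
    have "(\<Sum>v\<in>u ` {..n}. x v * r v i) = (\<Sum>k\<le>n. \<xi> k * delta k i - \<xi> (Suc k) * delta (Suc k) i)"
      unfolding su by (intro sum.cong) (simp_all add: x_def \<kappa> ru \<xi>Suc algebra_simps)
    also have "\<dots> = \<xi> 0 * delta 0 i - \<xi> (Suc n) * delta (Suc n) i" by (rule sum_telescope)
    finally show ?thesis by simp
  qed
  have "(\<Sum>i\<le>Suc n. (\<Sum>v\<in>u ` {..n}. x v * r v i)\<^sup>2) =
      (\<Sum>i\<le>Suc n. (\<xi> 0 * delta 0 i + - \<xi> (Suc n) * delta (Suc n) i) * (\<xi> 0 * delta 0 i + - \<xi> (Suc n) * delta (Suc n) i))"
    unfolding tele by (simp only: power2_eq_square)
  also have "\<dots> = \<xi> 0 * (\<xi> 0 * delta 0 0 + - \<xi> (Suc n) * delta (Suc n) 0) +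
      - \<xi> (Suc n) * (\<xi> 0 * delta 0 (Suc n) + - \<xi> (Suc n) * delta (Suc n) (Suc n))"
    by (rule pair_sum) auto
  also have "\<dots> = 2" using \<xi>[of 0] \<xi>[of "Suc n"] by (auto simp: delta_def)
  finally have e1: "(\<Sum>i\<le>Suc n. (\<Sum>v\<in>u ` {..n}. x v * r v i)\<^sup>2) = 2" .
  have "(x (u k))\<^sup>2 = 1" for k using \<xi>[of "\<kappa> (u k)"] by (auto simp: x_def)
  then have "(\<Sum>v\<in>u ` {..n}. (x v)\<^sup>2) = real (Suc n)" unfolding su by simp
  then show ?thesis using rep e1 by blast
qed

section \<open>Minimal signed graphs below the threshold\<close>

text \<open>\<open>l\<close> may be replaced by a larger value still below
  \<open>lambda_star\<close>; this corresponds to \<open>q > qstar\<close>. The cap 0.869 lies above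
  \<open>qstar\<close> and keeps \<open>q\<close> in the short interval for which the numerical
  estimates are made.\<close>

lemma exists_parameter:
  assumes "l < lambda_star"
  shows "\<exists>q. 0.8688 < q \<and> q < 0.8692 \<and> 1 < q ^ 4 + q ^ 6 \<and> l \<le> q + 1 / q"
proof -
  define l' where "l' = max l 2"
  have "2 < lambda_star" using lambda_star_approx by (auto simp: abs_if split: if_splits)
  then have l': "2 \<le> l'" "l' < lambda_star" "l \<le> l'" using assms by (auto simp: l'_def)
  obtain t where t: "0 < t" "t \<le> 1" "l' = t + 1 / t" using exists_inverse_sum[OF l'(1)] by blast
  have "qstar < t"
    by (rule inverse_sum_less_imp) (use t l' qstar in auto)
  define q where "q = min t 0.869"
  have q: "qstar < q" "q \<le> t" "q \<le> 0.869" using \<open>qstar < t\<close> qstar(2) by (auto simp: q_def)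
  have pos: "0 < qstar" using qstar(1) by simp
  have "1 < q ^ 4 + q ^ 6"
    using power_strict_mono[of qstar q 4] power_strict_mono[of qstar q 6] q(1) pos qstar(4) by simp
  moreover have "t + 1 / t \<le> q + 1 / q" using q pos t by (intro inverse_sum_antimono) auto
  ultimately show ?thesis using q qstar(1) t(3) l'(3) by (intro exI[of _ q]) auto
qed

lemma exists_depth:
  fixes q e :: real
  assumes "0 < q" "q < 1" "0 < e"
  shows "\<exists>N>0. q ^ (2 * N - 1) < e"
proof -
  obtain m where m: "q ^ m < e" using real_arch_pow_inv[OF assms(3,2)] by blast
  have "q ^ (2 * Suc m - 1) \<le> q ^ m" using assms by (intro power_decreasing) auto
  then show ?thesis using m by (intro exI[of _ "Suc m"]) auto
qed

text \<open>Across a cut without edges the form is the sum of the forms of two proper parts, both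
  nonnegative by minimality.\<close>

lemma minimal_no_cut:
  assumes V: "finite V" "\<not> psd a V l" "\<And>U. U \<subset> V \<Longrightarrow> psd a U l" and sym: "\<And>u v. a u v = a v u"
  shows "no_cut (\<lambda>u v. a u v \<noteq> 0) V"
  unfolding no_cut_def
proof (intro allI impI, elim conjE, rule ccontr)
  fix A assume A: "A \<subseteq> V" "A \<noteq> {}" "A \<noteq> V" and no: "\<not> (\<exists>x\<in>A. \<exists>y\<in>V - A. a x y \<noteq> 0)"
  have fin: "finite A" "finite (V - A)" using A V(1) finite_subset by auto
  have z: "a x y = 0" "a y x = 0" if "x \<in> A" "y \<in> V - A" for x y using no that sym[of y x] by auto
  have split: "(\<Sum>v\<in>V. g v) = (\<Sum>v\<in>A. g v) + (\<Sum>v\<in>V - A. g v)" for g :: "'a \<Rightarrow> real"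
    using sum.subset_diff[OF A(1) V(1), of g] by simp
  have "qform a V l x = qform a A l x + qform a (V - A) l x" for x
  proof -
    have "(\<Sum>u\<in>A. \<Sum>v\<in>V. a u v * x u * x v) = (\<Sum>u\<in>A. \<Sum>v\<in>A. a u v * x u * x v)"
      using A V z by (intro sum.cong sum.mono_neutral_right) auto
    moreover have "(\<Sum>u\<in>V - A. \<Sum>v\<in>V. a u v * x u * x v) = (\<Sum>u\<in>V - A. \<Sum>v\<in>V - A. a u v * x u * x v)"
      using A V z by (intro sum.cong sum.mono_neutral_right) auto
    ultimately show ?thesis unfolding qform_def
      split[of "\<lambda>u. \<Sum>v\<in>V. a u v * x u * x v"] split[of "\<lambda>u. (x u)\<^sup>2"] by (simp add: distrib_left)
  qed
  moreover have "psd a A l" "psd a (V - A) l" using A by (auto intro!: V(3))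
  ultimately have "psd a V l" unfolding psd_def by (simp add: add_nonneg_nonneg)
  then show False using V(2) by simp
qed

text \<open>A ball count provides a geodesic of length \<open>n\<close>, which is an induced path
  and hence represented. A largest represented set with enough coordinates is not all of
  \<open>V\<close>, because represented graphs satisfy the bound for \<open>l \<ge> 2\<close>; by
  connectedness it has a neighbor, by which it can be extended.\<close>

lemma minimal_card_bound:
  assumes "l < lambda_star"
  shows "\<exists>M. \<forall>(a :: nat \<Rightarrow> nat \<Rightarrow> real) V. finite V \<longrightarrow> (\<forall>u v. a u v = a v u) \<longrightarrow> (\<forall>u. a u u = 0) \<longrightarrow>
    (\<forall>u v. a u v \<in> {-1, 0, 1}) \<longrightarrow> (\<forall>v\<in>V. card {u \<in> V. a v u \<noteq> 0} \<le> D) \<longrightarrow>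
    \<not> psd a V l \<longrightarrow> (\<forall>U. U \<subset> V \<longrightarrow> psd a U l) \<longrightarrow> card V \<le> M"
proof -
  obtain q where q: "0.8688 < q" "q < 0.8692" "1 < q ^ 4 + q ^ 6" "l \<le> q + 1 / q"
    using exists_parameter[OF assms] by blast
  define l2 where "l2 = q + 1 / q"
  obtain N where N: "0 < N" "q ^ (2 * N - 1) < min ((q ^ 4 + q ^ 6 - 1) / 100) (1 / 10000)"
    using exists_depth[of q "min ((q ^ 4 + q ^ 6 - 1) / 100) (1 / 10000)"] q by auto
  then have N': "100 * q ^ (2 * N - 1) < q ^ 4 + q ^ 6 - 1" "10000 * q ^ (2 * N - 1) < 1" by simp_all
  obtain n0 :: nat where n0: "2 / (2 - l) < real n0" using reals_Archimedean2 by blast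
  \<comment> \<open>\<open>n0\<close> is for the path in the case \<open>l < 2\<close>. The second
    term leaves room for a root farther than \<open>N\<close> from the at most \<open>2 * D\<close>
    coordinates used by neighbors of a new vertex, when coordinates have degree at most
    \<open>D + 1\<close>.\<close>
  define n where "n = max n0 (2 * D * (D + 1 + 1) ^ N)"
  have n_large: "2 * D * (D + 1 + 1) ^ N < n + 2" by (simp add: n_def)
  have n_neg: "2 + (l - 2) * real (Suc n) < 0" if "l < 2"
  proof -
    have "2 / (2 - l) < real (Suc n)" using n0 by (simp add: n_def)
    then show ?thesis using that by (simp add: field_simps)
  qed
  have bound: "card V \<le> max ((D + 1) ^ n) (n + 1)" if fin: "finite V" and sym: "\<forall>u v. a u v = a v u" and diag: "\<forall>u. a u u = 0"
      and vals: "\<forall>u v. a u v \<in> {-1, 0, 1}" and deg: "\<forall>v\<in>V. card {u \<in> V. a v u \<noteq> 0} \<le> D"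
      and bad: "\<not> psd a V l" and minimal: "\<forall>U. U \<subset> V \<longrightarrow> psd a U l" for a :: "nat \<Rightarrow> nat \<Rightarrow> real" and V
  proof (rule ccontr)
    assume "\<not> ?thesis"
    then have big: "(D + 1) ^ n < card V" "n + 1 < card V" by auto
    have nc: "no_cut (\<lambda>u v. a u v \<noteq> 0) V"
      using fin bad minimal sym by (intro minimal_no_cut) auto
    interpret C: connected_relation "\<lambda>u v. a u v \<noteq> 0" V
      by unfold_locales (use sym nc in auto)
    let ?d = "gdist (\<lambda>u v. a u v \<noteq> 0) V"
    obtain z where z: "z \<in> V" using big by fastforce
    have "card {y \<in> V. ?d z y \<le> n} \<le> (D + 1) ^ n" using C.ball_card[OF fin _ z] deg by blast
    then have "{y \<in> V. ?d z y \<le> n} \<noteq> V" using big by auto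
    then have "\<exists>y\<in>V. \<not> ?d z y \<le> n" by blast
    then obtain y where y: "y \<in> V" "n < ?d z y" using not_le by blast
    obtain u where geo: "\<forall>k\<le>?d z y. u k \<in> V \<and> ?d z (u k) = k" "\<forall>k<?d z y. a (u k) (u (Suc k)) \<noteq> 0"
      using C.geodesic[OF z y(1) refl] by blast
    have u: "u k \<in> V" "?d z (u k) = k" if "k \<le> n" for k using geo(1) that y(2) by auto
    have step: "a (u k) (u (Suc k)) \<noteq> 0" if "k < n" for k using geo(2) that y(2) by auto
    have induced: "a (u k) (u m) = 0" if km: "k \<le> n" "m \<le> n" "Suc k < m" for k m
    proof (rule ccontr)
      assume "a (u k) (u m) \<noteq> 0"
      then have "?d z (u m) \<le> Suc (?d z (u k))" using u km by (intro C.gdist_step[OF z]) auto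
      then show False using u(2) km by simp
    qed
    define H0 where "H0 = u ` {..n}"
    have H0: "H0 \<subseteq> V" using u(1) by (auto simp: H0_def)
    obtain r0 x0 where r0: "represents a H0 {..Suc n} r0"
        "(\<Sum>i\<le>Suc n. (\<Sum>v\<in>H0. x0 v * r0 v i)\<^sup>2) = 2" "(\<Sum>v\<in>H0. (x0 v)\<^sup>2) = real (Suc n)"
      using represents_path[of a n "?d z" u] sym vals u(2) step induced unfolding H0_def by blast
    have l2: "2 \<le> l"
    proof (rule ccontr)
      assume "\<not> 2 \<le> l"
      then have "qform a H0 l x0 < 0"
        using represents_qform[OF r0(1), of l x0] diag n_neg unfolding r0(2,3) by simp
      then have "\<not> psd a H0 l" unfolding psd_def by (meson not_le)
      then have "H0 = V" using minimal H0 by blast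
      moreover have "card H0 \<le> card {..n}" unfolding H0_def by (rule card_image_le) simp
      ultimately show False using big(2) by simp
    qed
    \<comment> \<open>The lower bound on the number of coordinates belongs to the maximality
      condition, since it is what provides a far root at each extension.\<close>
    define P where "P = (\<lambda>H. H \<subseteq> V \<and> (\<exists>I r. represents a H I r \<and> n + 2 \<le> card I))"
    have "P H0" unfolding P_def using H0 r0(1) by (intro conjI exI[of _ "{..Suc n}"] exI[of _ r0]) simp_all
    moreover have "\<And>H. P H \<Longrightarrow> card H < Suc (card V)" unfolding P_def using fin by (simp add: card_mono less_Suc_eq_le)
    ultimately obtain H where H: "P H" "\<And>H'. P H' \<Longrightarrow> card H' \<le> card H"
      using ex_has_greatest_nat[of P H0 card "Suc (card V)"] by blast
    obtain I r where rep: "represents a H I r" and cI: "n + 2 \<le> card I" and HV: "H \<subseteq> V"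
      using H(1) unfolding P_def by blast
    have finH: "finite H" "finite I" using rep by (auto simp: represents_def)
    show False
    proof (cases "H = V")
      case True
      have "psd a V l" unfolding psd_def
      proof
        fix x show "0 \<le> qform a V l x"
          using represents_qform[OF rep, of l x] diag l2 True
          by (simp add: sum_nonneg)
      qed
      then show False using bad by simp
    next
      case False
      have "H0 \<noteq> {}" by (simp add: H0_def)
      then have "0 < card H0" using H0 fin finite_subset by (auto simp: card_gt_0_iff)
      then have "H \<noteq> {}" using H(2)[OF \<open>P H0\<close>] by auto
      then obtain u v where uv: "u \<in> H" "v \<in> V - H" "a u v \<noteq> 0"
        using nc HV False unfolding no_cut_def by blast
      have degH: "card {w \<in> H. a x w \<noteq> 0} \<le> D" if "x \<in> V" for x
      proof -
        have "card {w \<in> H. a x w \<noteq> 0} \<le> card {w \<in> V. a x w \<noteq> 0}" using fin HV by (intro card_mono) auto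
        then show ?thesis using deg that by fastforce
      qed
      let ?J = "joined H r"
      have ncJ: "no_cut ?J I" using rep by (simp add: represents_def)
      have cJ: "connected_relation ?J I" by (rule connected_relation.intro[OF joined_sym ncJ])
      define T where "T = (\<Union>w\<in>{w \<in> H. a v w \<noteq> 0}. {i. r w i \<noteq> 0})"
      have row: "card {i. r w i \<noteq> 0} \<le> 2" "{i. r w i \<noteq> 0} \<subseteq> I" if "w \<in> H" for w
        using represents_support[OF rep that] by auto
      have "T \<subseteq> I" using row(2) unfolding T_def by blast
      moreover have "card T \<le> 2 * D"
      proof -
        have "card T \<le> (\<Sum>w\<in>{w \<in> H. a v w \<noteq> 0}. card {i. r w i \<noteq> 0})"
          unfolding T_def using finH by (intro card_UN_le) auto
        also have "\<dots> \<le> (\<Sum>w\<in>{w \<in> H. a v w \<noteq> 0}. 2)" using row(1) by (intro sum_mono) auto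
        also have "\<dots> \<le> 2 * D" using degH[of v] uv by simp
        finally show ?thesis .
      qed
      moreover have "card {j \<in> I. ?J i j} \<le> D + 1" for i
        using represents_degree[OF rep] degH HV by blast
      ultimately obtain z' where z': "z' \<in> I" "\<forall>t\<in>T. N < gdist ?J I z' t"
        using connected_relation.far_point[OF cJ finH(2), of "D + 1" T "2 * D" N] n_large cI by (metis less_le_trans)
      have "\<exists>w :: nat \<Rightarrow> real. (\<forall>i. w i \<in> {-1, 0, 1}) \<and> (\<forall>i. w i \<noteq> 0 \<longrightarrow> i \<in> I) \<and> card {i. w i \<noteq> 0} \<le> 2 \<and>
          (\<forall>u\<in>H. a u v = (\<Sum>m\<in>I. w m * r u m))"
      proof (rule extension_vector[OF rep _ _ _ _ q(1-3) l2_def N(1) N' _ z'(1)])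
        show "psd a (insert v (H - {u})) l2" if "u \<in> H" for u
        proof (rule psd_mono)
          have "insert v (H - {u}) \<subset> V" using that uv HV by auto
          then show "psd a (insert v (H - {u})) l" using minimal by blast
        qed (use q l2_def in simp)
        show "N < gdist ?J I z' i" if "w \<in> H" "a w v \<noteq> 0" "r w i \<noteq> 0" for w i
          using z'(2) that sym unfolding T_def by auto
      qed (use sym diag vals uv in auto)
      then obtain w :: "nat \<Rightarrow> real" where w: "\<forall>i. w i \<in> {-1, 0, 1}" "\<forall>i. w i \<noteq> 0 \<longrightarrow> i \<in> I"
          "card {i. w i \<noteq> 0} \<le> 2" "\<forall>u\<in>H. a u v = (\<Sum>m\<in>I. w m * r u m)" by (elim exE conjE)
      have vH: "v \<notin> H" "v \<in> V" using uv(2) by auto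
      have "\<exists>I' r'. represents a (insert v H) I' r' \<and> card I \<le> card I'"
        by (rule represents_extend[where w = w, OF rep sym[rule_format] vH(1) uv(1,3) w(1)[rule_format]
            w(2)[rule_format] w(3) w(4)[rule_format]])
      then obtain I' r' where "represents a (insert v H) I' r'" "card I \<le> card I'" by (elim exE conjE)
      then have "P (insert v H)" unfolding P_def using HV vH(2) cI
        by (intro conjI exI[of _ I'] exI[of _ r']) (simp_all add: le_trans)
      then show False using H(2)[of "insert v H"] vH finH by simp
    qed
  qed
  show ?thesis
    by (intro exI[of _ "max ((D + 1) ^ n) (n + 1)"] allI impI) (rule bound)
qed

text \<open>With \<open>- 3 * c\<close> at the center and 1 at the ten leaves, the star contributes
  - 60, the edges among the leaves at most 0, and the squares 19 l <= 57.\<close>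

lemma monochromatic_star_not_psd:
  assumes S: "finite S" "card S = 10" "v \<notin> S" and l: "l \<le> 3"
    and sym: "\<And>u w. a u w = a w u" and diag: "a v v = 0"
    and star: "\<And>u. u \<in> S \<Longrightarrow> a u v = c" "c \<in> {-1, 1}"
    and nonpos: "\<And>u w. u \<in> S \<Longrightarrow> w \<in> S \<Longrightarrow> a u w \<le> 0"
  shows "\<not> psd a (insert v S) l"
proof -
  define x where "x = (\<lambda>u. if u = v then - 3 * c else 1)"
  have xS: "x u = 1" if "u \<in> S" for u using that S(3) by (auto simp: x_def)
  have c: "c * c = 1" "c * (- 3 * c) = - 3" using star(2) by auto
  have "(\<Sum>u\<in>S. \<Sum>w\<in>insert v S. a u w * x u * x w) = (\<Sum>u\<in>S. c * (- 3 * c) + (\<Sum>w\<in>S. a u w))"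
    using S star(1) xS by (intro sum.cong refl) (simp add: x_def cong: sum.cong)
  also have "\<dots> = - 30 + (\<Sum>u\<in>S. \<Sum>w\<in>S. a u w)" unfolding c(2) sum.distrib using S by simp
  finally have 1: "(\<Sum>u\<in>S. \<Sum>w\<in>insert v S. a u w * x u * x w) = - 30 + (\<Sum>u\<in>S. \<Sum>w\<in>S. a u w)" .
  have "(\<Sum>w\<in>insert v S. a v w * x v * x w) = (\<Sum>w\<in>S. c * (- 3 * c))"
  proof -
    have "(\<Sum>w\<in>insert v S. a v w * x v * x w) = (\<Sum>w\<in>S. a v w * x v * x w)" using S diag by simp
    also have "\<dots> = (\<Sum>w\<in>S. c * (- 3 * c))"
    proof (intro sum.cong refl)
      fix w assume w: "w \<in> S"
      have "a v w = c" using star(1)[OF w] sym[of v w] by simp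
      then show "a v w * x v * x w = c * (- 3 * c)" using xS[OF w] by (simp add: x_def)
    qed
    finally show ?thesis .
  qed
  also have "\<dots> = - 30" unfolding c(2) using S by simp
  finally have 2: "(\<Sum>w\<in>insert v S. a v w * x v * x w) = - 30" .
  have 3: "(\<Sum>u\<in>insert v S. (x u)\<^sup>2) = 19"
  proof -
    have "(\<Sum>u\<in>insert v S. (x u)\<^sup>2) = (x v)\<^sup>2 + (\<Sum>u\<in>S. (x u)\<^sup>2)" using S by simp
    also have "(\<Sum>u\<in>S. (x u)\<^sup>2) = 10" using S(2) xS by simp
    also have "(x v)\<^sup>2 = 9" using star(2) by (auto simp: x_def)
    finally show ?thesis by simp
  qed
  have "(\<Sum>u\<in>S. \<Sum>w\<in>S. a u w) \<le> 0" using nonpos by (intro sum_nonpos) auto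
  then have "qform a (insert v S) l x < 0"
    unfolding qform_def 3 using 1 2 S l by simp
  then show ?thesis unfolding psd_def by (meson not_le)
qed

text \<open>Among more than \<open>9 * p\<close> neighbors ten share a color. Their edges to
  \<open>v\<close> have one common sign, decided by the color of \<open>v\<close>, and no edge among
  them is positive.\<close>

lemma large_degree_not_psd:
  assumes G: "G \<in> colorable_class p" and v: "v \<in> verts G" and l: "l \<le> 3" and U: "U \<subseteq> verts G"
    and deg: "9 * p < card {u \<in> U. adj_entry G v u \<noteq> 0}"
  shows "\<exists>S \<subseteq> verts G. card S = 11 \<and> \<not> psd (adj_entry G) S l"
proof -
  have sg: "signed_graph G" and fin: "finite U" using G U finite_subset by (auto simp: colorable_class_def signed_graph_def)
  obtain c where c: "\<And>v. v \<in> verts G \<Longrightarrow> c v < p" "\<And>u v. {u, v} \<in> neg_edges G \<Longrightarrow> c u = c v"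
      "\<And>u v. {u, v} \<in> pos_edges G \<Longrightarrow> c u \<noteq> c v"
    using G by (auto simp: colorable_class_def colorable_def)
  let ?N = "{u \<in> U. adj_entry G v u \<noteq> 0}"
  have "\<exists>k<p. 9 < card {u \<in> ?N. c u = k}"
  proof (rule ccontr)
    assume no: "\<not> ?thesis"
    have "?N \<subseteq> (\<Union>k\<in>{..<p}. {u \<in> ?N. c u = k})" using c(1) U by auto
    then have "card ?N \<le> card (\<Union>k\<in>{..<p}. {u \<in> ?N. c u = k})" using fin by (intro card_mono) auto
    also have "\<dots> \<le> (\<Sum>k<p. card {u \<in> ?N. c u = k})" by (intro card_UN_le) simp
    also have "\<dots> \<le> (\<Sum>k<p. 9)" using no by (intro sum_mono) (meson lessThan_iff not_less)
    finally show False using deg by simp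
  qed
  then obtain k where "9 < card {u \<in> ?N. c u = k}" by blast
  then have "10 \<le> card {u \<in> ?N. c u = k}" by linarith
  then obtain S where S: "S \<subseteq> {u \<in> ?N. c u = k}" "card S = 10" "finite S" by (rule obtain_subset_with_card_n)
  have vS: "v \<notin> S" using S(1) adj_entry_self[OF sg] by auto
  have "\<not> psd (adj_entry G) (insert v S) l"
  proof (rule monochromatic_star_not_psd[OF S(3,2) vS l adj_entry_commute adj_entry_self[OF sg]])
    show "adj_entry G u v = (if c v = k then -1 else 1)" if "u \<in> S" for u
    proof -
      have "adj_entry G u v \<noteq> 0" "c u = k" using that S(1) adj_entry_commute[of G u v] by auto
      then show ?thesis using c(2)[of u v] c(3)[of u v] by (auto simp: adj_entry_def split: if_splits)
    qed
    show "adj_entry G u w \<le> 0" if "u \<in> S" "w \<in> S" for u w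
    proof -
      have "c u = c w" using that S(1) by auto
      then show ?thesis using c(3)[of u w] by (auto simp: adj_entry_def)
    qed
  qed auto
  then show ?thesis using S vS v U by (intro exI[of _ "insert v S"]) auto
qed

text \<open>A violating vertex set of least size has degrees at most \<open>9 * p\<close>, so that
  \<open>minimal_card_bound\<close> applies, or a vertex of larger degree yields a violating set of
  11 vertices.\<close>

lemma bounded_obstruction:
  assumes l: "l < lambda_star"
  shows "\<exists>M. \<forall>G \<in> colorable_class p. \<not> psd (adj_entry G) (verts G) l \<longrightarrow>
    (\<exists>U \<subseteq> verts G. card U \<le> M \<and> \<not> psd (adj_entry G) U l)"
proof -
  have l3: "l \<le> 3" using l lambda_star_approx by (auto simp: abs_if split: if_splits)
  from minimal_card_bound[OF l, of "9 * p"]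
  obtain M where M: "\<forall>(a :: nat \<Rightarrow> nat \<Rightarrow> real) V. finite V \<longrightarrow> (\<forall>u v. a u v = a v u) \<longrightarrow> (\<forall>u. a u u = 0) \<longrightarrow>
      (\<forall>u v. a u v \<in> {-1, 0, 1}) \<longrightarrow> (\<forall>v\<in>V. card {u \<in> V. a v u \<noteq> 0} \<le> 9 * p) \<longrightarrow>
      \<not> psd a V l \<longrightarrow> (\<forall>U. U \<subset> V \<longrightarrow> psd a U l) \<longrightarrow> card V \<le> M" by (elim exE)
  have "\<exists>U \<subseteq> verts G. card U \<le> max M 11 \<and> \<not> psd (adj_entry G) U l"
    if G: "G \<in> colorable_class p" and bad: "\<not> psd (adj_entry G) (verts G) l" for G
  proof -
    have sg: "signed_graph G" and fin: "finite (verts G)" using G by (auto simp: colorable_class_def signed_graph_def)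
    define P where "P U \<longleftrightarrow> U \<subseteq> verts G \<and> \<not> psd (adj_entry G) U l" for U
    obtain U where U: "P U" "\<And>W. P W \<Longrightarrow> card U \<le> card W"
      using ex_has_least_nat[of P "verts G" card] bad by (auto simp: P_def)
    have finU: "finite U" using U(1) fin finite_subset by (auto simp: P_def)
    show ?thesis
    proof (cases "\<forall>v\<in>U. card {u \<in> U. adj_entry G v u \<noteq> 0} \<le> 9 * p")
      case True
      have "card U \<le> M"
      proof (rule M[rule_format, where a = "adj_entry G"])
        show "psd (adj_entry G) W l" if "W \<subset> U" for W
          using U(2)[of W] U(1) psubset_card_mono[OF finU that] that by (auto simp: P_def)
        show "\<not> psd (adj_entry G) U l" using U(1) by (simp add: P_def)
        show "card {u \<in> U. adj_entry G v u \<noteq> 0} \<le> 9 * p" if "v \<in> U" for v using True that by blast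
      qed (rule finU adj_entry_commute adj_entry_self[OF sg] adj_entry_values)+
      then show ?thesis using U(1) unfolding P_def by (intro exI[of _ U]) auto
    next
      case False
      then obtain v where "v \<in> U" "9 * p < card {u \<in> U. adj_entry G v u \<noteq> 0}" by (auto simp: not_le)
      then obtain S where "S \<subseteq> verts G" "card S = 11" "\<not> psd (adj_entry G) S l"
        using large_degree_not_psd[OF G _ l3, of v U] U(1) unfolding P_def by blast
      then show ?thesis by (intro exI[of _ S]) simp
    qed
  qed
  then show ?thesis by blast
qed

theorem theorem1p4:
  fixes p :: nat and l :: real
  assumes "p \<ge> 3"
  shows "(\<exists>\<F>. finite \<F> \<and>
            forbidden_subgraph_characterization (colorable_class p) (colorable_family p l) \<F>)
         \<longleftrightarrow> l < lambda_star"
proof (cases "l < lambda_star")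
  case True
  obtain M where "\<And>G. G \<in> colorable_class p \<Longrightarrow> \<not> psd (adj_entry G) (verts G) l \<Longrightarrow>
      \<exists>U \<subseteq> verts G. card U \<le> M \<and> \<not> psd (adj_entry G) U l"
    using bounded_obstruction[OF True, of p] by blast
  then show ?thesis using finite_characterization_if_bounded[of p l M] True by simp
next
  case False
  then show ?thesis
    using no_finite_characterization_if_limit[of p l] spectral_limit_ge_lambda_star[OF assms, of l] by simp
qed

end
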